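(* Let $(c,\kappa)\in\tilde{\mathcal{D}}$. Assume that $u\in\mathcal{X}(\mathbb{R})$ is a nontrivial weak solution to $\mathrm{TW}(c,\kappa)$ such that $\Gamma(u)=\{0\}$. Then, up to multiplication by a constant phase, $u=\sqrt{1-\eta_{c,\kappa}}\,e^{i\theta_{c,\kappa}}$, where $\eta_{c,\kappa}:\mathbb{R}\to\mathbb{R}$ is the even function defined for $x\ge0$ by $$\eta_{c,\kappa}(x)=f_{c,\kappa}^{-1}(x)\ \text{if }(c,\kappa)\in\mathcal{D}_1,\quad h_{c,\kappa}^{-1}(x)\ \text{if }(c,\kappa)\in\mathcal{D}_3,\quad g_{\kappa}^{-1}(x)\ \text{if }(c,\kappa)\in\mathcal{B}_-,\quad \tilde g_{\kappa}^{-1}(x)\ \text{if }(c,\kappa)\in\mathcal{B}_+,$$ and $\theta_{c,\kappa}(x)=\frac c2\int_0^x\frac{\eta_{c,\kappa}(y)}{1-\eta_{c,\kappa}(y)}\,dy$. In particular $\mathcal{N}(u)=\{0\}$.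
   Context: For $z_1,z_2\in\mathbb{C}$, $\langle z_1,z_2\rangle=\operatorname{Re}(z_1\overline{z_2})$. Energy space: $\mathcal{X}(\mathbb{R})=\{v\in H^1_{\mathrm{loc}}(\mathbb{R};\mathbb{C}): 1-|v|^2\in L^2(\mathbb{R}),\ v'\in L^2(\mathbb{R})\}$ (its elements are continuous). $\mathrm{TW}(c,\kappa)$ is the equation $icu'+u''+u(1-|u|^2)+\kappa u(1-|u|^2)''=0$. A function $u\in\mathcal{X}(\mathbb{R})$ is a weak solution if for all $\phi\in C_0^\infty(\mathbb{R};\mathbb{C})$, $$\int_{\mathbb{R}}\langle icu'+u(1-|u|^2),\phi\rangle-\langle u',\phi'\rangle+2\kappa\langle u,u'\rangle\langle u,\phi\rangle'=0.$$ A solution is trivial if it is a constant of modulus one. $\Gamma(u)=\{x\in\mathbb{R}:|u(x)|^2=1/(2\kappa)\}$ and $\mathcal{N}(u)$ is the set of points where $u$ is not differentiable (in the classical sense). Parameter sets: $\mathcal{D}_1=\{0\le c<\sqrt2,\ 0<\kappa<1/2\}$, $\mathcal{D}_3=\{c>\sqrt2,\ \kappa>1/2\}$, $\mathcal{B}_-=\{c=\sqrt2,\ 0<\kappa<1/2\}$, $\mathcal{B}_+=\{c=\sqrt2,\ \kappa>1/2\}$, $\tilde{\mathcal{D}}=\mathcal{D}_1\cup\mathcal{D}_3\cup\mathcal{B}_-\cup\mathcal{B}_+$. Functions: $\mathfrak{T}_\kappa=[1-\frac1{2\kappa},0)$ if $0<\kappa<1/2$; $\mathfrak{J}_\kappa=(0,1-\frac1{2\kappa}]$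 if $\kappa>1/2$. For $(c,\kappa)\in\mathcal{D}_1$, $f_{c,\kappa}:\mathfrak{T}_\kappa\to\mathbb{R}$ is $$f_{c,\kappa}(y)=2\sqrt\kappa\arctan\Big(\sqrt\kappa\sqrt{\tfrac{2-c^2-2y}{1-2\kappa+2\kappa y}}\Big)+2\sqrt{\tfrac{1-2\kappa}{2-c^2}}\operatorname{artanh}\Big(\sqrt{\tfrac{(2-c^2)(1-2\kappa+2\kappa y)}{(1-2\kappa)(2-c^2-2y)}}\Big)-\pi\sqrt\kappa.$$ For $(c,\kappa)\in\mathcal{D}_3$, $h_{c,\kappa}:\mathfrak{J}_\kappa\to\mathbb{R}$ is given by the same formula. For $(\sqrt2,\kappa)\in\mathcal{B}_-$, $g_\kappa:\mathfrak{T}_\kappa\to\mathbb{R}$ is $$g_\kappa(y)=2\sqrt\kappa\arctan\Big(\sqrt{\tfrac{-2\kappa y}{1-2\kappa+2\kappa y}}\Big)+\sqrt2\sqrt{-\tfrac{1-2\kappa+2\kappa y}{y}}-\pi\sqrt\kappa,$$ and for $(\sqrt2,\kappa)\in\mathcal{B}_+$, $\tilde g_\kappa:\mathfrak{J}_\kappa\to\mathbb{R}$ is given by the same formula as $g_\kappa$. At $y=1-\frac1{2\kappa}$ the formulas are understood by continuity ($\arctan(+\infty)=\pi/2$), giving the value $0$. These functions are bijections onto $[0,\infty)$. *)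

theory Defs
  imports "HOL-Analysis.Analysis"
begin

text \<open>The pairing \<open>\<langle>z\<^sub>1, z\<^sub>2\<rangle> = Re (z\<^sub>1 cnj z\<^sub>2)\<close> on the complex numbers is the library's real inner product:\<close>

lemma complex_pairing: "z1 \<bullet> z2 = Re (z1 * cnj z2)" for z1 z2 :: complex
  by (simp add: inner_complex_def)

definition vderiv :: "(real \<Rightarrow> 'a::real_normed_vector) \<Rightarrow> real \<Rightarrow> 'a" where
  "vderiv f = (\<lambda>x. vector_derivative f (at x))"

definition test_functions :: "(real \<Rightarrow> 'a::real_normed_vector) set" where
  "test_functions = {\<phi>. (\<forall>n x. (vderiv ^^ n) \<phi> differentiable (at x)) \<and> compact (closure {x. \<phi> x \<noteq> 0})}"

definition L2 :: "(real \<Rightarrow> 'a::euclidean_space) set" where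
  "L2 = {f. f \<in> borel_measurable lebesgue \<and> integrable lebesgue (\<lambda>x. (norm (f x))\<^sup>2)}"

definition L2_loc :: "(real \<Rightarrow> 'a::euclidean_space) set" where
  "L2_loc = {f. \<forall>a b. (\<lambda>x. indicator {a..b} x *\<^sub>R f x) \<in> L2}"

definition has_weak_deriv ::
    "(real \<Rightarrow> 'a::euclidean_space) \<Rightarrow> (real \<Rightarrow> 'a) \<Rightarrow> bool" where
  "has_weak_deriv f g \<longleftrightarrow>
     (\<forall>a b. set_integrable lebesgue {a..b} f \<and> set_integrable lebesgue {a..b} g) \<and>
     (\<forall>\<psi>::real \<Rightarrow> real. \<psi> \<in> test_functions \<longrightarrow>
        (LINT x|lebesgue. vderiv \<psi> x *\<^sub>R f x) = - (LINT x|lebesgue. \<psi> x *\<^sub>R g x))"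

text \<open>A weak derivative is unique only up to null sets; \<open>weak_deriv f\<close> picks one representative.
  It is used only for weakly differentiable functions and only in ways that do not depend on the
  representative (membership in Lebesgue spaces and integrals).\<close>

definition weak_deriv :: "(real \<Rightarrow> 'a::euclidean_space) \<Rightarrow> real \<Rightarrow> 'a" where
  "weak_deriv f = (SOME g. has_weak_deriv f g)"

definition H1_loc :: "(real \<Rightarrow> 'a::euclidean_space) set" where
  "H1_loc = {f. f \<in> L2_loc \<and> (\<exists>g. has_weak_deriv f g) \<and> weak_deriv f \<in> L2_loc}"

text \<open>Every class in \<open>H1_loc\<close> has exactly one continuous representative; elements of the energy
  space are identified with it, so that their pointwise values make sense.\<close>

definition energy_space :: "(real \<Rightarrow> complex) set" where
  "energy_space = {v. v \<in> H1_loc \<and> continuous_on UNIV v \<and>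
     (\<lambda>x. 1 - (cmod (v x))\<^sup>2) \<in> L2 \<and> weak_deriv v \<in> L2}"

definition TW_weak_solution :: "real \<Rightarrow> real \<Rightarrow> (real \<Rightarrow> complex) \<Rightarrow> bool" where
  "TW_weak_solution c \<kappa> u \<longleftrightarrow> u \<in> energy_space \<and>
     (\<forall>\<phi>::real \<Rightarrow> complex. \<phi> \<in> test_functions \<longrightarrow>
       (LINT x|lebesgue.
          (\<i> * of_real c * weak_deriv u x + u x * of_real (1 - (cmod (u x))\<^sup>2)) \<bullet> \<phi> x
          - weak_deriv u x \<bullet> vderiv \<phi> x
          + 2 * \<kappa> * (u x \<bullet> weak_deriv u x) * weak_deriv (\<lambda>y. u y \<bullet> \<phi> y) x) = 0)"

definition trivial_solution :: "(real \<Rightarrow> complex) \<Rightarrow> bool" where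
  "trivial_solution u \<longleftrightarrow> (\<exists>a. cmod a = 1 \<and> (\<forall>x. u x = a))"

definition Gamma_set :: "real \<Rightarrow> (real \<Rightarrow> complex) \<Rightarrow> real set" where
  "Gamma_set \<kappa> u = {x. (cmod (u x))\<^sup>2 = 1 / (2 * \<kappa>)}"

definition nondiff_set :: "(real \<Rightarrow> complex) \<Rightarrow> real set" where
  "nondiff_set u = {x. \<not> u differentiable (at x)}"

definition D1 :: "(real \<times> real) set" where
  "D1 = {(c, \<kappa>). 0 \<le> c \<and> c < sqrt 2 \<and> 0 < \<kappa> \<and> \<kappa> < 1/2}"

definition D3 :: "(real \<times> real) set" where
  "D3 = {(c, \<kappa>). c > sqrt 2 \<and> \<kappa> > 1/2}"

definition B_minus :: "(real \<times> real) set" where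
  "B_minus = {(c, \<kappa>). c = sqrt 2 \<and> 0 < \<kappa> \<and> \<kappa> < 1/2}"

definition B_plus :: "(real \<times> real) set" where
  "B_plus = {(c, \<kappa>). c = sqrt 2 \<and> \<kappa> > 1/2}"

definition D_tilde :: "(real \<times> real) set" where
  "D_tilde = D1 \<union> D3 \<union> B_minus \<union> B_plus"

definition T_int :: "real \<Rightarrow> real set" where
  "T_int \<kappa> = {1 - 1 / (2 * \<kappa>)..<0}"

definition J_int :: "real \<Rightarrow> real set" where
  "J_int \<kappa> = {0<..1 - 1 / (2 * \<kappa>)}"

text \<open>\<open>fh_fun c \<kappa>\<close> is \<open>f\<close> on \<open>T_int \<kappa>\<close> for \<open>(c, \<kappa>) \<in> D1\<close> and \<open>h\<close> on \<open>J_int \<kappa>\<close> for \<open>(c, \<kappa>) \<in> D3\<close>.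
  At the closed endpoint the argument of the arctangent is infinite and the formula is read with
  \<open>arctan \<infinity> = pi/2\<close>, which gives 0; evaluating it with \<open>x / 0 = 0\<close> would give a wrong value.
  The same applies to \<open>g_fun\<close>, which is used on \<open>T_int \<kappa>\<close> for \<open>B_minus\<close> and on \<open>J_int \<kappa>\<close> for \<open>B_plus\<close>.\<close>

definition fh_fun :: "real \<Rightarrow> real \<Rightarrow> real \<Rightarrow> real" where
  "fh_fun c \<kappa> y =
     (if y = 1 - 1 / (2 * \<kappa>) then 0
      else 2 * sqrt \<kappa> * arctan (sqrt \<kappa> * sqrt ((2 - c\<^sup>2 - 2 * y) / (1 - 2 * \<kappa> + 2 * \<kappa> * y)))
         + 2 * sqrt ((1 - 2 * \<kappa>) / (2 - c\<^sup>2)) *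
             artanh (sqrt (((2 - c\<^sup>2) * (1 - 2 * \<kappa> + 2 * \<kappa> * y)) / ((1 - 2 * \<kappa>) * (2 - c\<^sup>2 - 2 * y))))
         - pi * sqrt \<kappa>)"

definition g_fun :: "real \<Rightarrow> real \<Rightarrow> real" where
  "g_fun \<kappa> y =
     (if y = 1 - 1 / (2 * \<kappa>) then 0
      else 2 * sqrt \<kappa> * arctan (sqrt ((- 2 * \<kappa> * y) / (1 - 2 * \<kappa> + 2 * \<kappa> * y)))
         + sqrt 2 * sqrt (- ((1 - 2 * \<kappa> + 2 * \<kappa> * y) / y))
         - pi * sqrt \<kappa>)"

text \<open>The four parameter sets are disjoint, so the order of the cases is immaterial; evenness is
  built in through the absolute value.\<close>

definition eta :: "real \<Rightarrow> real \<Rightarrow> real \<Rightarrow> real" where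
  "eta c \<kappa> x =
     (if (c, \<kappa>) \<in> D1 then inv_into (T_int \<kappa>) (fh_fun c \<kappa>) \<bar>x\<bar>
      else if (c, \<kappa>) \<in> D3 then inv_into (J_int \<kappa>) (fh_fun c \<kappa>) \<bar>x\<bar>
      else if (c, \<kappa>) \<in> B_minus then inv_into (T_int \<kappa>) (g_fun \<kappa>) \<bar>x\<bar>
      else inv_into (J_int \<kappa>) (g_fun \<kappa>) \<bar>x\<bar>)"

text \<open>The interval integral is oriented, so this is the intended value also for negative \<open>x\<close>.\<close>

definition theta :: "real \<Rightarrow> real \<Rightarrow> real \<Rightarrow> real" where
  "theta c \<kappa> x = c / 2 * (LBINT y=0..x. eta c \<kappa> y / (1 - eta c \<kappa> y))"

end

theory Submission
  imports Defs
begin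

text \<open>
  Testing the equation shows that \<open>u' - 2 \<kappa> \<langle>u, u'\<rangle> u\<close> is absolutely continuous. The linear map
  \<open>w \<mapsto> w - 2 \<kappa> \<langle>u, w\<rangle> u\<close> is invertible exactly off \<open>\<Gamma>(u)\<close>, so \<open>u\<close> solves the equation classically on
  each half-line. There the momentum \<open>\<langle>\<i> u, u'\<rangle> - c \<eta> / 2\<close> and the energy
  \<open>|u'|\<^sup>2 - \<eta>\<^sup>2 / 2 - \<kappa> \<eta>'\<^sup>2 / 2\<close>, where \<open>\<eta> = 1 - |u|\<^sup>2\<close>, are constant, and the constants vanish because
  \<open>\<eta>\<close> and \<open>u'\<close> are square integrable. Eliminating \<open>u'\<close> gives
  \<open>\<eta>'\<^sup>2 (1 - 2 \<kappa> + 2 \<kappa> \<eta>) = \<eta>\<^sup>2 (2 - c\<^sup>2 - 2 \<eta>)\<close>, and \<open>f\<close>, \<open>h\<close>, \<open>g\<close> are antiderivatives of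
  the resulting separable equation, so that \<open>f (\<eta> x) = x\<close> for \<open>x \<ge> 0\<close>. The momentum identity determines the
  phase, and \<open>\<eta>'\<close> blows up at \<open>0\<close> because the factor \<open>1 - 2 \<kappa> + 2 \<kappa> \<eta>\<close> vanishes there.
\<close>

section \<open>Smooth test functions\<close>

text \<open>A weak solution may fail to be differentiable at the origin, so nothing is carried
  across it by differentiation: each half-line has its own constants of motion, to be determined on
  that side. Square integrability gives no pointwise decay, only points where \<eta> and u' are both
  as small as desired, and the argument is arranged so that such points suffice. The reflection x ->
  -x, which turns c into -c, reduces the left half-line to the right one, as the profile equation
  contains only c^2. The conserved quantities come from pairing the equation with \<i> u and with
  u'; the elimination rests on |u|^2 |u'|^2 = <u, u'>^2 + <\<i> u, u'>^2. The profile equation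
  leaves the sign of \<eta>' open and degenerates where \<eta> = 0, so it has to be shown that
  \<eta> never reaches 0 and that |\<eta>| decreases. At the origin the two halves are glued by
  continuity of u alone, which fixes a single phase because u does not vanish there.\<close>

definition smooth :: "(real \<Rightarrow> 'a::real_normed_vector) \<Rightarrow> bool" where
  "smooth f \<longleftrightarrow> (\<forall>n x. (vderiv ^^ n) f differentiable (at x))"

lemma vderiv_eqI: "(\<And>x. (f has_vector_derivative f' x) (at x)) \<Longrightarrow> vderiv f = f'"
  by (auto simp: vderiv_def fun_eq_iff intro: vector_derivative_at)

text \<open>Every iterate of \<open>vderiv\<close> stays in \<open>S\<close>, so closure of
  \<open>S\<close> under differentiation replaces any formula for higher derivatives.\<close>

lemma smooth_coinduct:
  assumes "f \<in> S"
    and "\<And>f. f \<in> S \<Longrightarrow> \<exists>f'\<in>S. \<forall>x. (f has_vector_derivative f' x) (at x)"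
  shows "smooth f"
proof -
  have "(vderiv ^^ n) f \<in> S" for n
  proof (induction n)
    case (Suc n)
    then obtain f' where "f' \<in> S" "\<forall>x. ((vderiv ^^ n) f has_vector_derivative f' x) (at x)"
      using assms(2) by blast
    then show ?case using vderiv_eqI[of "(vderiv ^^ n) f" f'] by simp
  qed (use assms in simp)
  then show ?thesis unfolding smooth_def
    by (metis assms(2) differentiableI_vector)
qed

lemma smooth_has_vderiv: "smooth f \<Longrightarrow> (f has_vector_derivative vderiv f x) (at x)"
  unfolding smooth_def vderiv_def by (metis funpow_0 vector_derivative_works)

lemma smooth_vderiv: "smooth f \<Longrightarrow> smooth (vderiv f)"
  unfolding smooth_def by (metis comp_apply funpow_Suc_right)

lemma smooth_continuous: "smooth f \<Longrightarrow> continuous_on A f"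
  using smooth_has_vderiv[of f]
  by (meson continuous_at_imp_continuous_on has_vector_derivative_continuous)

lemma smooth_antideriv:
  assumes "\<And>x. (F has_vector_derivative f x) (at x)" "smooth f"
  shows "smooth F"
proof (rule smooth_coinduct[where S = "insert F (Collect smooth)"])
  show "\<exists>g'\<in>insert F (Collect smooth). \<forall>x. (g has_vector_derivative g' x) (at x)"
    if "g \<in> insert F (Collect smooth)" for g
    using that assms smooth_has_vderiv smooth_vderiv by blast
qed simp

text \<open>Products alone are not closed under differentiation: Leibniz' rule produces sums of
  products. Closing up under both makes \<open>smooth_coinduct\<close> applicable.\<close>

inductive_set smooth_algebra :: "(real \<Rightarrow> real) set" where
  base: "smooth f \<Longrightarrow> f \<in> smooth_algebra"
| add: "f \<in> smooth_algebra \<Longrightarrow> g \<in> smooth_algebra \<Longrightarrow> (\<lambda>x. f x + g x) \<in> smooth_algebra"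
| mult: "f \<in> smooth_algebra \<Longrightarrow> g \<in> smooth_algebra \<Longrightarrow> (\<lambda>x. f x * g x) \<in> smooth_algebra"

lemma smooth_algebra_smooth:
  assumes "f \<in> smooth_algebra"
  shows "smooth f"
proof (rule smooth_coinduct[OF assms])
  show "\<exists>f'\<in>smooth_algebra. \<forall>x. (f has_vector_derivative f' x) (at x)" if "f \<in> smooth_algebra" for f
    using that
  proof induction
    case (base f)
    then show ?case using smooth_has_vderiv smooth_vderiv smooth_algebra.base by blast
  next
    case (add f g)
    then obtain f' g' where "f' \<in> smooth_algebra" "\<forall>x. (f has_vector_derivative f' x) (at x)"
      "g' \<in> smooth_algebra" "\<forall>x. (g has_vector_derivative g' x) (at x)" by blast
    then show ?case
      by (intro bexI[of _ "\<lambda>x. f' x + g' x"] allI has_vector_derivative_add smooth_algebra.add) auto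
  next
    case (mult f g)
    then obtain f' g' where "f' \<in> smooth_algebra" "\<forall>x. (f has_vector_derivative f' x) (at x)"
      "g' \<in> smooth_algebra" "\<forall>x. (g has_vector_derivative g' x) (at x)" by blast
    then show ?case using mult
      by (intro bexI[of _ "\<lambda>x. f x * g' x + f' x * g x"] allI has_vector_derivative_mult
          smooth_algebra.add smooth_algebra.mult) auto
  qed
qed

lemma smooth_const: "smooth (\<lambda>x. c)"
  by (rule smooth_coinduct[where S = "range (\<lambda>c x. c)"]) (auto intro!: exI[of _ 0])

lemma smooth_add: "smooth f \<Longrightarrow> smooth g \<Longrightarrow> smooth (\<lambda>x. f x + g x)" for f g :: "real \<Rightarrow> real"
  by (rule smooth_algebra_smooth[OF smooth_algebra.add[OF smooth_algebra.base smooth_algebra.base]])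

lemma smooth_mult: "smooth f \<Longrightarrow> smooth g \<Longrightarrow> smooth (\<lambda>x. f x * g x)" for f g :: "real \<Rightarrow> real"
  by (rule smooth_algebra_smooth[OF smooth_algebra.mult[OF smooth_algebra.base smooth_algebra.base]])

lemma smooth_scaleR:
  fixes f :: "real \<Rightarrow> real" and e :: "'a::real_normed_vector"
  assumes "smooth f" shows "smooth (\<lambda>x. f x *\<^sub>R e)"
proof (rule smooth_coinduct[where S = "{\<lambda>x. f x *\<^sub>R e |f. smooth f}"])
  show "\<exists>g'\<in>{\<lambda>x. f x *\<^sub>R e |f. smooth f}. \<forall>x. (g has_vector_derivative g' x) (at x)"
    if g: "g \<in> {\<lambda>x. f x *\<^sub>R e |f. smooth f}" for g
  proof -
    from g obtain f where f: "smooth f" "g = (\<lambda>x. f x *\<^sub>R e)" by auto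
    have "(g has_vector_derivative vderiv f x *\<^sub>R e) (at x)" for x
      using has_vector_derivative_scaleR[of f "vderiv f x" x UNIV "\<lambda>x. e" 0] smooth_has_vderiv[OF f(1)] f(2)
      by (auto simp: has_real_derivative_iff_has_vector_derivative)
    then show ?thesis using smooth_vderiv[OF f(1)]
      by (intro bexI[of _ "\<lambda>x. vderiv f x *\<^sub>R e"]) auto
  qed
qed (use assms in auto)

lemma smooth_affine:
  fixes f :: "real \<Rightarrow> real"
  assumes "smooth f" shows "smooth (\<lambda>x. f (a * x + b))"
\<comment> \<open>The factor \<open>k\<close> collects the powers of \<open>a\<close> that the chain
  rule produces.\<close>
proof (rule smooth_coinduct[where S = "{\<lambda>x. k * f (a * x + b) |f k. smooth f}"])
  show "\<exists>g'\<in>{\<lambda>x. k * (f :: real \<Rightarrow> real) (a * x + b) |f k. smooth f}. \<forall>x. (g has_vector_derivative g' x) (at x)"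
    if "g \<in> {\<lambda>x::real. k * (f :: real \<Rightarrow> real) (a * x + b) |f k. smooth f}" for g
  proof -
    from that obtain f k where f: "smooth f" "g = (\<lambda>x. k * f (a * x + b))" by auto
    have 1: "(f has_real_derivative vderiv f y) (at y)" for y
      using smooth_has_vderiv[OF f(1)] by (simp add: has_real_derivative_iff_has_vector_derivative)
    have "(g has_real_derivative (k * a) * vderiv f (a * x + b)) (at x)" for x
    proof -
      have "((\<lambda>x. a * x + b) has_real_derivative a) (at x)"
        by (auto intro!: derivative_eq_intros)
      from DERIV_cmult[OF DERIV_chain2[OF 1 this], of k] show ?thesis
        unfolding f(2) by (simp add: mult_ac)
    qed
    then have "\<forall>x. (g has_vector_derivative (k * a) * vderiv f (a * x + b)) (at x)"
      by (simp add: has_real_derivative_iff_has_vector_derivative)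
    then show ?thesis using smooth_vderiv[OF f(1)]
      by (intro bexI[of _ "\<lambda>x. (k * a) * vderiv f (a * x + b)"]) auto
  qed
qed (use assms in \<open>auto intro!: exI[of _ f] exI[of _ 1]\<close>)

section \<open>Bump functions built from exp(-1/x)\<close>

definition flat_exp :: "nat \<Rightarrow> real \<Rightarrow> real" where
  "flat_exp n x = (if x \<le> 0 then 0 else (1 / x) ^ n * exp (- (1 / x)))"

text \<open>With t = 1 / x the functions are t^n exp(-t), and d/dx is -t^2 d/dt. The power n is
  carried along because this keeps the family closed up to linear combinations.\<close>

lemma flat_exp_deriv:
  "(flat_exp n has_real_derivative (- real n) * flat_exp (n + 1) x + flat_exp (n + 2) x) (at x)"
proof -
  consider "x < 0" | "x = 0" | "x > 0" by linarith
  then show ?thesis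
  proof cases
    case 1
    have "((\<lambda>x. 0) has_real_derivative 0) (at x)" by simp
    then have "(flat_exp n has_real_derivative 0) (at x)"
      by (rule has_field_derivative_transform_within_open[where S = "{..<0}"])
        (use 1 in \<open>auto simp: flat_exp_def\<close>)
    then show ?thesis using 1 by (simp add: flat_exp_def)
  next
    case 2
    \<comment> \<open>From the right, the difference quotient at 0 is t^(n+1) exp(-t) with t = 1 / y
      tending to infinity.\<close>
    have lim: "((\<lambda>y. (1 / y) ^ Suc n * exp (- (1 / y))) \<longlongrightarrow> 0) (at_right (0::real))"
    proof -
      have "((\<lambda>t. t ^ Suc n / exp t) \<longlongrightarrow> (0::real)) at_top" by (rule tendsto_power_div_exp_0)
      moreover have "filterlim (\<lambda>y. 1 / y) at_top (at_right (0::real))" by (simp add: divide_inverse filterlim_inverse_at_top_right)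
      ultimately have "((\<lambda>y. (1/y) ^ Suc n / exp (1/y)) \<longlongrightarrow> (0::real)) (at_right 0)"
        by (rule filterlim_compose)
      then show ?thesis by (simp add: exp_minus field_simps)
    qed
    have "((\<lambda>y. (flat_exp n y - flat_exp n 0) / (y - 0)) \<longlongrightarrow> 0) (at 0)"
    proof (rule filterlim_split_at)
      have "eventually (\<lambda>y. y < 0) (at_left (0::real))"
        by (simp add: eventually_at_filter)
      then show "((\<lambda>y. (flat_exp n y - flat_exp n 0) / (y - 0)) \<longlongrightarrow> 0) (at_left 0)"
        by (intro tendsto_eventually, eventually_elim) (auto simp: flat_exp_def)
      have "eventually (\<lambda>y. y > 0) (at_right (0::real))"
        by (simp add: eventually_at_filter)
      then show "((\<lambda>y. (flat_exp n y - flat_exp n 0) / (y - 0)) \<longlongrightarrow> 0) (at_right 0)"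
        by (intro Lim_transform_eventually[OF lim], eventually_elim) (auto simp: flat_exp_def field_simps)
    qed
    then show ?thesis using 2 by (simp add: has_field_derivative_iff flat_exp_def)
  next
    case 3
    have "((\<lambda>x. (1 / x) ^ n * exp (- (1 / x))) has_real_derivative
       (- real n) * flat_exp (n + 1) x + flat_exp (n + 2) x) (at x)"
    proof -
      have D: "((\<lambda>x. 1 / x) has_real_derivative - ((1 / x)\<^sup>2)) (at x)"
        using 3 by (auto intro!: derivative_eq_intros simp: power2_eq_square)
      have D': "((\<lambda>x. (1 / x) ^ n * exp (- (1 / x))) has_real_derivative
         real n * (1 / x) ^ (n - 1) * - ((1 / x)\<^sup>2) * exp (- (1 / x)) +
         (1 / x) ^ n * (exp (- (1 / x)) * (1 / x)\<^sup>2)) (at x)"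
      proof -
        have "((\<lambda>x. exp (- (1 / x))) has_real_derivative exp (- (1 / x)) * (1 / x)\<^sup>2) (at x)"
          using DERIV_chain2[OF DERIV_exp DERIV_minus[OF D]] by simp
        from DERIV_mult[OF DERIV_power[OF D, of n] this] show ?thesis
          by (simp add: mult_ac)
      qed
      have "real n * t ^ (n - 1) * - t\<^sup>2 * E + t ^ n * (E * t\<^sup>2)
        = (- real n) * (t ^ (n + 1) * E) + t ^ (n + 2) * E" for t E :: real
        by (cases n) (simp_all add: power2_eq_square algebra_simps)
      from D'[unfolded this[of "1 / x" "exp (- (1 / x))"]] show ?thesis
        using 3 by (simp add: flat_exp_def)
    qed
    then show ?thesis
      by (rule has_field_derivative_transform_within_open[where S = "{0<..}"])
        (use 3 in \<open>auto simp: flat_exp_def\<close>)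
  qed
qed

text \<open>The linear span absorbs the two terms in the derivative of \<open>flat_exp\<close>, as
  \<open>smooth_coinduct\<close> requires.\<close>

inductive_set flat_span :: "(real \<Rightarrow> real) set" where
  base: "flat_exp n \<in> flat_span"
| add: "f \<in> flat_span \<Longrightarrow> g \<in> flat_span \<Longrightarrow> (\<lambda>x. f x + g x) \<in> flat_span"
| scale: "f \<in> flat_span \<Longrightarrow> (\<lambda>x. c * f x) \<in> flat_span"

lemma smooth_flat_exp: "smooth (flat_exp n)"
proof (rule smooth_coinduct[OF flat_span.base])
  show "\<exists>f'\<in>flat_span. \<forall>x. (f has_vector_derivative f' x) (at x)" if "f \<in> flat_span" for f
    using that
  proof induction
    case (base n)
    show ?case
      by (rule bexI[of _ "\<lambda>x. (- real n) * flat_exp (n + 1) x + flat_exp (n + 2) x"])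
        (use flat_exp_deriv flat_span.add[OF flat_span.scale[OF flat_span.base] flat_span.base] in
          \<open>simp_all only: has_real_derivative_iff_has_vector_derivative simp_thms\<close>)
  next
    case (add f g)
    then obtain f' g' where "f' \<in> flat_span" "\<forall>x. (f has_vector_derivative f' x) (at x)"
      "g' \<in> flat_span" "\<forall>x. (g has_vector_derivative g' x) (at x)" by blast
    then show ?case
      by (intro bexI[of _ "\<lambda>x. f' x + g' x"] allI has_vector_derivative_add flat_span.add) auto
  next
    case (scale f c)
    then obtain f' where "f' \<in> flat_span" "\<forall>x. (f has_vector_derivative f' x) (at x)" by blast
    then show ?case
      by (intro bexI[of _ "\<lambda>x. c * f' x"] allI flat_span.scale)
        (auto intro: has_vector_derivative_mult_right)
  qed
qed

text \<open>The dilation \<open>k\<close> steepens the flanks without moving the support: as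
  \<open>k\<close> grows, the bumps approximate the indicator of the open interval while staying
  below 1, as dominated convergence requires.\<close>

definition bump :: "real \<Rightarrow> real \<Rightarrow> real \<Rightarrow> real \<Rightarrow> real" where
  "bump k s t x = flat_exp 0 (k * (x - s)) * flat_exp 0 (k * (t - x))"

lemma smooth_bump: "smooth (bump k s t)"
proof -
  have "smooth (\<lambda>x. flat_exp 0 (k * x + - k * s) * flat_exp 0 (- k * x + k * t))"
    by (intro smooth_mult smooth_affine smooth_flat_exp)
  also have "(\<lambda>x. flat_exp 0 (k * x + - k * s) * flat_exp 0 (- k * x + k * t)) = bump k s t"
    by (simp add: bump_def fun_eq_iff algebra_simps)
  finally show ?thesis .
qed

lemma flat_exp_0_bounds: "0 \<le> flat_exp 0 x" "flat_exp 0 x \<le> 1"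
  by (auto simp: flat_exp_def)

lemma bump_bounds: "0 \<le> bump k s t x" "bump k s t x \<le> 1"
  using flat_exp_0_bounds unfolding bump_def by (auto intro: mult_le_one)

lemma bump_eq_0: "k > 0 \<Longrightarrow> x \<notin> {s<..<t} \<Longrightarrow> bump k s t x = 0"
  by (auto simp: bump_def flat_exp_def mult_le_0_iff)

lemma bump_pos: "k > 0 \<Longrightarrow> x \<in> {s<..<t} \<Longrightarrow> bump k s t x > 0"
  by (auto simp: bump_def flat_exp_def mult_le_0_iff)

lemma flat_exp_0_tendsto: "x > 0 \<Longrightarrow> (\<lambda>n. flat_exp 0 (real (Suc n) * x)) \<longlonglongrightarrow> 1"
proof -
  assume x: "x > 0"
  have "(\<lambda>n. exp (- (inverse (real (Suc n)) * (1 / x)))) \<longlonglongrightarrow> exp (- (0 * (1 / x)))"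
    by (intro tendsto_intros LIMSEQ_inverse_real_of_nat)
  moreover have "flat_exp 0 (real (Suc n) * x) = exp (- (inverse (real (Suc n)) * (1 / x)))" for n
  proof -
    have "real (Suc n) * x > 0" using x by simp
    then show ?thesis unfolding flat_exp_def by (simp add: divide_inverse)
  qed
  ultimately show ?thesis by simp
qed

lemma bump_tendsto: "(\<lambda>n. bump (real (Suc n)) s t x) \<longlonglongrightarrow> indicator {s<..<t} x"
proof (cases "x \<in> {s<..<t}")
  case True
  then have "(\<lambda>n. bump (real (Suc n)) s t x) \<longlonglongrightarrow> 1 * 1"
    unfolding bump_def by (intro tendsto_mult flat_exp_0_tendsto) auto
  then show ?thesis using True by simp
next
  case False
  then show ?thesis using bump_eq_0[OF _ False] by simp
qed

section \<open>Test functions and their supports\<close>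

lemma test_functionsI:
  assumes "smooth f" "\<And>x. x \<notin> {a..b} \<Longrightarrow> f x = 0"
  shows "f \<in> test_functions"
proof -
  have "{x. f x \<noteq> 0} \<subseteq> {a..b}" using assms(2) by blast
  then have "closure {x. f x \<noteq> 0} \<subseteq> {a..b}" by (simp add: closure_minimal)
  then have "compact (closure {x. f x \<noteq> 0})"
    using bounded_subset[OF bounded_closed_interval] by (auto simp: compact_eq_bounded_closed)
  with assms(1) show ?thesis by (simp add: test_functions_def smooth_def)
qed

lemma test_functions_smooth: "f \<in> test_functions \<Longrightarrow> smooth f"
  by (simp add: test_functions_def smooth_def)

lemma test_functions_support:
  assumes "f \<in> test_functions"
  obtains N :: real where "N > 0" "\<And>x. x \<notin> {-N..N} \<Longrightarrow> f x = 0" "\<And>x. x \<notin> {-N..N} \<Longrightarrow> vderiv f x = 0"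
proof -
  have "bounded {x. f x \<noteq> 0}"
    using assms by (intro bounded_subset[OF compact_imp_bounded closure_subset]) (simp add: test_functions_def)
  then obtain N where N: "N > 0" "\<And>x. f x \<noteq> 0 \<Longrightarrow> norm x \<le> N"
    unfolding bounded_pos by blast
  have z: "f x = 0" if "x \<notin> {-N..N}" for x using N(2)[of x] that by (cases "f x = 0") auto
  have "vderiv f x = 0" if "x \<notin> {-N..N}" for x
  proof -
    have "((\<lambda>x. 0) has_vector_derivative 0) (at x)" by simp
    then have "(f has_vector_derivative 0) (at x)"
      by (rule has_vector_derivative_transform_within_open[where S = "- {-N..N}"])
        (use that z in \<open>auto simp: open_Compl\<close>)
    then show ?thesis by (simp add: vderiv_def vector_derivative_at)
  qed
  with N(1) z that[of N] show ?thesis by simp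
qed

lemma test_functions_vderiv:
  assumes f: "f \<in> test_functions" shows "vderiv f \<in> test_functions"
proof -
  obtain N where "\<And>x. x \<notin> {-N..N} \<Longrightarrow> vderiv f x = 0"
    using test_functions_support[OF f] by metis
  then show ?thesis by (rule test_functionsI[OF smooth_vderiv[OF test_functions_smooth[OF f]]])
qed

lemma bump_test: "k > 0 \<Longrightarrow> bump k s t \<in> test_functions"
  by (rule test_functionsI[of _ s t]) (auto simp: smooth_bump bump_eq_0)

section \<open>Weak derivatives on the line\<close>

lemma continuous_lebesgue_measurable:
  "continuous_on UNIV f \<Longrightarrow> f \<in> borel_measurable lebesgue"
  by (intro measurable_completion) (simp add: borel_measurable_continuous_onI)

lemma continuous_scaleR_set_integrable:
  fixes f :: "real \<Rightarrow> real" and g :: "real \<Rightarrow> 'a::euclidean_space"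
  assumes f: "continuous_on UNIV f" and g: "set_integrable lebesgue {a..b} g"
  shows "set_integrable lebesgue {a..b} (\<lambda>x. f x *\<^sub>R g x)"
proof -
  have "bounded (f ` {a..b})"
    by (intro compact_imp_bounded compact_continuous_image) (auto intro: continuous_on_subset[OF f])
  then obtain K where K: "\<And>x. x \<in> {a..b} \<Longrightarrow> norm (f x) \<le> K"
    unfolding bounded_iff by blast
  have eq: "(\<lambda>x. indicator {a..b} x *\<^sub>R f x *\<^sub>R g x) = (\<lambda>x. f x *\<^sub>R indicator {a..b} x *\<^sub>R g x)" by auto
  show ?thesis unfolding set_integrable_def
  proof (rule Bochner_Integration.integrable_bound)
    show "integrable lebesgue (\<lambda>x. K *\<^sub>R (indicator {a..b} x *\<^sub>R g x))"
      using g unfolding set_integrable_def by (rule integrable_scaleR_right)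
    show "(\<lambda>x. indicator {a..b} x *\<^sub>R f x *\<^sub>R g x) \<in> borel_measurable lebesgue"
      unfolding eq using g unfolding set_integrable_def
      by (intro borel_measurable_scaleR[OF continuous_lebesgue_measurable[OF f]]) auto
    have "\<bar>f x\<bar> * norm (g x) \<le> \<bar>K\<bar> * norm (g x)" if "x \<in> {a..b}" for x
      using K[OF that] by (intro mult_right_mono) auto
    then show "AE x in lebesgue. norm (indicator {a..b} x *\<^sub>R f x *\<^sub>R g x) \<le> norm (K *\<^sub>R indicator {a..b} x *\<^sub>R g x)"
      by (intro AE_I2) (auto simp: indicator_def)
  qed
qed

lemma test_scaleR_integrable:
  fixes f :: "real \<Rightarrow> real" and g :: "real \<Rightarrow> 'a::euclidean_space"
  assumes f: "f \<in> test_functions" and g: "\<And>a b. set_integrable lebesgue {a..b} g"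
  shows "integrable lebesgue (\<lambda>x. f x *\<^sub>R g x)"
proof -
  obtain N where N: "\<And>x. x \<notin> {-N..N} \<Longrightarrow> f x = 0"
    using test_functions_support[OF f] by metis
  have "set_integrable lebesgue {-N..N} (\<lambda>x. f x *\<^sub>R g x)"
    by (intro continuous_scaleR_set_integrable smooth_continuous test_functions_smooth f g)
  moreover have "(\<lambda>x. indicator {-N..N} x *\<^sub>R f x *\<^sub>R g x) = (\<lambda>x. f x *\<^sub>R g x)"
    using N by (auto simp: indicator_def fun_eq_iff)
  ultimately show ?thesis by (simp add: set_integrable_def)
qed

section \<open>The fundamental lemma of the calculus of variations\<close>

lemma sigma_finite_lebesgue: "sigma_finite_measure (lebesgue :: real measure)"
proof
  have "(\<Union>n. {- real n..real n}) = UNIV"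
  proof -
    have "\<exists>n. x \<in> {- real n..real n}" for x :: real
      using real_arch_simple[of "\<bar>x\<bar>"] by (force simp: abs_le_iff)
    then show ?thesis by auto
  qed
  then show "\<exists>A::real set set. countable A \<and> A \<subseteq> sets lebesgue \<and> \<Union> A = space lebesgue \<and> (\<forall>a\<in>A. emeasure lebesgue a \<noteq> \<infinity>)"
    by (intro exI[of _ "range (\<lambda>n. {- real n..real n})"]) auto
qed

text \<open>Uniqueness of densities and Fubini's theorem are both applied to the completed measure
  itself.\<close>

interpretation lebesgue: sigma_finite_measure "lebesgue :: real measure"
  by (rule sigma_finite_lebesgue)

text \<open>Dynkin's argument: open intervals are stable under intersection and generate the Borel
  sets, Lebesgue sets differ from Borel sets by null sets, and a density whose integrals over all
  measurable sets vanish is zero almost everywhere.\<close>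

lemma interval_integrals_zero_imp_AE_zero:
  fixes G :: "real \<Rightarrow> 'a::euclidean_space"
  assumes G: "integrable lebesgue G"
    and z: "\<And>s t. (LINT x:{s<..<t}|lebesgue. G x) = 0"
  shows "AE x in lebesgue. G x = 0"
proof (rule lebesgue.density_zero[OF G])
  have gen: "sets (borel :: real measure) = sigma_sets UNIV (range (\<lambda>(a, b). {a<..<b}))"
  proof -
    have eq: "(\<lambda>(a, b). box a b) = (\<lambda>(a, b). {a<..<b::real})" by (auto simp: fun_eq_iff)
    have "sets (borel :: real measure) = sigma_sets UNIV (range (\<lambda>(a, b). box a b))"
      by (subst borel_eq_box) simp
    then show ?thesis by (simp only: eq)
  qed
  have si: "set_integrable lebesgue A G" if "A \<in> sets lebesgue" for A
    using that G unfolding set_integrable_def by (rule integrable_mult_indicator)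
  have bor: "B \<in> sets lebesgue" if "B \<in> sets borel" for B :: "real set"
    using that by (simp add: sets_completionI_sets)
  \<comment> \<open>Complements are handled by subtraction from the whole line, which is itself no
    interval \<open>{s<..<t}\<close>.\<close>
  have whole: "(LINT x|lebesgue. G x) = 0"
  proof -
    have "(\<lambda>n. LINT x|lebesgue. indicator {- real n<..<real n} x *\<^sub>R G x) \<longlonglongrightarrow> (LINT x|lebesgue. G x)"
    proof (rule integral_dominated_convergence[where w = "\<lambda>x. norm (G x)"])
      show "AE x in lebesgue. (\<lambda>n. indicator {- real n<..<real n} x *\<^sub>R G x) \<longlonglongrightarrow> G x"
      proof (intro AE_I2 tendsto_eventually)
        fix x :: real
        obtain m where m: "\<bar>x\<bar> < real m" using reals_Archimedean2 by blast
        show "\<forall>\<^sub>F n in sequentially. indicator {- real n<..<real n} x *\<^sub>R G x = G x"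
          using eventually_ge_at_top[of m] by eventually_elim (use m in \<open>auto simp: indicator_def\<close>)
      qed
    next
      show "(\<lambda>x. indicator {- real n<..<real n} x *\<^sub>R G x) \<in> borel_measurable lebesgue" for n
        using si[of "{- real n<..<real n}"] by (auto simp: set_integrable_def)
      show "AE x in lebesgue. norm (indicat_real {- real n<..<real n} x *\<^sub>R G x) \<le> norm (G x)" for n
        by (auto simp: indicator_def)
    qed (use G in auto)
    then show ?thesis using z by (simp add: set_lebesgue_integral_def LIMSEQ_const_iff)
  qed
  have borel0: "(LINT x:B|lebesgue. G x) = 0" if "B \<in> sets borel" for B
  proof (rule sigma_sets_induct_disjoint[of "range (\<lambda>(a, b). {a<..<b})" UNIV B
        "\<lambda>B. (LINT x:B|lebesgue. G x) = 0"])
    show "Int_stable (range (\<lambda>(a, b). {a<..<b::real}))"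
    proof (rule Int_stableI_image[of UNIV "\<lambda>(a,b). {a<..<b::real}"])
      show "\<exists>c\<in>UNIV. (case a of (a, b) \<Rightarrow> {a<..<b}) \<inter> (case b of (a, b) \<Rightarrow> {a<..<b}) = (case c of (a, b) \<Rightarrow> {a<..<b})"
        for a b :: "real \<times> real"
        by (rule bexI[of _ "(max (fst a) (fst b), min (snd a) (snd b))"]) auto
    qed
  next
    fix A assume A: "A \<in> sigma_sets UNIV (range (\<lambda>(a, b). {a<..<b::real}))" "(LINT x:A|lebesgue. G x) = 0"
    then have A': "A \<in> sets lebesgue" using bor gen by auto
    have "(LINT x:UNIV - A|lebesgue. G x) = (LINT x|lebesgue. G x - indicator A x *\<^sub>R G x)"
      unfolding set_lebesgue_integral_def by (intro Bochner_Integration.integral_cong) (auto simp: indicator_def)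
    also have "\<dots> = 0"
      using A(2) whole si[OF A'] G unfolding set_lebesgue_integral_def set_integrable_def
      by (subst Bochner_Integration.integral_diff) simp_all
    finally show "(LINT x:UNIV - A|lebesgue. G x) = 0" .
  next
    fix A :: "nat \<Rightarrow> real set"
    assume A: "disjoint_family A" "range A \<subseteq> sigma_sets UNIV (range (\<lambda>(a, b). {a<..<b::real}))"
      "\<And>i. (LINT x:A i|lebesgue. G x) = 0"
    have m: "A i \<in> sets lebesgue" for i using A(2) bor[of "A i"] unfolding gen by blast
    have "(LINT x:(\<Union>i. A i)|lebesgue. G x) = (\<Sum>i. LINT x:A i|lebesgue. G x)"
      by (intro lebesgue_integral_countable_add m si) (use A(1) m in \<open>auto simp: disjoint_family_on_def\<close>)
    then show "(LINT x:(\<Union>i. A i)|lebesgue. G x) = 0" by (simp add: A(3))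
  qed (use that gen z in \<open>auto simp: set_lebesgue_integral_def\<close>)
  fix A :: "real set" assume "A \<in> sets lebesgue"
  then obtain S N N' where A: "A = S \<union> N" "N \<subseteq> N'" "N' \<in> null_sets lborel" "S \<in> sets lborel"
    by (rule sets_completionE)
  have "AE x in lebesgue. x \<notin> N'" using A(3) by (intro AE_not_in null_sets_completionI)
  then have "(LINT x:A|lebesgue. G x) = (LINT x:S|lebesgue. G x)"
    unfolding set_lebesgue_integral_def
  proof (intro integral_cong_AE)
    show "(\<lambda>x. indicat_real A x *\<^sub>R G x) \<in> borel_measurable lebesgue"
      using si[OF \<open>A \<in> sets lebesgue\<close>] unfolding set_integrable_def by auto
    show "(\<lambda>x. indicat_real S x *\<^sub>R G x) \<in> borel_measurable lebesgue"
      using si[OF bor] A(4) unfolding set_integrable_def by auto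
    show "AE x in lebesgue. indicat_real A x *\<^sub>R G x = indicat_real S x *\<^sub>R G x"
      using \<open>AE x in lebesgue. x \<notin> N'\<close> by eventually_elim (use A in \<open>auto simp: indicator_def\<close>)
  qed
  then show "(LINT x:A|lebesgue. G x) = 0" using borel0 A(4) by simp
qed

text \<open>Bumps turn the hypothesis into vanishing integrals over bounded intervals. Since
  \<open>g\<close> is only locally integrable, the conclusion is drawn for cut-offs to
  \<open>{- real n..real n}\<close> and collected over all n.\<close>

lemma fundamental_lemma:
  fixes g :: "real \<Rightarrow> 'a::euclidean_space"
  assumes g: "\<And>a b. set_integrable lebesgue {a..b} g"
    and z: "\<And>\<psi>::real \<Rightarrow> real. \<psi> \<in> test_functions \<Longrightarrow> (LINT x|lebesgue. \<psi> x *\<^sub>R g x) = 0"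
  shows "AE x in lebesgue. g x = 0"
proof -
  have int0: "(LINT x:{s<..<t}|lebesgue. g x) = 0" for s t
  proof -
    have "(\<lambda>n. LINT x|lebesgue. bump (real (Suc n)) s t x *\<^sub>R g x) \<longlonglongrightarrow> (LINT x:{s<..<t}|lebesgue. g x)"
      unfolding set_lebesgue_integral_def
    proof (rule integral_dominated_convergence[where w = "\<lambda>x. norm (indicator {s..t} x *\<^sub>R g x)"])
      show "integrable lebesgue (\<lambda>x. norm (indicat_real {s..t} x *\<^sub>R g x))"
        using g[of s t] unfolding set_integrable_def by (rule integrable_norm)
      have "set_integrable lebesgue {s<..<t} g"
        by (rule set_integrable_subset[OF g[of s t]]) auto
      then show "(\<lambda>x. indicat_real {s<..<t} x *\<^sub>R g x) \<in> borel_measurable lebesgue"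
        unfolding set_integrable_def by auto
      show "(\<lambda>x. bump (real (Suc i)) s t x *\<^sub>R g x) \<in> borel_measurable lebesgue" for i
        using test_scaleR_integrable[OF bump_test g] by auto
      show "AE x in lebesgue. (\<lambda>i. bump (real (Suc i)) s t x *\<^sub>R g x) \<longlonglongrightarrow> indicat_real {s<..<t} x *\<^sub>R g x"
        by (intro AE_I2 tendsto_scaleR bump_tendsto tendsto_const)
      show "AE x in lebesgue. norm (bump (real (Suc i)) s t x *\<^sub>R g x) \<le> norm (indicat_real {s..t} x *\<^sub>R g x)" for i
      proof (intro AE_I2)
        fix x
        show "norm (bump (real (Suc i)) s t x *\<^sub>R g x) \<le> norm (indicat_real {s..t} x *\<^sub>R g x)"
          using bump_bounds[of "real (Suc i)" s t x] bump_eq_0[of "real (Suc i)" x s t]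
          by (cases "x \<in> {s<..<t}") (auto intro: mult_left_le_one_le)
      qed
    qed
    then show ?thesis using z[OF bump_test] by (simp add: LIMSEQ_const_iff)
  qed
  have "AE x in lebesgue. indicator {- real n..real n} x *\<^sub>R g x = 0" for n
  proof (rule interval_integrals_zero_imp_AE_zero)
    show "integrable lebesgue (\<lambda>x. indicat_real {- real n..real n} x *\<^sub>R g x)"
      using g unfolding set_integrable_def .
    fix s t :: real
    \<comment> \<open>The intersection of the two intervals is an interval up to the endpoints of
      the cut-off, which form a null set.\<close>
    have "(LINT x:{s<..<t}|lebesgue. indicat_real {- real n..real n} x *\<^sub>R g x)
      = (LINT x:{max s (- real n)<..<min t (real n)}|lebesgue. g x)"
      unfolding set_lebesgue_integral_def
    proof (intro integral_cong_AE)
      have "set_integrable lebesgue ({s<..<t} \<inter> {- real n..real n}) g"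
        by (rule set_integrable_subset[OF g[of "- real n" "real n"]]) auto
      then show "(\<lambda>x. indicat_real {s<..<t} x *\<^sub>R indicat_real {- real n..real n} x *\<^sub>R g x) \<in> borel_measurable lebesgue"
        unfolding set_integrable_def by (auto simp: indicator_inter_arith)
      have "set_integrable lebesgue {max s (- real n)<..<min t (real n)} g"
        by (rule set_integrable_subset[OF g[of "- real n" "real n"]]) auto
      then show "(\<lambda>x. indicat_real {max s (- real n)<..<min t (real n)} x *\<^sub>R g x) \<in> borel_measurable lebesgue"
        unfolding set_integrable_def by auto
      have "AE x in lebesgue. x \<noteq> real n \<and> x \<noteq> - real n"
        by (intro AE_conjI AE_completion AE_lborel_singleton)
      then show "AE x in lebesgue. indicat_real {s<..<t} x *\<^sub>R indicat_real {- real n..real n} x *\<^sub>R g x =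
                  indicat_real {max s (- real n)<..<min t (real n)} x *\<^sub>R g x"
        by eventually_elim (auto simp: indicator_def)
    qed
    then show "(LINT x:{s<..<t}|lebesgue. indicat_real {- real n..real n} x *\<^sub>R g x) = 0" using int0 by simp
  qed
  then have "AE x in lebesgue. \<forall>n. indicator {- real n..real n} x *\<^sub>R g x = 0"
    by (simp only: AE_all_countable) simp
  then show ?thesis
  proof eventually_elim
    case (elim x)
    obtain n where "\<bar>x\<bar> < real n" using reals_Archimedean2 by blast
    then show ?case using elim[rule_format, of n] by (auto simp: indicator_def split: if_splits)
  qed
qed

text \<open>Fubini on the triangle \<open>- N \<le> y \<le> x \<le> N\<close>.\<close>

lemma integration_by_parts_test:
  fixes g :: "real \<Rightarrow> 'a::euclidean_space" and F :: "real \<Rightarrow> 'a"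
  assumes g: "\<And>a b. set_integrable lebesgue {a..b} g"
    and F: "\<And>s t. s \<le> t \<Longrightarrow> F t - F s = (LINT x:{s..t}|lebesgue. g x)"
    and \<psi>: "(\<psi> :: real \<Rightarrow> real) \<in> test_functions"
  shows "(LINT x|lebesgue. vderiv \<psi> x *\<^sub>R F x) = - (LINT x|lebesgue. \<psi> x *\<^sub>R g x)"
proof -
  interpret P: pair_sigma_finite "lebesgue :: real measure" "lebesgue :: real measure" ..
  obtain N where N: "N > 0" "\<And>x. x \<notin> {-N..N} \<Longrightarrow> \<psi> x = 0" "\<And>x. x \<notin> {-N..N} \<Longrightarrow> vderiv \<psi> x = 0"
    using test_functions_support[OF \<psi>] by metis
  have cont: "continuous_on A (vderiv \<psi>)" for A
    by (intro smooth_continuous smooth_vderiv test_functions_smooth \<psi>)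
  define h where "h x y = (indicator {-N..x} y * vderiv \<psi> x) *\<^sub>R (indicator {-N..N} y *\<^sub>R g y)" for x y
  \<comment> \<open>The same integrand with the triangle as a subset of the plane; in this form
    joint measurability can be checked.\<close>
  define k where "k p = indicator {p. - N \<le> snd p \<and> snd p \<le> fst p} p *\<^sub>R
      (vderiv \<psi> (fst p) *\<^sub>R (indicator {-N..N} (snd p) *\<^sub>R g (snd p)))" for p
  have hk: "case_prod h = k" by (auto simp: fun_eq_iff h_def k_def indicator_def)
  have gN: "integrable lebesgue (\<lambda>y. indicator {-N..N} y *\<^sub>R g y)"
    using g[of "-N" N] by (simp add: set_integrable_def)
  have idm: "(\<lambda>x. x) \<in> borel_measurable (lebesgue :: real measure)"
    by (rule continuous_lebesgue_measurable) auto
  have FTC: "(vderiv \<psi> has_integral (\<psi> b - \<psi> a)) {a..b}" if "a \<le> b" for a b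
    by (rule fundamental_theorem_of_calculus[OF that])
      (use smooth_has_vderiv[OF test_functions_smooth[OF \<psi>]] in \<open>auto intro: has_vector_derivative_at_within\<close>)
  have absint: "set_integrable lebesgue {a..b} (vderiv \<psi>)" for a b
    by (rule absolutely_integrable_continuous_real[OF cont])
  have LINTpsi: "(LINT x:{a..b}|lebesgue. vderiv \<psi> x) = \<psi> b - \<psi> a" if "a \<le> b" for a b
    using set_lebesgue_integral_eq_integral(2)[OF absint] FTC[OF that] by (simp add: integral_unique)
  have psiint: "integrable lebesgue (vderiv \<psi>)"
    using test_scaleR_integrable[OF test_functions_vderiv[OF \<psi>], of "\<lambda>x. 1::real"] by simp
  have int: "integrable (lebesgue \<Otimes>\<^sub>M lebesgue) (case_prod h)"
  proof (rule P.Fubini_integrable)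
    have m1[measurable]: "fst \<in> borel_measurable ((lebesgue :: real measure) \<Otimes>\<^sub>M (lebesgue :: real measure))"
      by (rule measurable_compose[OF measurable_fst idm])
    have m2[measurable]: "snd \<in> borel_measurable ((lebesgue :: real measure) \<Otimes>\<^sub>M (lebesgue :: real measure))"
      by (rule measurable_compose[OF measurable_snd idm])
    have m3[measurable]: "(\<lambda>p. vderiv \<psi> (fst p)) \<in> borel_measurable ((lebesgue :: real measure) \<Otimes>\<^sub>M (lebesgue :: real measure))"
      by (rule measurable_compose[OF measurable_fst continuous_lebesgue_measurable[OF cont]])
    have m4[measurable]: "(\<lambda>p. indicator {-N..N} (snd p) *\<^sub>R g (snd p)) \<in> borel_measurable ((lebesgue :: real measure) \<Otimes>\<^sub>M (lebesgue :: real measure))"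
      by (rule measurable_compose[OF measurable_snd]) (use gN in auto)
    have m5[measurable]: "Measurable.pred ((lebesgue :: real measure) \<Otimes>\<^sub>M (lebesgue :: real measure)) (\<lambda>p. - N \<le> snd p \<and> snd p \<le> fst p)"
      by measurable
    have "k \<in> borel_measurable (lebesgue \<Otimes>\<^sub>M lebesgue)" unfolding k_def by measurable
    then show "case_prod h \<in> borel_measurable (lebesgue \<Otimes>\<^sub>M lebesgue)" by (simp add: hk)
    have hi: "integrable lebesgue (h x)" for x
    proof -
      have "integrable lebesgue (\<lambda>y. vderiv \<psi> x *\<^sub>R (indicator {-N..x} y *\<^sub>R (indicator {-N..N} y *\<^sub>R g y)))"
        by (intro integrable_scaleR_right integrable_mult_indicator gN) simp
      then show ?thesis by (simp add: h_def[abs_def] mult_ac)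
    qed
    then show "AE x in lebesgue. integrable lebesgue (\<lambda>y. case_prod h (x, y))" by simp
    show "integrable lebesgue (\<lambda>x. LINT y|lebesgue. norm (case_prod h (x, y)))"
    proof (rule Bochner_Integration.integrable_bound)
      show "integrable lebesgue (\<lambda>x. norm (vderiv \<psi> x) * (LINT y|lebesgue. norm (indicator {-N..N} y *\<^sub>R g y)))"
        by (intro integrable_mult_left integrable_norm psiint)
      show "(\<lambda>x. LINT y|lebesgue. norm (case_prod h (x, y))) \<in> borel_measurable lebesgue"
        using \<open>case_prod h \<in> borel_measurable (lebesgue \<Otimes>\<^sub>M lebesgue)\<close>
        by (intro lebesgue.borel_measurable_lebesgue_integral) (simp add: case_prod_beta')
      show "AE x in lebesgue. norm (LINT y|lebesgue. norm (case_prod h (x, y)))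
          \<le> norm (norm (vderiv \<psi> x) * (LINT y|lebesgue. norm (indicator {-N..N} y *\<^sub>R g y)))"
      proof (intro AE_I2)
        fix x
        have "(LINT y|lebesgue. norm (h x y)) \<le> (LINT y|lebesgue. norm (vderiv \<psi> x) * norm (indicator {-N..N} y *\<^sub>R g y))"
          by (intro integral_mono integrable_norm hi integrable_mult_right gN)
            (auto simp: h_def indicator_def)
        then show "norm (LINT y|lebesgue. norm (case_prod h (x, y)))
          \<le> norm (norm (vderiv \<psi> x) * (LINT y|lebesgue. norm (indicator {-N..N} y *\<^sub>R g y)))"
          by (simp add: abs_mult)
      qed
    qed
  qed
  \<comment> \<open>Integration in y alone reproduces the increment of \<open>F\<close>; for
    \<open>right\<close> below, integration in x alone gives the increment of \<psi> from y to N,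
    which is -\<psi>(y).\<close>
  have left: "(LINT y|lebesgue. h x y) = vderiv \<psi> x *\<^sub>R (F x - F (-N))" for x
  proof (cases "x \<in> {-N..N}")
    case True
    have "(LINT y|lebesgue. h x y) = (LINT y|lebesgue. vderiv \<psi> x *\<^sub>R (indicator {-N..x} y *\<^sub>R g y))"
      by (rule Bochner_Integration.integral_cong) (use True in \<open>auto simp: h_def indicator_def\<close>)
    also have "\<dots> = vderiv \<psi> x *\<^sub>R (F x - F (-N))"
      using F[of "-N" x] True by (simp add: set_lebesgue_integral_def del: scaleR_scaleR)
    finally show ?thesis .
  next
    case False
    then have "vderiv \<psi> x = 0" by (rule N(3))
    then show ?thesis by (simp add: h_def)
  qed
  have right: "(LINT x|lebesgue. h x y) = - (\<psi> y *\<^sub>R g y)" for y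
  proof (cases "y \<in> {-N..N}")
    case True
    have "(LINT x|lebesgue. h x y) = (LINT x|lebesgue. (indicator {y..N} x *\<^sub>R vderiv \<psi> x) *\<^sub>R g y)"
      by (rule Bochner_Integration.integral_cong) (use True N(3) in \<open>auto simp: h_def indicator_def\<close>)
    also have "\<dots> = (LINT x:{y..N}|lebesgue. vderiv \<psi> x) *\<^sub>R g y"
      using absint[of y N] unfolding set_lebesgue_integral_def set_integrable_def
      by (intro integral_scaleR_left) auto
    also have "\<dots> = (\<psi> N - \<psi> y) *\<^sub>R g y" using LINTpsi[of y N] True by simp
    \<comment> \<open>The support bound says nothing at N itself; the value there follows from
      continuity from the right.\<close>
    also have "\<psi> N = 0"
    proof -
      have "continuous_on UNIV \<psi>" by (intro smooth_continuous test_functions_smooth \<psi>)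
      then have "isCont \<psi> N" by (simp add: continuous_on_eq_continuous_at)
      then have "(\<psi> \<longlongrightarrow> \<psi> N) (at_right N)" by (simp add: continuous_at_imp_continuous_at_within isCont_def tendsto_within_subset filterlim_at_split)
      moreover have "(\<psi> \<longlongrightarrow> 0) (at_right N)"
        by (intro tendsto_eventually) (auto simp: eventually_at_filter N(2))
      ultimately show ?thesis using tendsto_unique[of "at_right N"] by auto
    qed
    finally show ?thesis by simp
  next
    case False
    then show ?thesis using N(2)[of y] by (simp add: h_def)
  qed
  have Fcont: "(\<lambda>x. vderiv \<psi> x *\<^sub>R (F x - F (-N))) = (\<lambda>x. LINT y|lebesgue. h x y)"
    by (simp add: left)
  have i1: "integrable lebesgue (\<lambda>x. vderiv \<psi> x *\<^sub>R (F x - F (-N)))"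
    unfolding Fcont using P.integrable_fst[OF int] .
  have "(LINT x|lebesgue. vderiv \<psi> x *\<^sub>R (F x - F (-N))) = (LINT y|lebesgue. - (\<psi> y *\<^sub>R g y))"
    using P.Fubini_integral[OF int] by (simp add: left right)
  also have "\<dots> = - (LINT y|lebesgue. \<psi> y *\<^sub>R g y)" by simp
  finally have main: "(LINT x|lebesgue. vderiv \<psi> x *\<^sub>R (F x - F (-N))) = - (LINT y|lebesgue. \<psi> y *\<^sub>R g y)" .
  \<comment> \<open>The constant F(-N) contributes nothing because \<open>vderiv \<psi>\<close> has
    integral zero. The interval is widened by 1 so that \<psi> is known to vanish at both
    ends.\<close>
  have "(LINT x|lebesgue. vderiv \<psi> x) = (LINT x:{-N-1..N+1}|lebesgue. vderiv \<psi> x)"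
    unfolding set_lebesgue_integral_def
  proof (rule Bochner_Integration.integral_cong)
    show "vderiv \<psi> x = indicat_real {- N - 1..N + 1} x *\<^sub>R vderiv \<psi> x" for x
      using N(3)[of x] by (cases "x \<in> {-N..N}") auto
  qed simp
  also have "\<dots> = 0" using LINTpsi[of "-N-1" "N+1"] N(1) N(2)[of "-N-1"] N(2)[of "N+1"] by simp
  finally have z: "(LINT x|lebesgue. vderiv \<psi> x) = 0" .
  have "(LINT x|lebesgue. vderiv \<psi> x *\<^sub>R F x) = (LINT x|lebesgue. vderiv \<psi> x *\<^sub>R (F x - F (-N)) + vderiv \<psi> x *\<^sub>R F (-N))"
    by (simp add: algebra_simps)
  also have "\<dots> = (LINT x|lebesgue. vderiv \<psi> x *\<^sub>R (F x - F (-N)))"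
    using i1 psiint z by (subst Bochner_Integration.integral_add) simp_all
  finally show ?thesis using main by simp
qed

section \<open>Primitives and weak derivatives\<close>

lemma ex_primitive:
  fixes g :: "real \<Rightarrow> 'a::euclidean_space"
  assumes g: "\<And>a b. set_integrable lebesgue {a..b} g"
  obtains F where "continuous_on UNIV F" "\<And>s t. s \<le> t \<Longrightarrow> F t - F s = (LINT x:{s..t}|lebesgue. g x)"
proof -
  define F where "F x = (if x \<ge> 0 then integral {0..x} g else - integral {x..0} g)" for x
  have io: "g integrable_on {a..b}" for a b
    using g[of a b] by (rule set_lebesgue_integral_eq_integral(1))
  have inc: "F t - F s = integral {s..t} g" if "s \<le> t" for s t
  proof -
    consider "0 \<le> s" | "s < 0" "0 \<le> t" | "t < 0" by linarith
    then show ?thesis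
    proof cases
      case 1
      then show ?thesis using Henstock_Kurzweil_Integration.integral_combine[of 0 s t g] io that by (simp add: F_def algebra_simps)
    next
      case 2
      then show ?thesis using Henstock_Kurzweil_Integration.integral_combine[of s 0 t g] io that by (simp add: F_def algebra_simps)
    next
      case 3
      then show ?thesis using Henstock_Kurzweil_Integration.integral_combine[of s t 0 g] io that by (simp add: F_def algebra_simps)
    qed
  qed
  have "isCont F x" for x
  proof -
    have "continuous_on {x-1..x+1} (\<lambda>t. F (x-1) + integral {x-1..t} g)"
      by (intro continuous_intros indefinite_integral_continuous_1 io)
    then have "continuous_on {x-1..x+1} F"
    proof (rule continuous_on_eq)
      show "F (x - 1) + integral {x-1..t} g = F t" if "t \<in> {x-1..x+1}" for t
        using inc[of "x-1" t] that by (simp add: algebra_simps)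
    qed
    then show ?thesis by (rule continuous_on_interior) simp
  qed
  then have "continuous_on UNIV F" by (simp add: continuous_on_eq_continuous_at)
  moreover have "F t - F s = (LINT x:{s..t}|lebesgue. g x)" if "s \<le> t" for s t
    using inc[OF that] set_lebesgue_integral_eq_integral(2)[OF g] by simp
  ultimately show ?thesis by (rule that)
qed

lemma continuous_set_integrable:
  fixes F :: "real \<Rightarrow> 'a::euclidean_space"
  shows "continuous_on UNIV F \<Longrightarrow> set_integrable lebesgue {a..b} F"
  by (rule absolutely_integrable_continuous_real, erule continuous_on_subset, rule subset_UNIV)

text \<open>Du Bois-Reymond: a test function with integral zero is the derivative of a test
  function. Subtracting from \<zeta> its integral m times a fixed \<rho> of integral 1 enforces
  this, and the error is m times the pairing of \<rho> with \<open>D\<close>, which identifies the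
  constant.\<close>

lemma zero_weak_deriv_imp_const:
  fixes D :: "real \<Rightarrow> 'a::euclidean_space"
  assumes D: "\<And>a b. set_integrable lebesgue {a..b} D"
    and z: "\<And>\<psi>::real \<Rightarrow> real. \<psi> \<in> test_functions \<Longrightarrow> (LINT x|lebesgue. vderiv \<psi> x *\<^sub>R D x) = 0"
  obtains C where "AE x in lebesgue. D x = C"
proof -
  define I where "I = (LINT x|lebesgue. bump 1 0 1 x)"
  have testint: "integrable lebesgue \<zeta>" if "\<zeta> \<in> test_functions" for \<zeta> :: "real \<Rightarrow> real"
    using test_scaleR_integrable[OF that, of "\<lambda>x. 1::real"] by simp
  have b: "bump 1 0 1 \<in> test_functions" by (rule bump_test) simp
  have "I > 0"
  proof -
    have "I \<noteq> 0"
    proof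
      assume "I = 0"
      then have "AE x in lebesgue. bump 1 0 1 x = 0"
        using integral_nonneg_eq_0_iff_AE[OF testint[OF b]] bump_bounds by (auto simp: I_def)
      then have "AE x in lebesgue. x \<notin> {0<..<1::real}"
        by eventually_elim (metis bump_pos zero_less_one less_irrefl)
      then have "{0<..<1::real} \<in> null_sets lebesgue"
        by (subst AE_iff_null_sets) auto
      then show False by (auto simp: null_sets_def)
    qed
    moreover have "I \<ge> 0" unfolding I_def by (rule Bochner_Integration.integral_nonneg) (use bump_bounds in auto)
    ultimately show ?thesis by simp
  qed
  define \<rho> where "\<rho> x = (1 / I) * bump 1 0 1 x" for x
  have smooth_rho: "smooth \<rho>" unfolding \<rho>_def by (intro smooth_mult smooth_const smooth_bump)
  have rho: "\<rho> \<in> test_functions"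
    by (rule test_functionsI[OF smooth_rho, of 0 1]) (auto simp: \<rho>_def bump_eq_0)
  have Irho: "(LINT x|lebesgue. \<rho> x) = 1" using \<open>I > 0\<close> by (simp add: \<rho>_def I_def)
  define C where "C = (LINT x|lebesgue. \<rho> x *\<^sub>R D x)"
  have "AE x in lebesgue. D x - C = 0"
  proof (rule fundamental_lemma)
    show "set_integrable lebesgue {a..b} (\<lambda>x. D x - C)" for a b
      by (intro set_integral_diff D continuous_set_integrable) auto
    fix \<zeta> :: "real \<Rightarrow> real" assume \<zeta>: "\<zeta> \<in> test_functions"
    define m where "m = (LINT x|lebesgue. \<zeta> x)"
    define q where "q x = \<zeta> x + (- m) * \<rho> x" for x
    have smooth_q: "smooth q" unfolding q_def
      by (intro smooth_add smooth_mult smooth_const smooth_rho test_functions_smooth \<zeta>)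
    obtain N where N: "N > 0" "\<And>x. x \<notin> {-N..N} \<Longrightarrow> \<zeta> x = 0" using test_functions_support[OF \<zeta>] by metis
    obtain M where M: "M > 0" "\<And>x. x \<notin> {-M..M} \<Longrightarrow> \<rho> x = 0" using test_functions_support[OF rho] by metis
    have q0: "q x = 0" if "x \<notin> {-(N + M)..N + M}" for x
    proof -
      have "x \<notin> {-N..N}" "x \<notin> {-M..M}" using that N(1) M(1) by auto
      then show ?thesis using N(2)[of x] M(2)[of x] by (simp add: q_def)
    qed
    have q: "q \<in> test_functions" by (rule test_functionsI[OF smooth_q q0])
    obtain Q where Q: "continuous_on UNIV Q" "\<And>s t. s \<le> t \<Longrightarrow> Q t - Q s = (LINT x:{s..t}|lebesgue. q x)"
      using ex_primitive[OF continuous_set_integrable[OF smooth_continuous[OF smooth_q]]] by metis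
    define K where "K = N + M"
    \<comment> \<open>Normalised to vanish at the left end; on the right it vanishes because q has
      integral zero.\<close>
    define \<psi> where "\<psi> x = Q x - Q (- K)" for x
    have dQ: "(\<psi> has_vector_derivative q x) (at x)" for x
    proof -
      have "((\<lambda>t. integral {x-1..t} q) has_vector_derivative q x) (at x within {x-1..x+1})"
        by (intro integral_has_vector_derivative smooth_continuous smooth_q) auto
      then have "((\<lambda>t. integral {x-1..t} q) has_vector_derivative q x) (at x)"
        by (simp add: at_within_Icc_at)
      then have "((\<lambda>t. (Q (x-1) - Q (-K)) + integral {x-1..t} q) has_vector_derivative q x) (at x)"
        using has_vector_derivative_add[OF has_vector_derivative_const[of "Q (x-1) - Q (-K)"]] by simp
      note D = this
      have Qeq: "Q (x-1) - Q (-K) + integral {x-1..t} q = \<psi> t" if "x - 1 < t" for t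
        using Q(2)[of "x-1" t] that
          set_lebesgue_integral_eq_integral(2)[OF continuous_set_integrable[OF smooth_continuous[OF smooth_q]], of "x-1" t]
        by (simp add: \<psi>_def algebra_simps)
      show ?thesis
        by (rule has_vector_derivative_transform_within_open[OF D, where S = "{x-1<..}"])
          (auto simp: Qeq)
    qed
    have "smooth \<psi>" by (rule smooth_antideriv[OF dQ smooth_q])
    moreover have "\<psi> x = 0" if "x \<notin> {- K..K}" for x
    proof (cases "x < - K")
      case True
      have "(LINT y:{x..-K}|lebesgue. q y) = (LINT y|(lebesgue :: real measure). 0)" unfolding set_lebesgue_integral_def
      proof (rule integral_cong_AE)
        have "AE y in lebesgue. y \<noteq> - K" by (intro AE_completion AE_lborel_singleton)
        then show "AE y in lebesgue. indicat_real {x..-K} y *\<^sub>R q y = 0"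
          by eventually_elim (use q0 in \<open>auto simp: indicator_def K_def\<close>)
        show "(\<lambda>y. indicat_real {x..-K} y *\<^sub>R q y) \<in> borel_measurable lebesgue"
          using continuous_set_integrable[OF smooth_continuous[OF smooth_q]] unfolding set_integrable_def by auto
      qed simp
      then show ?thesis using Q(2)[of x "-K"] True by (simp add: \<psi>_def)
    next
      case False
      with that have x: "x > K" by auto
      have Kp: "K > 0" using N M by (simp add: K_def)
      have "(LINT y:{-K..x}|lebesgue. q y) = (LINT y|lebesgue. q y)" unfolding set_lebesgue_integral_def
      proof (rule Bochner_Integration.integral_cong)
        show "indicat_real {-K..x} y *\<^sub>R q y = q y" for y
          using q0[of y] x by (cases "y \<in> {-K..x}") (auto simp: K_def)
      qed simp
      also have "\<dots> = 0"
        unfolding q_def using testint[OF \<zeta>] testint[OF rho] Irho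
        by (subst Bochner_Integration.integral_add) (simp_all add: m_def)
      finally show ?thesis using Q(2)[of "-K" x] x Kp by (simp add: \<psi>_def)
    qed
    ultimately have "\<psi> \<in> test_functions" by (rule test_functionsI)
    moreover have "vderiv \<psi> = q" by (rule vderiv_eqI[OF dQ])
    ultimately have "(LINT x|lebesgue. q x *\<^sub>R D x) = 0" using z[of \<psi>] by simp
    moreover have "(LINT x|lebesgue. q x *\<^sub>R D x) = (LINT x|lebesgue. \<zeta> x *\<^sub>R D x) - m *\<^sub>R C"
    proof -
      have "(LINT x|lebesgue. q x *\<^sub>R D x) = (LINT x|lebesgue. \<zeta> x *\<^sub>R D x - m *\<^sub>R (\<rho> x *\<^sub>R D x))"
        by (simp add: q_def algebra_simps)
      also have "\<dots> = (LINT x|lebesgue. \<zeta> x *\<^sub>R D x) - m *\<^sub>R C"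
        using test_scaleR_integrable[OF \<zeta> D] test_scaleR_integrable[OF rho D]
        by (subst Bochner_Integration.integral_diff) (simp_all add: C_def del: scaleR_scaleR)
      finally show ?thesis .
    qed
    moreover have "(LINT x|lebesgue. \<zeta> x *\<^sub>R (D x - C)) = (LINT x|lebesgue. \<zeta> x *\<^sub>R D x) - m *\<^sub>R C"
      using test_scaleR_integrable[OF \<zeta> D] testint[OF \<zeta>]
      by (simp add: scaleR_diff_right m_def)
    ultimately show "(LINT x|lebesgue. \<zeta> x *\<^sub>R (D x - C)) = 0" by simp
  qed
  then have "AE x in lebesgue. D x = C" by simp
  then show ?thesis by (rule that)
qed

lemma has_weak_derivD:
  assumes "has_weak_deriv f g"
  shows "set_integrable lebesgue {a..b} f" "set_integrable lebesgue {a..b} g"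
    "(\<psi> :: real \<Rightarrow> real) \<in> test_functions \<Longrightarrow>
      (LINT x|lebesgue. vderiv \<psi> x *\<^sub>R f x) = - (LINT x|lebesgue. \<psi> x *\<^sub>R g x)"
  using assms by (simp_all add: has_weak_deriv_def)

text \<open>By \<open>integration_by_parts_test\<close> any primitive of \<open>g\<close> has weak
  derivative \<open>g\<close>, so its difference from \<open>f\<close> falls under
  \<open>zero_weak_deriv_imp_const\<close>.\<close>

lemma has_weak_deriv_primitive:
  fixes f g :: "real \<Rightarrow> 'a::euclidean_space"
  assumes "has_weak_deriv f g"
  obtains F where "continuous_on UNIV F" "AE x in lebesgue. f x = F x"
    "\<And>s t. s \<le> t \<Longrightarrow> F t - F s = (LINT x:{s..t}|lebesgue. g x)"
proof -
  note f = has_weak_derivD(1)[OF assms] and g = has_weak_derivD(2)[OF assms]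
    and fg = has_weak_derivD(3)[OF assms]
  obtain F where F: "continuous_on UNIV F" "\<And>s t. s \<le> t \<Longrightarrow> F t - F s = (LINT x:{s..t}|lebesgue. g x)"
    using ex_primitive[OF g] by metis
  have Fi: "\<And>a b. set_integrable lebesgue {a..b} F" by (intro continuous_set_integrable F)
  obtain C where C: "AE x in lebesgue. f x - F x = C"
  proof (rule zero_weak_deriv_imp_const[of "\<lambda>x. f x - F x"])
    show "set_integrable lebesgue {a..b} (\<lambda>x. f x - F x)" for a b
      by (intro set_integral_diff f Fi)
    show "(LINT x|lebesgue. vderiv \<psi> x *\<^sub>R (f x - F x)) = 0" if "\<psi> \<in> test_functions" for \<psi> :: "real \<Rightarrow> real"
      using test_scaleR_integrable[OF test_functions_vderiv[OF that] f]
        test_scaleR_integrable[OF test_functions_vderiv[OF that] Fi]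
        fg[OF that] integration_by_parts_test[OF g F(2) that]
      by (simp add: scaleR_diff_right)
  qed
  show ?thesis
  proof (rule that[of "\<lambda>x. F x + C"])
    show "continuous_on UNIV (\<lambda>x. F x + C)" by (intro continuous_intros F)
    show "AE x in lebesgue. f x = F x + C" using C by eventually_elim (simp add: algebra_simps)
  qed (use F(2) in simp)
qed

text \<open>Removes the arbitrary choice in \<open>weak_deriv\<close>: two weak derivatives have the
  same pairing with every test function, so \<open>fundamental_lemma\<close> applies to their
  difference.\<close>

lemma weak_deriv_AE_unique:
  fixes f g :: "real \<Rightarrow> 'a::euclidean_space"
  assumes g: "has_weak_deriv f g"
  shows "AE x in lebesgue. weak_deriv f x = g x"
proof -
  have w: "has_weak_deriv f (weak_deriv f)" 
    unfolding weak_deriv_def by (rule someI[of "has_weak_deriv f", OF g])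
  have "AE x in lebesgue. weak_deriv f x - g x = 0"
  proof (rule fundamental_lemma)
    show "set_integrable lebesgue {a..b} (\<lambda>x. weak_deriv f x - g x)" for a b
      by (intro set_integral_diff has_weak_derivD(2)[OF w] has_weak_derivD(2)[OF g])
    show "(LINT x|lebesgue. \<psi> x *\<^sub>R (weak_deriv f x - g x)) = 0" if "\<psi> \<in> test_functions" for \<psi> :: "real \<Rightarrow> real"
      using test_scaleR_integrable[OF that has_weak_derivD(2)[OF w]]
        test_scaleR_integrable[OF that has_weak_derivD(2)[OF g]]
        has_weak_derivD(3)[OF w that] has_weak_derivD(3)[OF g that]
      by (simp add: scaleR_diff_right)
  qed
  then show ?thesis by simp
qed

section \<open>From almost-everywhere identities to classical derivatives\<close>

lemma locally_integrable_measurable: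
  fixes g :: "real \<Rightarrow> 'a::euclidean_space"
  assumes g: "\<And>a b. set_integrable lebesgue {a..b} g"
  shows "g \<in> borel_measurable lebesgue"
proof (rule borel_measurable_LIMSEQ_metric)
  show "(\<lambda>x. indicator {- real n..real n} x *\<^sub>R g x) \<in> borel_measurable lebesgue" for n
    using g[of "- real n" "real n"] by (simp add: set_integrable_def borel_measurable_integrable)
  show "(\<lambda>n. indicator {- real n..real n} x *\<^sub>R g x) \<longlonglongrightarrow> g x" for x
  proof (rule tendsto_eventually)
    obtain m where m: "\<bar>x\<bar> < real m" using reals_Archimedean2 by blast
    show "\<forall>\<^sub>F n in sequentially. indicator {- real n..real n} x *\<^sub>R g x = g x"
      using eventually_ge_at_top[of m] by eventually_elim (use m in \<open>auto simp: indicator_def\<close>)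
  qed
qed

text \<open>Serves the nonlinear terms: \<open>k\<close> is a continuous coefficient, bounded on the
  compact interval, and \<open>h\<close> will be the weak derivative of u or the square of its
  norm.\<close>

lemma set_integrable_bound_Icc:
  fixes f :: "real \<Rightarrow> 'a::euclidean_space" and h :: "real \<Rightarrow> 'b::euclidean_space"
  assumes h: "set_integrable lebesgue {a..b} h" and f: "f \<in> borel_measurable lebesgue"
    and k: "continuous_on {a..b} k" and le: "\<And>x. x \<in> {a..b} \<Longrightarrow> norm (f x) \<le> k x * norm (h x)"
  shows "set_integrable lebesgue {a..b} f"
proof -
  have "bounded (k ` {a..b})" by (intro compact_imp_bounded compact_continuous_image k) auto
  then obtain K where K: "\<And>x. x \<in> {a..b} \<Longrightarrow> \<bar>k x\<bar> \<le> K" unfolding bounded_iff real_norm_def by blast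
  show ?thesis unfolding set_integrable_def
  proof (rule Bochner_Integration.integrable_bound)
    show "integrable lebesgue (\<lambda>x. K *\<^sub>R (indicator {a..b} x *\<^sub>R h x))"
      using h unfolding set_integrable_def by (rule integrable_scaleR_right)
    show "(\<lambda>x. indicator {a..b} x *\<^sub>R f x) \<in> borel_measurable lebesgue"
      by (intro borel_measurable_scaleR f borel_measurable_indicator) simp
    have "norm (f x) \<le> \<bar>K\<bar> * norm (h x)" if "x \<in> {a..b}" for x
    proof -
      have "k x \<le> \<bar>K\<bar>" using K[OF that] by linarith
      then show ?thesis using le[OF that] mult_right_mono[of "k x" "\<bar>K\<bar>" "norm (h x)"] by simp
    qed
    then show "AE x in lebesgue. norm (indicator {a..b} x *\<^sub>R f x) \<le> norm (K *\<^sub>R indicator {a..b} x *\<^sub>R h x)"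
      by (intro AE_I2) (simp add: indicator_def)
  qed
qed

lemma continuous_AE_eq_imp_eq:
  fixes f g :: "real \<Rightarrow> 'a::euclidean_space"
  assumes "continuous_on UNIV f" "continuous_on UNIV g" "AE x in lebesgue. f x = g x"
  shows "f = g"
proof (rule ccontr)
  assume "f \<noteq> g"
  have "open {x. f x \<noteq> g x}" by (intro open_Collect_neq assms)
  moreover have "{x. f x \<noteq> g x} \<noteq> {}" using \<open>f \<noteq> g\<close> by auto
  ultimately have "\<not> negligible {x. f x \<noteq> g x}" by (rule open_not_negligible)
  then show False using assms(3) by (simp add: completion.AE_iff_null_sets negligible_iff_null_sets)
qed

text \<open>The bootstrap: increments of \<open>F\<close> see \<open>g\<close> only up to null sets,
  so near x it may be replaced by \<open>h\<close>, which is continuous there, and the fundamental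
  theorem of calculus applies.\<close>

lemma primitive_has_vector_derivative:
  fixes F g h :: "real \<Rightarrow> 'a::euclidean_space"
  assumes g: "\<And>a b. set_integrable lebesgue {a..b} g"
    and F: "\<And>s t. s \<le> t \<Longrightarrow> F t - F s = (LINT x:{s..t}|lebesgue. g x)"
    and gh: "AE x in lebesgue. g x = h x"
    and S: "open S" "x \<in> S" and h: "continuous_on S h"
  shows "(F has_vector_derivative h x) (at x)"
proof -
  obtain e where e: "e > 0" "cball x e \<subseteq> S" using S open_contains_cball by blast
  have sub: "{x - e..x + e} \<subseteq> S" using e(2) by (simp add: cball_eq_atLeastAtMost)
  have hc: "continuous_on {x - e..t} h" if "t \<le> x + e" for t
    by (rule continuous_on_subset[OF h]) (use sub that in auto)
  have Fh: "F (x - e) + integral {x - e..t} h = F t" if t: "x - e \<le> t" "t \<le> x + e" for t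
  proof -
    have hi: "set_integrable lebesgue {x - e..t} h" by (rule absolutely_integrable_continuous_real[OF hc[OF t(2)]])
    have "(LINT y:{x - e..t}|lebesgue. g y) = (LINT y:{x - e..t}|lebesgue. h y)"
      unfolding set_lebesgue_integral_def
    proof (rule integral_cong_AE)
      show "(\<lambda>y. indicat_real {x - e..t} y *\<^sub>R g y) \<in> borel_measurable lebesgue"
        using g[of "x - e" t] unfolding set_integrable_def by (rule borel_measurable_integrable)
      show "(\<lambda>y. indicat_real {x - e..t} y *\<^sub>R h y) \<in> borel_measurable lebesgue"
        using hi unfolding set_integrable_def by (rule borel_measurable_integrable)
      show "AE y in lebesgue. indicat_real {x - e..t} y *\<^sub>R g y = indicat_real {x - e..t} y *\<^sub>R h y"
        using gh by eventually_elim simp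
    qed
    then show ?thesis
      using F[OF t(1)] set_lebesgue_integral_eq_integral(2)[OF hi] by (simp add: algebra_simps)
  qed
  have "((\<lambda>t. integral {x - e..t} h) has_vector_derivative h x) (at x within {x - e..x + e})"
    by (rule integral_has_vector_derivative[OF hc]) (use e in auto)
  then have "((\<lambda>t. integral {x - e..t} h) has_vector_derivative h x) (at x)"
    using e(1) by (simp add: at_within_Icc_at)
  from has_vector_derivative_add[OF has_vector_derivative_const[of "F (x - e)"] this]
  have D: "((\<lambda>t. F (x - e) + integral {x - e..t} h) has_vector_derivative h x) (at x)" by simp
  show ?thesis
    by (rule has_vector_derivative_transform_within_open[OF D, of "{x - e<..<x + e}"])
      (use e Fh in auto)
qed

text \<open>Otherwise e n would stay below the fixed integral of \<open>f\<close> for every n. The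
  intervals may be placed anywhere, which lets both half-lines use the statement.\<close>

lemma integrable_small_on_long_intervals:
  fixes f h :: "real \<Rightarrow> real"
  assumes f: "integrable lebesgue f" "\<And>x. f x \<ge> 0" and fh: "AE x in lebesgue. f x = h x" and e: "e > 0"
    and I: "\<And>n. I n = {a n<..<a n + real n}"
  shows "\<exists>n. \<exists>x\<in>I n. h x < e"
proof (rule ccontr)
  assume "\<not> ?thesis"
  then have h: "h x \<ge> e" if "x \<in> I n" for n x using that by force
  obtain n where n: "(LINT x|lebesgue. f x) / e < real n" using reals_Archimedean2 by blast
  have "e * real n = (LINT x|lebesgue. e * indicator (I n) x)"
    by (simp add: I)
  also have "\<dots> \<le> (LINT x|lebesgue. f x)"
  proof (rule integral_mono_AE[OF _ f(1)])
    show "integrable lebesgue (\<lambda>x. e * indicator (I n) x)"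
      by (intro integrable_mult_right integrable_real_indicator) (simp_all add: I)
    show "AE x in lebesgue. e * indicator (I n) x \<le> f x"
      using fh
    proof eventually_elim
      case (elim x)
      then show ?case using h[of x n] f(2)[of x] by (cases "x \<in> I n") auto
    qed
  qed
  finally show False using n e by (simp add: field_simps)
qed

section \<open>The product rule against test functions\<close>

lemma test_functions_mult:
  assumes "f \<in> test_functions" "smooth g"
  shows "(\<lambda>x. f x * g x) \<in> (test_functions :: (real \<Rightarrow> real) set)"
proof -
  obtain N where N: "\<And>x. x \<notin> {-N..N} \<Longrightarrow> f x = 0" using test_functions_support[OF assms(1)] by metis
  show ?thesis
    by (rule test_functionsI[OF smooth_mult[OF test_functions_smooth[OF assms(1)] assms(2)], of "-N" N])
      (simp add: N)
qed

lemma vderiv_mult: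
  fixes f g :: "real \<Rightarrow> real"
  assumes "smooth f" "smooth g"
  shows "vderiv (\<lambda>x. f x * g x) = (\<lambda>x. f x * vderiv g x + vderiv f x * g x)"
  by (rule vderiv_eqI) (intro has_vector_derivative_mult smooth_has_vderiv assms)

lemma vderiv_scaleR_const:
  fixes f :: "real \<Rightarrow> real" and e :: "'a::real_normed_vector"
  assumes "smooth f" shows "vderiv (\<lambda>x. f x *\<^sub>R e) = (\<lambda>x. vderiv f x *\<^sub>R e)"
proof (rule vderiv_eqI)
  show "((\<lambda>x. f x *\<^sub>R e) has_vector_derivative vderiv f x *\<^sub>R e) (at x)" for x
    using has_vector_derivative_scaleR[of f "vderiv f x" x UNIV "\<lambda>x. e" 0] smooth_has_vderiv[OF assms]
    by (auto simp: has_real_derivative_iff_has_vector_derivative)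
qed

lemma has_weak_deriv_weak_deriv:
  assumes "has_weak_deriv f g" shows "has_weak_deriv f (weak_deriv f)"
  unfolding weak_deriv_def by (rule someI[of "has_weak_deriv f", OF assms])

lemma set_integrable_inner:
  fixes g :: "real \<Rightarrow> 'a::euclidean_space"
  assumes "set_integrable lebesgue {a..b} g"
  shows "set_integrable lebesgue {a..b} (\<lambda>x. g x \<bullet> e)"
  using integrable_inner_left[of e lebesgue "\<lambda>x. indicator {a..b} x *\<^sub>R g x"] assms
  by (simp add: set_integrable_def)

text \<open>Computes the derivative of the scalar product of u with a test function \<psi> e that
  occurs in the weak equation. Moving \<psi> into the function tested against reduces it to the weak
  derivative of u.\<close>

lemma has_weak_deriv_test_times_inner:
  fixes u w :: "real \<Rightarrow> 'a::euclidean_space" and \<psi> :: "real \<Rightarrow> real"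
  assumes w: "has_weak_deriv u w" and \<psi>: "\<psi> \<in> test_functions"
  shows "has_weak_deriv (\<lambda>x. \<psi> x * (u x \<bullet> e)) (\<lambda>x. vderiv \<psi> x * (u x \<bullet> e) + \<psi> x * (w x \<bullet> e))"
proof -
  note ui = set_integrable_inner[OF has_weak_derivD(1)[OF w], of _ _ e]
  note wi = set_integrable_inner[OF has_weak_derivD(2)[OF w], of _ _ e]
  note sm = test_functions_smooth[OF \<psi>]
  note cont = smooth_continuous[OF sm] smooth_continuous[OF smooth_vderiv[OF sm]]
  have 1: "set_integrable lebesgue {a..b} (\<lambda>x. \<psi> x * (u x \<bullet> e))" for a b
    using continuous_scaleR_set_integrable[OF cont(1) ui] by simp
  have 2: "set_integrable lebesgue {a..b} (\<lambda>x. vderiv \<psi> x * (u x \<bullet> e) + \<psi> x * (w x \<bullet> e))" for a b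
    using continuous_scaleR_set_integrable[OF cont(2) ui] continuous_scaleR_set_integrable[OF cont(1) wi]
    by (intro set_integral_add) simp_all
  have "(LINT x|lebesgue. vderiv \<rho> x *\<^sub>R (\<psi> x * (u x \<bullet> e)))
      = - (LINT x|lebesgue. \<rho> x *\<^sub>R (vderiv \<psi> x * (u x \<bullet> e) + \<psi> x * (w x \<bullet> e)))"
    if \<rho>: "\<rho> \<in> test_functions" for \<rho> :: "real \<Rightarrow> real"
  proof -
    note smr = test_functions_smooth[OF \<rho>]
    define \<tau> where "\<tau> x = \<rho> x * \<psi> x" for x
    have \<tau>: "\<tau> \<in> test_functions" unfolding \<tau>_def[abs_def] by (rule test_functions_mult[OF \<rho> sm])
    have d\<tau>: "vderiv \<tau> x = \<rho> x * vderiv \<psi> x + vderiv \<rho> x * \<psi> x" for x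
      unfolding \<tau>_def[abs_def] vderiv_mult[OF smr sm] ..
    have t1: "(\<lambda>x. \<rho> x * vderiv \<psi> x) \<in> test_functions" by (rule test_functions_mult[OF \<rho> smooth_vderiv[OF sm]])
    have t2: "(\<lambda>x. vderiv \<rho> x * \<psi> x) \<in> test_functions" by (rule test_functions_mult[OF test_functions_vderiv[OF \<rho>] sm])
    have i: "integrable lebesgue (\<lambda>x. \<rho> x * vderiv \<psi> x * (u x \<bullet> e))" "integrable lebesgue (\<lambda>x. vderiv \<rho> x * \<psi> x * (u x \<bullet> e))"
      "integrable lebesgue (\<lambda>x. \<rho> x * \<psi> x * (w x \<bullet> e))"
      using test_scaleR_integrable[OF t1 ui] test_scaleR_integrable[OF t2 ui] test_scaleR_integrable[OF \<tau> wi]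
      by (simp_all add: \<tau>_def)
    have "(LINT x|lebesgue. vderiv \<tau> x *\<^sub>R u x) \<bullet> e = - (LINT x|lebesgue. \<tau> x *\<^sub>R w x) \<bullet> e"
      using has_weak_derivD(3)[OF w \<tau>] by simp
    then have "(LINT x|lebesgue. (vderiv \<tau> x *\<^sub>R u x) \<bullet> e) = - (LINT x|lebesgue. (\<tau> x *\<^sub>R w x) \<bullet> e)"
      using test_scaleR_integrable[OF test_functions_vderiv[OF \<tau>] has_weak_derivD(1)[OF w]]
        test_scaleR_integrable[OF \<tau> has_weak_derivD(2)[OF w]] by (simp del: inner_scaleR_left)
    then have "(LINT x|lebesgue. \<rho> x * vderiv \<psi> x * (u x \<bullet> e) + vderiv \<rho> x * \<psi> x * (u x \<bullet> e))
        = - (LINT x|lebesgue. \<rho> x * \<psi> x * (w x \<bullet> e))"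
      by (simp add: d\<tau> \<tau>_def distrib_right)
    then have "(LINT x|lebesgue. vderiv \<rho> x * \<psi> x * (u x \<bullet> e))
      = - ((LINT x|lebesgue. \<rho> x * vderiv \<psi> x * (u x \<bullet> e)) + (LINT x|lebesgue. \<rho> x * \<psi> x * (w x \<bullet> e)))"
      using i by (simp add: Bochner_Integration.integral_add)
    also have "(LINT x|lebesgue. \<rho> x * vderiv \<psi> x * (u x \<bullet> e)) + (LINT x|lebesgue. \<rho> x * \<psi> x * (w x \<bullet> e))
      = (LINT x|lebesgue. \<rho> x * vderiv \<psi> x * (u x \<bullet> e) + \<rho> x * \<psi> x * (w x \<bullet> e))"
      using i by (simp add: Bochner_Integration.integral_add)
    finally show ?thesis by (simp add: distrib_left mult.assoc)
  qed
  then show ?thesis unfolding has_weak_deriv_def using 1 2 by blast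
qed

section \<open>The profile equation\<close>

lemma has_real_derivative_inner:
  fixes f g :: "real \<Rightarrow> 'a::real_inner"
  assumes "(f has_vector_derivative f') (at x)" "(g has_vector_derivative g') (at x)"
  shows "((\<lambda>x. f x \<bullet> g x) has_real_derivative f x \<bullet> g' + f' \<bullet> g x) (at x)"
proof -
  have "((\<lambda>x. f x \<bullet> g x) has_vector_derivative f x \<bullet> g' + f' \<bullet> g x) (at x)"
    by (rule bounded_bilinear.has_vector_derivative[OF bounded_bilinear_inner assms])
  then show ?thesis by (simp add: has_real_derivative_iff_has_vector_derivative)
qed

text \<open>The restriction to \<open>e \<le> 1\<close> is for the callers: it bounds |u| and lets
  e^2 be replaced by e.\<close>

lemma eq_zero_if_abs_le_small:
  assumes "\<And>e. 0 < e \<Longrightarrow> e \<le> 1 \<Longrightarrow> \<bar>C\<bar> \<le> K * e" "K > 0"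
  shows "C = (0::real)"
proof (rule ccontr)
  assume "C \<noteq> 0"
  define e where "e = min 1 (\<bar>C\<bar> / (2 * K))"
  have "0 < e" "e \<le> 1" "e \<le> \<bar>C\<bar> / (2 * K)" using \<open>C \<noteq> 0\<close> assms(2) by (auto simp: e_def)
  then have "\<bar>C\<bar> \<le> K * (\<bar>C\<bar> / (2 * K))"
    using assms(1)[of e] assms(2) mult_left_mono[of e "\<bar>C\<bar> / (2 * K)" K] by simp
  then show False using \<open>C \<noteq> 0\<close> assms(2) by simp
qed

lemma zero_deriv_half_line_const:
  fixes f :: "real \<Rightarrow> real"
  assumes "\<And>x. x > 0 \<Longrightarrow> (f has_real_derivative 0) (at x)"
  shows "\<exists>C. \<forall>x>0. f x = C"
proof -
  have "f constant_on {0<..}"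
    by (rule has_field_derivative_0_imp_constant_on) (use assms in auto)
  then show ?thesis by (auto simp: constant_on_def)
qed

lemma has_vector_derivative_reflect:
  fixes f :: "real \<Rightarrow> 'a::real_normed_vector"
  assumes "(f has_vector_derivative f') (at (- x))"
  shows "((\<lambda>x. f (- x)) has_vector_derivative - f') (at x)"
proof -
  have "(uminus has_vector_derivative - 1) (at x)"
    by (auto intro!: derivative_eq_intros)
  from vector_diff_chain_at[OF this assms] show ?thesis by (simp add: o_def)
qed

section \<open>Coefficients of the profile equation\<close>

locale tw_param =
  fixes c \<kappa> :: real
  assumes param: "(c, \<kappa>) \<in> D_tilde"
begin

text \<open>The profile equation is \<eta>'^2 B(\<eta>) = \<eta>^2 A(\<eta>), and \<open>y0\<close>
  is the value of \<eta> where |u|^2 = 1 / (2 \<kappa>), which is the zero of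
  \<open>B\<close>.\<close>

definition "A y = 2 - c\<^sup>2 - 2 * y"
definition "B y = 1 - 2 * \<kappa> + 2 * \<kappa> * y"
definition "y0 = 1 - 1 / (2 * \<kappa>)"

text \<open>The open interval between \<open>y0\<close> and \<open>0\<close>, for both signs of \<open>1 - 2 * \<kappa>\<close> at once.\<close>

definition "betw = {y. y * (1 - 2 * \<kappa>) < 0 \<and> B y * (1 - 2 * \<kappa>) > 0}"

text \<open>At c^2 = 2 the formula of \<open>fh_fun\<close> divides by zero; \<open>g_fun\<close> is
  its limit as c^2 tends to 2.\<close>

definition "fhg = (if c\<^sup>2 = 2 then g_fun \<kappa> else fh_fun c \<kappa>)"

lemma kappa_pos: "\<kappa> > 0"
  using param by (auto simp: D_tilde_def D1_def D3_def B_minus_def B_plus_def)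

lemma b_nz: "1 - 2 * \<kappa> \<noteq> 0"
  using param by (auto simp: D_tilde_def D1_def D3_def B_minus_def B_plus_def)

lemma param_cases:
  obtains "(c, \<kappa>) \<in> D1" "c\<^sup>2 < 2" "2 * \<kappa> < 1" | "(c, \<kappa>) \<in> D3" "c\<^sup>2 > 2" "2 * \<kappa> > 1"
    | "(c, \<kappa>) \<in> B_minus" "c\<^sup>2 = 2" "2 * \<kappa> < 1" | "(c, \<kappa>) \<in> B_plus" "c\<^sup>2 = 2" "2 * \<kappa> > 1"
proof -
  have 1: "c\<^sup>2 < 2" if "0 \<le> c" "c < sqrt 2"
    using that real_sqrt_pow2[of 2] power_strict_mono[of c "sqrt 2" 2] by simp
  have 2: "c\<^sup>2 > 2" if "c > sqrt 2"
    using that real_sqrt_pow2[of 2] power_strict_mono[of "sqrt 2" c 2] by simp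
  show ?thesis
    using param that 1 2 by (auto simp: D_tilde_def D1_def D3_def B_minus_def B_plus_def)
qed

text \<open>The fact common to the four parameter sets: 2 - c^2 is zero or has the sign of 1 - 2
  \<kappa>. Multiplying inequalities by 1 - 2 \<kappa> thereby treats both signs together.\<close>

lemma ab_nonneg: "(2 - c\<^sup>2) * (1 - 2 * \<kappa>) \<ge> 0"
  by (cases rule: param_cases) (auto intro: mult_nonneg_nonneg mult_nonpos_nonpos)

lemma y0_betw: "y0 * (1 - 2 * \<kappa>) < 0" "B y0 = 0"
proof -
  have "y0 * (1 - 2 * \<kappa>) = - ((1 - 2 * \<kappa>)\<^sup>2 / (2 * \<kappa>))"
    using kappa_pos by (simp add: y0_def field_simps power2_eq_square)
  also have "\<dots> < 0" using kappa_pos b_nz by simp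
  finally show "y0 * (1 - 2 * \<kappa>) < 0" .
  show "B y0 = 0" using kappa_pos by (simp add: y0_def B_def field_simps)
qed

lemma A_pos: "y * (1 - 2 * \<kappa>) < 0 \<Longrightarrow> A y * (1 - 2 * \<kappa>) > 0"
  using ab_nonneg by (simp add: A_def left_diff_distrib)

lemma ratio_pos:
  assumes "y \<in> betw" shows "A y / B y > 0" "A y \<noteq> 0" "B y \<noteq> 0" "y \<noteq> 0"
  using assms A_pos[of y] unfolding betw_def
  by (auto simp: zero_less_divide_iff zero_less_mult_iff)

lemma betw_open: "open betw"
  unfolding betw_def B_def by (intro open_Collect_conj open_Collect_less continuous_intros)

lemma betw_cases: "y \<in> betw \<longleftrightarrow> (if 2 * \<kappa> < 1 then y0 < y \<and> y < 0 else 0 < y \<and> y < y0)"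
proof -
  have 1: "y0 < y \<longleftrightarrow> B y > 0" "y < y0 \<longleftrightarrow> B y < 0"
    using kappa_pos by (auto simp: y0_def B_def field_simps)
  show ?thesis using b_nz unfolding 1 by (auto simp: betw_def mult_less_0_iff zero_less_mult_iff)
qed

text \<open>This constant is B(y) + \<kappa> A(y) for every y. It is the numerator of 1 + \<kappa> A
  / B and, up to the factor -2, of the derivative of A / B, so it cancels in the derivatives below.
  Multiplied by 1 - 2 \<kappa> it becomes a positive square plus a nonnegative term.\<close>

lemma b_ka_nz: "1 - 2 * \<kappa> + \<kappa> * (2 - c\<^sup>2) \<noteq> 0"
proof -
  have "(1 - 2 * \<kappa> + \<kappa> * (2 - c\<^sup>2)) * (1 - 2 * \<kappa>) = (1 - 2 * \<kappa>)\<^sup>2 + \<kappa> * ((2 - c\<^sup>2) * (1 - 2 * \<kappa>))"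
    by (simp add: algebra_simps power2_eq_square)
  also have "\<dots> > 0" using kappa_pos ab_nonneg b_nz by (intro add_pos_nonneg) auto
  finally show ?thesis by auto
qed

section \<open>Derivatives of f, h and g\<close>

lemma deriv_A: "(A has_real_derivative - 2) (at y)"
  unfolding A_def by (auto intro!: derivative_eq_intros)

lemma deriv_B: "(B has_real_derivative 2 * \<kappa>) (at y)"
  unfolding B_def by (auto intro!: derivative_eq_intros)

lemma deriv_ratio:
  assumes "B y \<noteq> 0"
  shows "((\<lambda>y. A y / B y) has_real_derivative - 2 * (1 - 2 * \<kappa> + \<kappa> * (2 - c\<^sup>2)) / (B y)\<^sup>2) (at y)"
proof -
  have "((\<lambda>y. A y / B y) has_real_derivative (- 2 * B y - A y * (2 * \<kappa>)) / (B y * B y)) (at y)"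
    by (rule DERIV_divide[OF deriv_A deriv_B assms])
  moreover have "- 2 * B y - A y * (2 * \<kappa>) = - 2 * (1 - 2 * \<kappa> + \<kappa> * (2 - c\<^sup>2))"
    by (simp add: A_def B_def algebra_simps)
  ultimately show ?thesis by (simp add: power2_eq_square)
qed

lemma deriv_arctan_part:
  assumes y: "y \<in> betw"
  shows "((\<lambda>y. 2 * sqrt \<kappa> * arctan (sqrt \<kappa> * sqrt (A y / B y))) has_real_derivative
    - 2 * \<kappa> / (B y * sqrt (A y / B y))) (at y)"
proof -
  note p = ratio_pos[OF y] and k = kappa_pos
  define s where "s = sqrt (A y / B y)"
  define m where "m = 1 - 2 * \<kappa> + \<kappa> * (2 - c\<^sup>2)"
  have s: "s > 0" "s\<^sup>2 = A y / B y" using p by (auto simp: s_def)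
  have "m \<noteq> 0" using b_ka_nz by (simp add: m_def)
  have ds: "((\<lambda>y. sqrt (A y / B y)) has_real_derivative inverse s / 2 * (- 2 * m / (B y)\<^sup>2)) (at y)"
    using DERIV_chain2[OF DERIV_real_sqrt[OF p(1)] deriv_ratio[OF p(3)]] by (simp add: s_def m_def)
  have 1: "((\<lambda>y. 2 * sqrt \<kappa> * arctan (sqrt \<kappa> * sqrt (A y / B y))) has_real_derivative
    2 * sqrt \<kappa> * (inverse (1 + (sqrt \<kappa> * s)\<^sup>2) * (sqrt \<kappa> * (inverse s / 2 * (- 2 * m / (B y)\<^sup>2))))) (at y)"
    unfolding s_def
    by (intro DERIV_cmult DERIV_chain2[OF DERIV_arctan] ds[unfolded s_def])
  have "m = B y + \<kappa> * A y" by (simp add: m_def A_def B_def algebra_simps)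
  then have "1 + (sqrt \<kappa> * s)\<^sup>2 = m / B y"
    using k p s(2) by (simp add: power_mult_distrib field_simps)
  then have "2 * sqrt \<kappa> * (inverse (1 + (sqrt \<kappa> * s)\<^sup>2) * (sqrt \<kappa> * (inverse s / 2 * (- 2 * m / (B y)\<^sup>2))))
    = - 2 * (sqrt \<kappa> * sqrt \<kappa>) / (B y * s)"
    using p s(1) \<open>m \<noteq> 0\<close> by (simp add: field_simps power2_eq_square)
  then show ?thesis using 1 k by (simp add: s_def)
qed

lemma deriv_artanh_part:
  assumes y: "y \<in> betw" and a: "c\<^sup>2 \<noteq> 2"
  shows "((\<lambda>y. 2 * sqrt ((1 - 2 * \<kappa>) / (2 - c\<^sup>2)) *
             artanh (sqrt (((2 - c\<^sup>2) * B y) / ((1 - 2 * \<kappa>) * A y)))) has_real_derivative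
    - sqrt (A y / B y) * (1 - 2 * \<kappa>) / (A y * y)) (at y)"
proof -
  note p = ratio_pos[OF y]
  define s where "s = sqrt (A y / B y)"
  define m where "m = 1 - 2 * \<kappa> + \<kappa> * (2 - c\<^sup>2)"
  define a where "a = 2 - c\<^sup>2"
  define b where "b = 1 - 2 * \<kappa>"
  define Q where "Q y = (a * B y) / (b * A y)" for y
  have s: "s > 0" "s\<^sup>2 = A y / B y" using p by (auto simp: s_def)
  have nz: "m \<noteq> 0" "b \<noteq> 0" "a \<noteq> 0" using b_ka_nz b_nz assms(2) by (auto simp: m_def a_def b_def)
  have ab: "a * b > 0" using ab_nonneg nz by (simp add: a_def b_def less_le)
  then have ab': "a / b > 0" "b / a > 0" by (auto simp: zero_less_divide_iff zero_less_mult_iff)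
  have Qs: "Q y = (a / b) / (A y / B y)" by (simp add: Q_def)
  have Qpos: "Q y > 0" unfolding Qs by (intro divide_pos_pos ab' p)
  have b1: "y * b < 0" "B y * b > 0" "A y * b > 0"
    using y A_pos[of y] by (auto simp: betw_def b_def)
  have Q1: "1 - Q y = - 2 * y * m / (b * A y)"
  proof -
    have "b * A y - a * B y = - 2 * y * m" by (simp add: A_def B_def a_def b_def m_def algebra_simps)
    moreover have "1 - Q y = (b * A y - a * B y) / (b * A y)"
      using p nz by (simp add: Q_def diff_divide_distrib)
    ultimately show ?thesis by simp
  qed
  have "m * b = b\<^sup>2 + \<kappa> * (a * b)"
    by (simp add: m_def a_def b_def algebra_simps power2_eq_square)
  then have "m * b > 0" using kappa_pos ab nz by (simp add: add_pos_pos)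
  \<comment> \<open>Each factor is paired with b, because only the products with b have a known
    sign. The result keeps the argument of artanh inside its domain.\<close>
  have "1 - Q y = (- (y * b)) * 2 * (m * b) / (b\<^sup>2 * (A y * b))"
    unfolding Q1 using nz p by (simp add: field_simps power2_eq_square)
  also have "\<dots> > 0" 
  proof -
    have "X * 2 * Y / (Z * W) > 0" if "X > 0" "Y > 0" "Z > 0" "W > 0" for X Y Z W :: real
      using that by simp
    note gen = this
    show ?thesis by (rule gen) (use b1 \<open>m * b > 0\<close> nz(2) in auto)
  qed
  finally have Qlt: "Q y < 1" by simp
  have dQ: "(Q has_real_derivative (a / b) * (2 * m / (A y)\<^sup>2)) (at y)"
  proof -
    have "((\<lambda>y. (a * B y) / (b * A y)) has_real_derivative (a * (2 * \<kappa>) * (b * A y) - (a * B y) * (b * (- 2))) / (b * A y * (b * A y))) (at y)"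
      by (rule DERIV_divide[OF DERIV_cmult[OF deriv_B] DERIV_cmult[OF deriv_A]]) (use p nz in auto)
    moreover have "a * (2 * \<kappa>) * (b * A y) - (a * B y) * (b * (- 2)) = a * b * (2 * m)"
      by (simp add: A_def B_def a_def b_def m_def algebra_simps)
    ultimately show ?thesis unfolding Q_def[abs_def]
      using nz p by (simp add: power2_eq_square field_simps)
  qed
  have dq: "((\<lambda>y. sqrt (Q y)) has_real_derivative inverse (sqrt (Q y)) / 2 * ((a / b) * (2 * m / (A y)\<^sup>2))) (at y)"
    by (rule DERIV_chain2[OF DERIV_real_sqrt[OF Qpos] dQ])
  have "\<bar>sqrt (Q y)\<bar> < 1" using Qlt Qpos by simp
  then have 1: "((\<lambda>y. 2 * sqrt (b / a) * artanh (sqrt (Q y))) has_real_derivative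
     2 * sqrt (b / a) * (1 / (1 - (sqrt (Q y))\<^sup>2) * (inverse (sqrt (Q y)) / 2 * ((a / b) * (2 * m / (A y)\<^sup>2))))) (at y)"
    by (intro DERIV_cmult DERIV_chain2[OF artanh_real_has_field_derivative] dq) auto
  \<comment> \<open>The square roots of b / a and of Q combine into a rational multiple of sqrt(A /
    B), so no square root of the parameters alone remains.\<close>
  have "sqrt (b / a) * inverse (sqrt (Q y)) = sqrt ((b / a) * inverse (Q y))"
    by (simp only: real_sqrt_mult real_sqrt_inverse)
  also have "(b / a) * inverse (Q y) = (b / a)\<^sup>2 * (A y / B y)"
    unfolding Qs by (simp add: power2_eq_square)
  also have "sqrt ((b / a)\<^sup>2 * (A y / B y)) = b / a * s"
    using ab' by (simp only: real_sqrt_mult real_sqrt_abs s_def abs_of_pos[OF ab'(2)])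
  finally have e: "sqrt (b / a) * inverse (sqrt (Q y)) = b / a * s" .
  have "2 * sqrt (b / a) * (1 / (1 - (sqrt (Q y))\<^sup>2) * (inverse (sqrt (Q y)) / 2 * ((a / b) * (2 * m / (A y)\<^sup>2))))
    = (sqrt (b / a) * inverse (sqrt (Q y))) * (1 / (1 - Q y)) * ((a / b) * (2 * m / (A y)\<^sup>2))"
    using Qpos by simp
  also have "\<dots> = - s * b / (A y * y)"
    unfolding e Q1 using nz p by (simp add: field_simps power2_eq_square)
  finally show ?thesis using 1 by (simp add: Q_def[abs_def] a_def b_def s_def)
qed

text \<open>At c^2 = 2 one has A(y) = -2 y. The derivative has the same form as in
  \<open>deriv_artanh_part\<close>, so the two cases merge in \<open>fhg_deriv\<close>.\<close>

lemma deriv_sqrt_part: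
  assumes y: "y \<in> betw" and a: "c\<^sup>2 = 2"
  shows "((\<lambda>y. sqrt 2 * sqrt (- (B y / y))) has_real_derivative
    - sqrt (A y / B y) * (1 - 2 * \<kappa>) / (A y * y)) (at y)"
proof -
  note p = ratio_pos[OF y]
  define s where "s = sqrt (A y / B y)"
  have A: "A y = - 2 * y" using a by (simp add: A_def)
  have M: "- (B y / y) = 2 / (A y / B y)" using p by (simp add: A field_simps)
  have Mpos: "- (B y / y) > 0" unfolding M by (intro divide_pos_pos p) simp
  have dM: "((\<lambda>y. - (B y / y)) has_real_derivative (1 - 2 * \<kappa>) / y\<^sup>2) (at y)"
  proof -
    have "((\<lambda>y. - (B y / y)) has_real_derivative - ((2 * \<kappa> * y - B y * 1) / (y * y))) (at y)"
      by (intro DERIV_minus DERIV_divide deriv_B DERIV_ident p)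
    moreover have "- ((2 * \<kappa> * y - B y * 1) / (y * y)) = (1 - 2 * \<kappa>) / y\<^sup>2"
      by (simp add: B_def power2_eq_square minus_divide_left)
    ultimately show ?thesis by simp
  qed
  have 1: "((\<lambda>y. sqrt 2 * sqrt (- (B y / y))) has_real_derivative
    sqrt 2 * (inverse (sqrt (- (B y / y))) / 2 * ((1 - 2 * \<kappa>) / y\<^sup>2))) (at y)"
    by (intro DERIV_cmult DERIV_chain2[OF DERIV_real_sqrt[OF Mpos] dM])
  have "sqrt 2 * inverse (sqrt (- (B y / y))) = s"
  proof -
    have "sqrt 2 * inverse (sqrt (2 / X)) = sqrt X" for X by (simp add: real_sqrt_divide)
    then show ?thesis unfolding M s_def .
  qed
  then have "sqrt 2 * (inverse (sqrt (- (B y / y))) / 2 * ((1 - 2 * \<kappa>) / y\<^sup>2)) = s / 2 * ((1 - 2 * \<kappa>) / y\<^sup>2)"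
    by simp
  also have "\<dots> = - s * (1 - 2 * \<kappa>) / (A y * y)"
    using p by (simp add: A power2_eq_square field_simps)
  finally show ?thesis using 1 by (simp add: s_def)
qed

lemma fhg_eq:
  assumes "y \<noteq> y0"
  shows "fhg y = 2 * sqrt \<kappa> * arctan (sqrt \<kappa> * sqrt (A y / B y)) +
    (if c\<^sup>2 = 2 then sqrt 2 * sqrt (- (B y / y)) else 2 * sqrt ((1 - 2 * \<kappa>) / (2 - c\<^sup>2)) *
             artanh (sqrt (((2 - c\<^sup>2) * B y) / ((1 - 2 * \<kappa>) * A y)))) - pi * sqrt \<kappa>"
proof (cases "c\<^sup>2 = 2")
  case True
  then have "(- 2 * \<kappa> * y) / (1 - 2 * \<kappa> + 2 * \<kappa> * y) = \<kappa> * (A y / B y)"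
    by (simp add: A_def B_def)
  then show ?thesis using True assms
    by (simp add: fhg_def g_fun_def y0_def B_def flip: real_sqrt_mult)
next
  case False
  then show ?thesis using assms by (simp add: fhg_def fh_fun_def y0_def A_def B_def)
qed

lemma fhg_y0: "fhg y0 = 0"
  by (simp add: fhg_def g_fun_def fh_fun_def y0_def)

lemma y0_notin: "y0 \<notin> betw"
  using y0_betw by (simp add: betw_def)

text \<open>Separation of variables: composed with a solution of \<eta>' = -\<eta> sqrt(A / B),
  \<open>fhg\<close> has derivative 1.\<close>

lemma fhg_deriv:
  assumes y: "y \<in> betw"
  shows "(fhg has_real_derivative - 1 / (y * sqrt (A y / B y))) (at y)"
proof -
  note p = ratio_pos[OF y]
  define s where "s = sqrt (A y / B y)"
  have s: "s > 0" "A y = s\<^sup>2 * B y" using p by (auto simp: s_def)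
  let ?G = "\<lambda>y. 2 * sqrt \<kappa> * arctan (sqrt \<kappa> * sqrt (A y / B y)) +
    (if c\<^sup>2 = 2 then sqrt 2 * sqrt (- (B y / y)) else 2 * sqrt ((1 - 2 * \<kappa>) / (2 - c\<^sup>2)) *
             artanh (sqrt (((2 - c\<^sup>2) * B y) / ((1 - 2 * \<kappa>) * A y)))) - pi * sqrt \<kappa>"
  have "((\<lambda>y. if c\<^sup>2 = 2 then sqrt 2 * sqrt (- (B y / y)) else 2 * sqrt ((1 - 2 * \<kappa>) / (2 - c\<^sup>2)) *
             artanh (sqrt (((2 - c\<^sup>2) * B y) / ((1 - 2 * \<kappa>) * A y)))) has_real_derivative
    - s * (1 - 2 * \<kappa>) / (A y * y)) (at y)"
    using deriv_artanh_part[OF y] deriv_sqrt_part[OF y] by (cases "c\<^sup>2 = 2") (simp_all add: s_def)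
  then have "(?G has_real_derivative (- 2 * \<kappa> / (B y * s) + - s * (1 - 2 * \<kappa>) / (A y * y)) - 0) (at y)"
    by (intro DERIV_diff DERIV_add deriv_arctan_part[OF y, folded s_def] DERIV_const)
  moreover have "(- 2 * \<kappa> / (B y * s) + - s * (1 - 2 * \<kappa>) / (A y * y)) - 0 = - 1 / (y * s)"
  proof -
    \<comment> \<open>Over the common denominator the arctan part contributes 2 \<kappa> y and the
      other part 1 - 2 \<kappa>; their sum is B, which cancels.\<close>
    have "(- 2 * \<kappa> / (B y * s) + - s * (1 - 2 * \<kappa>) / (A y * y)) - 0 = - (2 * \<kappa> * y + (1 - 2 * \<kappa>)) / (B y * s * y)"
      using s p unfolding s(2) by (simp add: field_simps power2_eq_square)
    also have "2 * \<kappa> * y + (1 - 2 * \<kappa>) = B y" by (simp add: B_def)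
    finally show ?thesis using p by simp
  qed
  ultimately have "(?G has_real_derivative - 1 / (y * s)) (at y)" by simp
  then have "(fhg has_real_derivative - 1 / (y * s)) (at y)"
  proof (rule has_field_derivative_transform_within_open[OF _ betw_open y])
    fix x assume "x \<in> betw"
    then have "x \<noteq> y0" using y0_notin by auto
    then show "?G x = fhg x" by (rule fhg_eq[symmetric])
  qed
  then show ?thesis by (simp add: s_def)
qed

section \<open>The endpoint \<open>y0\<close> and the inverse function\<close>

lemma ratio_at_top: "filterlim (\<lambda>y. A y / B y) at_top (at y0 within betw)"
proof -
  have "((\<lambda>y. A y * (1 - 2 * \<kappa>)) \<longlongrightarrow> A y0 * (1 - 2 * \<kappa>)) (at y0 within betw)"
    unfolding A_def by (intro tendsto_intros)
  moreover have "A y0 * (1 - 2 * \<kappa>) > 0" by (rule A_pos[OF y0_betw(1)])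
  \<comment> \<open>The factor 1 - 2 \<kappa> makes the vanishing denominator positive on
    \<open>betw\<close>.\<close>
  moreover have "filterlim (\<lambda>y. inverse (B y * (1 - 2 * \<kappa>))) at_top (at y0 within betw)"
  proof (rule filterlim_inverse_at_top)
    have "((\<lambda>y. B y * (1 - 2 * \<kappa>)) \<longlongrightarrow> B y0 * (1 - 2 * \<kappa>)) (at y0 within betw)"
      unfolding B_def by (intro tendsto_intros)
    then show "((\<lambda>y. B y * (1 - 2 * \<kappa>)) \<longlongrightarrow> 0) (at y0 within betw)" by (simp add: y0_betw)
    show "\<forall>\<^sub>F y in at y0 within betw. 0 < B y * (1 - 2 * \<kappa>)"
      by (auto simp: eventually_at_filter betw_def)
  qed
  ultimately have "filterlim (\<lambda>y. (A y * (1 - 2 * \<kappa>)) * inverse (B y * (1 - 2 * \<kappa>))) at_top (at y0 within betw)"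
    by (rule filterlim_tendsto_pos_mult_at_top)
  moreover have "(\<lambda>y. (A y * (1 - 2 * \<kappa>)) * inverse (B y * (1 - 2 * \<kappa>))) = (\<lambda>y. A y / B y)"
    using b_nz by (simp add: fun_eq_iff divide_inverse)
  ultimately show ?thesis by simp
qed

text \<open>The subtracted constant pi sqrt(\<kappa>) is the limit of the arctan term, whose
  argument is unbounded; the remaining term vanishes with B. Thus the value 0 assigned at
  \<open>y0\<close> is the continuous one.\<close>

lemma fhg_tendsto_y0: "(fhg \<longlongrightarrow> 0) (at y0 within betw)"
proof -
  have sq: "filterlim (\<lambda>y. sqrt (A y / B y)) at_top (at y0 within betw)"
    by (rule filterlim_compose[OF sqrt_at_top ratio_at_top])
  have "filterlim (\<lambda>y. sqrt \<kappa> * sqrt (A y / B y)) at_top (at y0 within betw)"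
    by (rule filterlim_tendsto_pos_mult_at_top[OF tendsto_const _ sq]) (use kappa_pos in simp)
  then have "((\<lambda>y. arctan (sqrt \<kappa> * sqrt (A y / B y))) \<longlongrightarrow> pi / 2) (at y0 within betw)"
    by (rule filterlim_compose[OF tendsto_arctan_at_top])
  then have 1: "((\<lambda>y. 2 * sqrt \<kappa> * arctan (sqrt \<kappa> * sqrt (A y / B y))) \<longlongrightarrow> 2 * sqrt \<kappa> * (pi / 2)) (at y0 within betw)"
    by (intro tendsto_intros)
  have y0nz: "y0 \<noteq> 0" "A y0 \<noteq> 0" using y0_betw A_pos[of y0] by auto
  have "((\<lambda>y. sqrt 2 * sqrt (- (B y / y))) \<longlongrightarrow> sqrt 2 * sqrt (- (B y0 / y0))) (at y0 within betw)"
    using y0nz unfolding B_def by (intro tendsto_intros) auto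
  moreover have "((\<lambda>y. 2 * sqrt ((1 - 2 * \<kappa>) / (2 - c\<^sup>2)) *
             artanh (sqrt (((2 - c\<^sup>2) * B y) / ((1 - 2 * \<kappa>) * A y)))) \<longlongrightarrow>
      2 * sqrt ((1 - 2 * \<kappa>) / (2 - c\<^sup>2)) *
             artanh (sqrt (((2 - c\<^sup>2) * B y0) / ((1 - 2 * \<kappa>) * A y0)))) (at y0 within betw)"
  proof (intro tendsto_mult tendsto_const tendsto_artanh tendsto_real_sqrt tendsto_divide)
    show "(A \<longlongrightarrow> A y0) (at y0 within betw)" "(B \<longlongrightarrow> B y0) (at y0 within betw)"
      unfolding A_def B_def by (intro tendsto_intros)+
  qed (use y0nz y0_betw b_nz in auto)
  ultimately have "((\<lambda>y. if c\<^sup>2 = 2 then sqrt 2 * sqrt (- (B y / y)) else 2 * sqrt ((1 - 2 * \<kappa>) / (2 - c\<^sup>2)) *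
             artanh (sqrt (((2 - c\<^sup>2) * B y) / ((1 - 2 * \<kappa>) * A y)))) \<longlongrightarrow> 0) (at y0 within betw)"
    by (cases "c\<^sup>2 = 2") (simp_all add: y0_betw)
  from tendsto_diff[OF tendsto_add[OF 1 this] tendsto_const[of "pi * sqrt \<kappa>"]]
  have "((\<lambda>y. 2 * sqrt \<kappa> * arctan (sqrt \<kappa> * sqrt (A y / B y)) +
    (if c\<^sup>2 = 2 then sqrt 2 * sqrt (- (B y / y)) else 2 * sqrt ((1 - 2 * \<kappa>) / (2 - c\<^sup>2)) *
             artanh (sqrt (((2 - c\<^sup>2) * B y) / ((1 - 2 * \<kappa>) * A y)))) - pi * sqrt \<kappa>) \<longlongrightarrow> 0) (at y0 within betw)"
    by (simp add: mult_ac)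
  then show ?thesis
    by (rule Lim_transform_eventually) (auto simp: eventually_at_filter fhg_eq)
qed

lemma betw_between:
  assumes "y1 \<in> insert y0 betw" "y2 \<in> insert y0 betw" "y1 < z" "z < y2"
  shows "z \<in> betw"
  using assms unfolding insert_iff betw_cases by (auto split: if_splits)

lemma fhg_continuous: "continuous_on (insert y0 betw) fhg"
  unfolding continuous_on_eq_continuous_within
proof
  fix y assume "y \<in> insert y0 betw"
  then consider "y = y0" | "y \<in> betw" by auto
  then show "continuous (at y within insert y0 betw) fhg"
  proof cases
    case 1
    have "(fhg \<longlongrightarrow> fhg y0) (at y0 within insert y0 betw)"
      using fhg_tendsto_y0 by (simp add: fhg_y0 at_within_def)
    then show ?thesis using 1 by (simp add: continuous_within)
  next
    case 2
    then show ?thesis using DERIV_isCont[OF fhg_deriv] continuous_at_imp_continuous_at_within by blast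
  qed
qed

text \<open>By Rolle, equal values would force a critical point in \<open>betw\<close>, where the
  derivative has no zero. This avoids deciding whether \<open>fhg\<close> increases or decreases,
  which depends on the sign of 1 - 2 \<kappa>.\<close>

lemma fhg_inj: "inj_on fhg (insert y0 betw)"
proof -
  have False if y: "y1 \<in> insert y0 betw" "y2 \<in> insert y0 betw" "y1 < y2" "fhg y1 = fhg y2" for y1 y2
  proof -
    have sub: "{y1..y2} \<subseteq> insert y0 betw"
    proof
      fix z assume "z \<in> {y1..y2}"
      then show "z \<in> insert y0 betw"
        using betw_between[OF y(1,2), of z] y(1,2) by (cases "z = y1 \<or> z = y2") auto
    qed
    have "\<exists>z. y1 < z \<and> z < y2 \<and> DERIV fhg z :> 0"
    proof (rule Rolle[OF y(3,4)])
      show "continuous_on {y1..y2} fhg" by (rule continuous_on_subset[OF fhg_continuous sub])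
      show "fhg differentiable (at z)" if "y1 < z" "z < y2" for z
        using fhg_deriv[OF betw_between[OF y(1,2) that]] by (auto simp: real_differentiable_def)
    qed
    then obtain z where z: "y1 < z" "z < y2" "DERIV fhg z :> 0" by blast
    have zb: "z \<in> betw" by (rule betw_between[OF y(1,2) z(1,2)])
    have "- 1 / (z * sqrt (A z / B z)) = 0" by (rule DERIV_unique[OF fhg_deriv[OF zb] z(3)])
    then show False using ratio_pos[OF zb] by simp
  qed
  then show ?thesis by (intro inj_onI) (metis linorder_neqE)
qed

text \<open>In their respective cases \<open>T_int\<close> and \<open>J_int\<close> are
  \<open>betw\<close> with its closed endpoint \<open>y0\<close>, so a single inverse covers the
  four parameter sets.\<close>

lemma eta_eq: "eta c \<kappa> x = inv_into (insert y0 betw) fhg \<bar>x\<bar>"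
proof (cases rule: param_cases)
  case 1
  moreover have "T_int \<kappa> = insert y0 betw"
    using 1 y0_betw unfolding T_int_def y0_def[symmetric] set_eq_iff insert_iff betw_cases
    by (auto simp: mult_less_0_iff)
  ultimately show ?thesis by (simp add: eta_def fhg_def)
next
  case 2
  moreover have "J_int \<kappa> = insert y0 betw"
    using 2 y0_betw unfolding J_int_def y0_def[symmetric] set_eq_iff insert_iff betw_cases
    by (auto simp: mult_less_0_iff)
  moreover have "(c, \<kappa>) \<notin> D1" using 2 by (auto simp: D1_def)
  ultimately show ?thesis by (simp add: eta_def fhg_def)
next
  case 3
  moreover have "T_int \<kappa> = insert y0 betw"
    using 3 y0_betw unfolding T_int_def y0_def[symmetric] set_eq_iff insert_iff betw_cases
    by (auto simp: mult_less_0_iff)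
  moreover have "(c, \<kappa>) \<notin> D1" "(c, \<kappa>) \<notin> D3" using 3 by (auto simp: B_minus_def D1_def D3_def)
  ultimately show ?thesis by (simp add: eta_def fhg_def)
next
  case 4
  moreover have "J_int \<kappa> = insert y0 betw"
    using 4 y0_betw unfolding J_int_def y0_def[symmetric] set_eq_iff insert_iff betw_cases
    by (auto simp: mult_less_0_iff)
  moreover have "(c, \<kappa>) \<notin> D1" "(c, \<kappa>) \<notin> D3" "(c, \<kappa>) \<notin> B_minus"
    using 4 by (auto simp: B_plus_def B_minus_def D1_def D3_def)
  ultimately show ?thesis by (simp add: eta_def fhg_def)
qed

end

section \<open>Solutions of the profile equation on a half-line\<close>

lemma nonzero_same_sign:
  fixes f :: "real \<Rightarrow> real"
  assumes "continuous_on S f" "connected S" "\<And>x. x \<in> S \<Longrightarrow> f x \<noteq> 0" "x \<in> S" "y \<in> S"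
  shows "f x * f y > 0"
proof (rule ccontr)
  assume "\<not> f x * f y > 0"
  then have "f x \<le> 0 \<and> 0 \<le> f y \<or> f y \<le> 0 \<and> 0 \<le> f x" by (auto simp: not_less mult_le_0_iff)
  moreover have c: "connected (f ` S)" by (rule connected_continuous_image[OF assms(1,2)])
  ultimately have "0 \<in> f ` S"
    using connectedD_interval[OF c imageI imageI] assms(4,5) by blast
  then show False using assms(3) by auto
qed

text \<open>The equation degenerates at 0, where B(\<eta>) vanishes, hence differentiability is
  assumed on the open half-line. The last assumption is what square integrability delivers in place
  of a limit at infinity.\<close>

locale tw_profile = tw_param c \<kappa> for c \<kappa> +
  fixes \<eta> \<eta>' :: "real \<Rightarrow> real"
  assumes cont: "continuous_on {0..} \<eta>"
    and init: "\<eta> 0 = y0"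
    and der: "x > 0 \<Longrightarrow> (\<eta> has_real_derivative \<eta>' x) (at x)"
    and cont': "continuous_on {0<..} \<eta>'"
    and ode: "x > 0 \<Longrightarrow> (\<eta>' x)\<^sup>2 * B (\<eta> x) = (\<eta> x)\<^sup>2 * A (\<eta> x)"
    and B_nz: "x > 0 \<Longrightarrow> B (\<eta> x) \<noteq> 0"
    and small: "e > 0 \<Longrightarrow> \<exists>x>0. \<bar>\<eta> x\<bar> < e"
begin

lemma cont0: "continuous_on {0<..} \<eta>"
  by (rule continuous_on_subset[OF cont]) auto

lemma tendsto0: "(\<eta> \<longlongrightarrow> y0) (at_right 0)"
proof -
  have "(\<eta> \<longlongrightarrow> \<eta> 0) (at 0 within {0..})" using cont by (simp add: continuous_on_def)
  then show ?thesis unfolding init by (rule tendsto_within_subset) auto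
qed

text \<open>Gronwall backwards: away from 0 the equation gives |\<eta> \<eta>'| <= K \<eta>^2, so
  \<eta>^2 exp(2 K t) is nondecreasing and a zero at x spreads to every point on its left, down to
  the initial value \<open>y0\<close>, which is nonzero.\<close>

lemma eta_nz:
  assumes "x \<ge> 0" shows "\<eta> x \<noteq> 0"
proof
  assume zero: "\<eta> x = 0"
  have y0: "y0 \<noteq> 0" using y0_betw by auto
  with zero init assms have x: "x > 0" by (cases "x = 0") auto
  \<comment> \<open>The bound K depends on e > 0, since A / B is unbounded at the origin.\<close>
  have "\<eta> e = 0" if e: "0 < e" "e < x" for e
  proof -
    have "continuous_on {e..x} \<eta>" by (rule continuous_on_subset[OF cont]) (use e in auto)
    then have "continuous_on {e..x} (\<lambda>t. A (\<eta> t) / B (\<eta> t))"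
      using e B_nz unfolding A_def B_def by (intro continuous_intros) auto
    then have "bounded ((\<lambda>t. A (\<eta> t) / B (\<eta> t)) ` {e..x})"
      by (intro compact_imp_bounded compact_continuous_image) auto
    then obtain K0 where K0: "\<And>t. t \<in> {e..x} \<Longrightarrow> \<bar>A (\<eta> t) / B (\<eta> t)\<bar> \<le> K0"
      unfolding bounded_iff real_norm_def by blast
    \<comment> \<open>The added 1 makes K at least 1, so that K^2 also bounds A / B.\<close>
    define K where "K = \<bar>K0\<bar> + 1"
    have K: "\<bar>\<eta> t * \<eta>' t\<bar> \<le> K * (\<eta> t)\<^sup>2" if t: "t \<in> {e..x}" for t
    proof -
      have "(\<eta>' t)\<^sup>2 = (\<eta> t)\<^sup>2 * (A (\<eta> t) / B (\<eta> t))"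
        using ode[of t] B_nz[of t] t e by (simp add: field_simps)
      also have "\<dots> \<le> (\<eta> t)\<^sup>2 * K\<^sup>2"
      proof (rule mult_left_mono)
        have "A (\<eta> t) / B (\<eta> t) \<le> K" using K0[OF t] unfolding K_def by linarith
        also have "K \<le> K\<^sup>2" using mult_left_mono[of 1 K K] by (simp add: K_def power2_eq_square)
        finally show "A (\<eta> t) / B (\<eta> t) \<le> K\<^sup>2" .
      qed simp
      finally have "(\<eta>' t)\<^sup>2 \<le> (K * \<eta> t)\<^sup>2" by (simp add: power_mult_distrib mult.commute)
      then have "\<bar>\<eta>' t\<bar> \<le> \<bar>K * \<eta> t\<bar>" by (simp add: abs_le_square_iff)
      then have "\<bar>\<eta> t\<bar> * \<bar>\<eta>' t\<bar> \<le> \<bar>\<eta> t\<bar> * \<bar>K * \<eta> t\<bar>" by (intro mult_left_mono) auto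
      also have "\<dots> = K * (\<eta> t)\<^sup>2" by (simp add: abs_mult K_def power2_eq_square)
      finally show ?thesis by (simp add: abs_mult)
    qed
    have "(\<eta> e)\<^sup>2 * exp (2 * K * e) \<le> (\<eta> x)\<^sup>2 * exp (2 * K * x)"
    proof (rule DERIV_nonneg_imp_nondecreasing[OF less_imp_le[OF e(2)]])
      fix t assume t: "e \<le> t" "t \<le> x"
      have "((\<lambda>t. (\<eta> t)\<^sup>2 * exp (2 * K * t)) has_real_derivative
          (2 * \<eta> t * \<eta>' t) * exp (2 * K * t) + exp (2 * K * t) * (2 * K) * (\<eta> t)\<^sup>2) (at t)"
        using t e by (auto intro!: derivative_eq_intros der)
      moreover have "(2 * \<eta> t * \<eta>' t) * exp (2 * K * t) + exp (2 * K * t) * (2 * K) * (\<eta> t)\<^sup>2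
          = 2 * exp (2 * K * t) * (\<eta> t * \<eta>' t + K * (\<eta> t)\<^sup>2)" by (simp add: algebra_simps)
      moreover have "\<dots> \<ge> 0" using K[of t] t by (intro mult_nonneg_nonneg) auto
      ultimately show "\<exists>d. ((\<lambda>t. (\<eta> t)\<^sup>2 * exp (2 * K * t)) has_real_derivative d) (at t) \<and> 0 \<le> d" by auto
    qed
    then have "(\<eta> e)\<^sup>2 * exp (2 * K * e) \<le> 0" by (simp add: zero)
    then show ?thesis by (simp add: mult_le_0_iff not_less_iff_gr_or_eq)
  qed
  then have "eventually (\<lambda>e. \<eta> e = 0) (at_right 0)"
    using x unfolding eventually_at_right_field by blast
  then have "(\<eta> \<longlongrightarrow> 0) (at_right 0)" by (rule tendsto_eventually)
  then have "y0 = 0" using tendsto_unique[OF _ tendsto0] by simp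
  then show False using y0 by simp
qed

text \<open>On the open half-line neither \<eta> nor B(\<eta>) vanishes, so both keep their sign.
  That of \<eta> is read off at 0; that of B(\<eta>), which vanishes at 0, at a point where \<eta>
  is so small that B(\<eta>) has the sign of 1 - 2 \<kappa>.\<close>

lemma eta_betw:
  assumes "x > 0" shows "\<eta> x \<in> betw"
proof -
  have 1: "\<eta> 0 * \<eta> x > 0"
    by (rule nonzero_same_sign[OF cont]) (use eta_nz assms in auto)
  have "\<eta> x * (1 - 2 * \<kappa>) < 0"
    using 1 y0_betw(1) by (auto simp: init zero_less_mult_iff mult_less_0_iff)
  define b where "b = 1 - 2 * \<kappa>"
  have b: "b \<noteq> 0" using b_nz by (simp add: b_def)
  obtain z where z: "z > 0" "\<bar>\<eta> z\<bar> < \<bar>b\<bar> / (2 * \<kappa>)"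
    using small[of "\<bar>b\<bar> / (2 * \<kappa>)"] b kappa_pos by auto
  have "\<bar>2 * \<kappa> * \<eta> z\<bar> < \<bar>b\<bar>" using z kappa_pos by (simp add: abs_mult field_simps)
  then have Bz: "B (\<eta> z) * b > 0"
    using b by (auto simp: B_def b_def[symmetric] zero_less_mult_iff)
  have "continuous_on {0<..} (\<lambda>x. B (\<eta> x))"
    unfolding B_def by (intro continuous_intros cont0)
  then have "B (\<eta> z) * B (\<eta> x) > 0"
    by (rule nonzero_same_sign) (use assms z B_nz in auto)
  then have "B (\<eta> x) * b > 0" using Bz by (auto simp: zero_less_mult_iff)
  with \<open>\<eta> x * (1 - 2 * \<kappa>) < 0\<close> show ?thesis by (simp add: betw_def b_def)
qed

lemma eta'_sq:
  assumes "x > 0" shows "(\<eta>' x)\<^sup>2 = (\<eta> x)\<^sup>2 * (A (\<eta> x) / B (\<eta> x))"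
  using ode[OF assms] B_nz[OF assms] by (simp add: field_simps)

lemma eta'_nz: "x > 0 \<Longrightarrow> \<eta>' x \<noteq> 0"
  using eta'_sq[of x] ratio_pos[OF eta_betw[of x]] by auto

text \<open>If |\<eta>| grew at one point it would grow everywhere, because \<eta> \<eta>' has no
  zeros; \<eta>^2 could then never fall below its initial value, against
  \<open>small\<close>.\<close>

lemma eta_decay:
  assumes "x > 0" shows "\<eta> x * \<eta>' x < 0"
proof (rule ccontr)
  assume "\<not> \<eta> x * \<eta>' x < 0"
  then have px: "\<eta> x * \<eta>' x > 0" using assms eta'_nz[of x] eta_nz[of x] by (auto simp: not_less less_le)
  have pos: "\<eta> t * \<eta>' t > 0" if "t > 0" for t
  proof -
    have "(\<eta> x * \<eta>' x) * (\<eta> t * \<eta>' t) > 0"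
      by (rule nonzero_same_sign[of "{0<..}"]) (use that assms eta'_nz eta_nz in \<open>auto intro!: continuous_intros cont0 cont'\<close>)
    then show ?thesis using px by (simp add: zero_less_mult_iff)
  qed
  have mono: "(\<eta> s)\<^sup>2 \<le> (\<eta> t)\<^sup>2" if "0 < s" "s \<le> t" for s t
  proof (rule DERIV_nonneg_imp_nondecreasing[OF that(2)])
    fix r assume "s \<le> r" "r \<le> t"
    then have r: "r > 0" using that by simp
    have "((\<lambda>t. (\<eta> t)\<^sup>2) has_real_derivative 2 * (\<eta> r * \<eta>' r)) (at r)"
      using r by (auto intro!: derivative_eq_intros der)
    moreover have "2 * (\<eta> r * \<eta>' r) \<ge> 0" using pos[OF r] by simp
    ultimately show "\<exists>d. ((\<lambda>t. (\<eta> t)\<^sup>2) has_real_derivative d) (at r) \<and> 0 \<le> d" by blast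
  qed
  have "y0\<^sup>2 \<le> (\<eta> t)\<^sup>2" if "t > 0" for t
  proof (rule tendsto_upperbound[OF tendsto_power[OF tendsto0]])
    show "\<forall>\<^sub>F s in at_right 0. (\<eta> s)\<^sup>2 \<le> (\<eta> t)\<^sup>2"
      unfolding eventually_at_right_field using that mono by (intro exI[of _ t]) auto
  qed simp
  moreover obtain t where "t > 0" "\<bar>\<eta> t\<bar> < \<bar>y0\<bar>" using small[of "\<bar>y0\<bar>"] y0_betw(1) by fastforce
  ultimately show False by (metis abs_le_square_iff not_le)
qed

lemma filterlim_eta: "filterlim \<eta> (at y0 within betw) (at_right 0)"
  unfolding filterlim_at
proof
  show "\<forall>\<^sub>F x in at_right 0. \<eta> x \<in> betw \<and> \<eta> x \<noteq> y0"
    unfolding eventually_at_filter using eta_betw y0_notin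
    by (intro always_eventually) (metis greaterThan_iff)
qed (rule tendsto0)

text \<open>\<open>eta_decay\<close> selects the root \<eta>' = -\<eta> sqrt(A / B), for which
  \<open>fhg_deriv\<close> gives slope 1; the integration constant comes from the limit at the
  origin.\<close>

lemma fhg_eta:
  assumes "x > 0" shows "fhg (\<eta> x) = x"
proof -
  have D: "((\<lambda>x. fhg (\<eta> x) - x) has_real_derivative 0) (at t)" if t: "t > 0" for t
  proof -
    note p = ratio_pos[OF eta_betw[OF t]]
    define s where "s = sqrt (A (\<eta> t) / B (\<eta> t))"
    have s: "s > 0" "(\<eta>' t)\<^sup>2 = (\<eta> t * s)\<^sup>2"
      using p eta'_sq[OF t] by (auto simp: s_def power_mult_distrib)
    have "\<eta>' t = - (\<eta> t * s)"
    proof -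
      have "\<eta>' t = \<eta> t * s \<or> \<eta>' t = - (\<eta> t * s)" using s(2) by (simp add: power2_eq_iff)
      moreover have "\<eta>' t \<noteq> \<eta> t * s"
      proof
        assume "\<eta>' t = \<eta> t * s"
        then have "\<eta> t * \<eta>' t = (\<eta> t)\<^sup>2 * s" by (simp add: power2_eq_square)
        also have "\<dots> \<ge> 0" using s by simp
        finally show False using eta_decay[OF t] by simp
      qed
      ultimately show ?thesis by blast
    qed
    then have "- 1 / (\<eta> t * s) * \<eta>' t = 1" using s p by simp
    moreover have "((\<lambda>x. fhg (\<eta> x)) has_real_derivative - 1 / (\<eta> t * s) * \<eta>' t) (at t)"
      unfolding s_def by (rule DERIV_chain2[OF fhg_deriv[OF eta_betw[OF t]] der[OF t]])
    ultimately have "((\<lambda>x. fhg (\<eta> x)) has_real_derivative 1) (at t)" by simp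
    from DERIV_diff[OF this DERIV_ident] show ?thesis by simp
  qed
  have "(\<lambda>x. fhg (\<eta> x) - x) constant_on {0<..}"
    by (rule has_field_derivative_0_imp_constant_on) (use D in auto)
  then obtain C where C: "\<And>t. t > 0 \<Longrightarrow> fhg (\<eta> t) - t = C" by (auto simp: constant_on_def)
  have "((\<lambda>x. fhg (\<eta> x)) \<longlongrightarrow> 0) (at_right 0)" by (rule filterlim_compose[OF fhg_tendsto_y0 filterlim_eta])
  then have "((\<lambda>x. fhg (\<eta> x) - x) \<longlongrightarrow> 0 - 0) (at_right 0)" by (intro tendsto_intros)
  moreover have "((\<lambda>x. fhg (\<eta> x) - x) \<longlongrightarrow> C) (at_right 0)"
    by (rule tendsto_eventually) (use C in \<open>auto simp: eventually_at_filter\<close>)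
  ultimately have "C = 0" using tendsto_unique[of "at_right (0::real)"] by fastforce
  then show ?thesis using C[OF assms] by simp
qed

lemma profile_eq_eta:
  assumes "x \<ge> 0" shows "eta c \<kappa> x = \<eta> x"
proof -
  have "\<eta> x \<in> insert y0 betw" "fhg (\<eta> x) = x"
    using eta_betw[of x] fhg_eta[of x] init fhg_y0 assms by (cases "x = 0"; simp)+
  then show ?thesis unfolding eta_eq using inv_into_f_eq[OF fhg_inj] assms by simp
qed

lemma eta'_blowup: "filterlim (\<lambda>x. \<bar>\<eta>' x\<bar>) at_top (at_right 0)"
proof -
  from filterlim_compose[OF ratio_at_top filterlim_eta]
  have "filterlim (\<lambda>x. A (\<eta> x) / B (\<eta> x)) at_top (at_right 0)" .
  moreover have "((\<lambda>x. (\<eta> x)\<^sup>2) \<longlongrightarrow> y0\<^sup>2) (at_right 0)" by (intro tendsto_intros tendsto0)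
  moreover have "y0\<^sup>2 > 0" using y0_betw by auto
  ultimately have "filterlim (\<lambda>x. (\<eta> x)\<^sup>2 * (A (\<eta> x) / B (\<eta> x))) at_top (at_right 0)"
    by (intro filterlim_tendsto_pos_mult_at_top)
  then have "filterlim (\<lambda>x. sqrt ((\<eta> x)\<^sup>2 * (A (\<eta> x) / B (\<eta> x)))) at_top (at_right 0)"
    by (rule filterlim_compose[OF sqrt_at_top])
  moreover have "sqrt ((\<eta> x)\<^sup>2 * (A (\<eta> x) / B (\<eta> x))) = \<bar>\<eta>' x\<bar>" if "x > 0" for x
    using eta'_sq[OF that] by (metis real_sqrt_abs)
  ultimately show ?thesis
    by (rule_tac filterlim_cong[THEN iffD1, rotated 3]) (auto simp: eventually_at_filter)
qed

text \<open>By the mean value theorem a right-hand difference quotient at 0 equals \<eta>' at an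
  intermediate point. Near 0 it would have to be within 1 of D, yet at least |D| + 1 in absolute
  value.\<close>

lemma not_differentiable:
  fixes f :: "real \<Rightarrow> real"
  assumes "\<And>x. x \<ge> 0 \<Longrightarrow> f x = \<eta> x"
  shows "\<not> f differentiable (at 0)"
proof
  assume "f differentiable (at 0)"
  then obtain D where "(f has_real_derivative D) (at 0)" by (auto simp: real_differentiable_def)
  then have "((\<lambda>x. (f x - f 0) / (x - 0)) \<longlongrightarrow> D) (at_right 0)"
    unfolding has_field_derivative_iff by (rule filterlim_mono) (auto intro: at_le)
  then have "eventually (\<lambda>x. dist ((f x - f 0) / (x - 0)) D < 1) (at_right 0)"
    by (rule tendstoD) simp
  moreover have "eventually (\<lambda>x. \<bar>\<eta>' x\<bar> \<ge> \<bar>D\<bar> + 1) (at_right 0)"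
    using eta'_blowup by (simp add: filterlim_at_top)
  ultimately have "eventually (\<lambda>x. dist ((f x - f 0) / (x - 0)) D < 1 \<and> \<bar>\<eta>' x\<bar> \<ge> \<bar>D\<bar> + 1) (at_right 0)"
    by (rule eventually_conj)
  then obtain b where b: "b > 0" "\<And>x. x > 0 \<Longrightarrow> x < b \<Longrightarrow> dist ((f x - f 0) / (x - 0)) D < 1 \<and> \<bar>\<eta>' x\<bar> \<ge> \<bar>D\<bar> + 1"
    unfolding eventually_at_right_field by blast
  define x where "x = b / 2"
  have x: "0 < x" "x < b" using b(1) by (auto simp: x_def)
  have "\<exists>l z. z > 0 \<and> z < x \<and> DERIV \<eta> z :> l \<and> \<eta> x - \<eta> 0 = (x - 0) * l"
  proof (rule MVT)
    show "continuous_on {0..x} \<eta>" by (rule continuous_on_subset[OF cont]) auto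
    show "\<eta> differentiable (at z)" if "0 < z" "z < x" for z
      using der[OF that(1)] by (auto simp: real_differentiable_def)
  qed (use x in auto)
  then obtain l z where z: "z > 0" "z < x" "DERIV \<eta> z :> l" "\<eta> x - \<eta> 0 = (x - 0) * l" by blast
  have "l = \<eta>' z" by (rule DERIV_unique[OF z(3) der[OF z(1)]])
  then have "(f x - f 0) / (x - 0) = \<eta>' z" using z(4) x assms by simp
  then have "dist (\<eta>' z) D < 1" using b(2)[OF x] by simp
  moreover have "\<bar>\<eta>' z\<bar> \<ge> \<bar>D\<bar> + 1" using b(2)[of z] z x by simp
  ultimately show False by (simp add: dist_real_def)
qed

end

section \<open>Classical solutions off the origin\<close>

text \<open>The speed is a separate parameter \<open>d\<close> because reflection turns c into -c,
  while \<open>A\<close> and \<open>B\<close> contain only c^2. The equation is stated through the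
  derivative of the combination called \<open>V\<close> below, as differentiability of
  \<open>W\<close> has still to be derived.\<close>

locale tw_half_line = tw_param c \<kappa> for c \<kappa> +
  fixes d :: real and u W :: "real \<Rightarrow> complex"
  assumes d_sq: "d\<^sup>2 = c\<^sup>2"
    and u_cont: "continuous_on {0..} u"
    and u_0: "(cmod (u 0))\<^sup>2 = 1 / (2 * \<kappa>)"
    and u_Gamma: "x > 0 \<Longrightarrow> (cmod (u x))\<^sup>2 \<noteq> 1 / (2 * \<kappa>)"
    and u_deriv: "x > 0 \<Longrightarrow> (u has_vector_derivative W x) (at x)"
    and W_cont: "continuous_on {0<..} W"
    and V_deriv: "x > 0 \<Longrightarrow> ((\<lambda>x. W x - (2 * \<kappa> * (u x \<bullet> W x)) *\<^sub>R u x) has_vector_derivative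
       - (\<i> * of_real d * W x + (1 - (cmod (u x))\<^sup>2) *\<^sub>R u x + (2 * \<kappa> * (u x \<bullet> W x)) *\<^sub>R W x)) (at x)"
    and small: "e > 0 \<Longrightarrow> \<exists>x>0. (1 - (cmod (u x))\<^sup>2)\<^sup>2 + (cmod (W x))\<^sup>2 < e"
begin

text \<open>Here \<open>p\<close> is -\<eta>' / 2 and \<open>m\<close> is the momentum
  density.\<close>

definition "\<eta> x = 1 - (cmod (u x))\<^sup>2"
definition "p x = u x \<bullet> W x"
definition "m x = (\<i> * u x) \<bullet> W x"
definition "V x = W x - (2 * \<kappa> * p x) *\<^sub>R u x"

lemma V_deriv': "x > 0 \<Longrightarrow> (V has_vector_derivative
   - (\<i> * of_real d * W x + \<eta> x *\<^sub>R u x + (2 * \<kappa> * p x) *\<^sub>R W x)) (at x)"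
  using V_deriv[of x] by (simp add: V_def[abs_def] p_def \<eta>_def)

lemma \<eta>_deriv: assumes "x > 0" shows "(\<eta> has_real_derivative - 2 * p x) (at x)"
proof -
  have "((\<lambda>x. 1 - u x \<bullet> u x) has_real_derivative 0 - (u x \<bullet> W x + W x \<bullet> u x)) (at x)"
    by (intro DERIV_diff DERIV_const has_real_derivative_inner u_deriv assms)
  then show ?thesis by (simp add: \<eta>_def[abs_def] p_def inner_commute power2_norm_eq_inner)
qed

text \<open>u and \<i> u are orthogonal and of equal length, so this is Pythagoras for the
  components of \<open>W\<close> along them.\<close>

lemma Lagrange: "(cmod (u x))\<^sup>2 * (cmod (W x))\<^sup>2 = (p x)\<^sup>2 + (m x)\<^sup>2"
  unfolding cmod_power2 p_def m_def inner_complex_def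
  by (simp add: algebra_simps power2_eq_square)

text \<open>Pairing with \<i> u does not see multiples of u, so \<open>m\<close> can be computed
  from \<open>V\<close>, whose derivative is known. The same orthogonality removes the term \<eta> u
  of the equation.\<close>

lemma momentum_deriv:
  assumes "x > 0"
  shows "((\<lambda>x. m x - d / 2 * \<eta> x) has_real_derivative 0) (at x)"
proof -
  let ?V' = "- (\<i> * of_real d * W x + \<eta> x *\<^sub>R u x + (2 * \<kappa> * p x) *\<^sub>R W x)"
  have mV: "m = (\<lambda>x. (\<i> * u x) \<bullet> V x)"
    by (simp add: fun_eq_iff m_def V_def inner_complex_def algebra_simps)
  have "((\<lambda>x. \<i> * u x) has_vector_derivative \<i> * W x) (at x)"
    by (rule has_vector_derivative_mult_right[OF u_deriv[OF assms]])
  from has_real_derivative_inner[OF this V_deriv'[OF assms]]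
  have "(m has_real_derivative (\<i> * u x) \<bullet> ?V' + (\<i> * W x) \<bullet> V x) (at x)" unfolding mV .
  moreover have "(\<i> * u x) \<bullet> ?V' + (\<i> * W x) \<bullet> V x = - d * p x"
    unfolding V_def by (simp add: p_def inner_complex_def algebra_simps)
  ultimately have "(m has_real_derivative - d * p x) (at x)" by simp
  from DERIV_diff[OF this DERIV_cmult[OF \<eta>_deriv[OF assms], of "d / 2"]]
  show ?thesis by simp
qed

text \<open>Pairing \<open>V\<close> with u multiplies \<open>p\<close> by 1 - 2 \<kappa> |u|^2,
  which is nonzero off \<Gamma>(u); division expresses \<open>p\<close> through differentiable
  functions.\<close>

lemma p_differentiable:
  assumes "x > 0"
  obtains p' where "(p has_real_derivative p') (at x)"
proof -
  have nz: "1 - 2 * \<kappa> * (u x \<bullet> u x) \<noteq> 0" if "x > 0" for x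
    using u_Gamma[OF that] kappa_pos by (simp add: power2_norm_eq_inner field_simps)
  have "\<exists>D. ((\<lambda>x. (u x \<bullet> V x) / (1 - 2 * \<kappa> * (u x \<bullet> u x))) has_real_derivative D) (at x)"
    by (rule exI, rule DERIV_divide[OF has_real_derivative_inner[OF u_deriv V_deriv'] DERIV_diff[OF DERIV_const
            DERIV_cmult[OF has_real_derivative_inner[OF u_deriv u_deriv]]] nz]) (fact assms)+
  then obtain D where "((\<lambda>x. (u x \<bullet> V x) / (1 - 2 * \<kappa> * (u x \<bullet> u x))) has_real_derivative D) (at x)" ..
  note D = this
  have eq: "(u y \<bullet> V y) / (1 - 2 * \<kappa> * (u y \<bullet> u y)) = p y" if "y \<in> {0<..}" for y
    using nz[of y] that by (simp add: V_def p_def inner_diff_right field_simps)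
  have "(p has_real_derivative D) (at x)"
    by (rule has_field_derivative_transform_within_open[OF D open_greaterThan _ eq]) (use assms in auto)
  then show ?thesis by (rule that)
qed

text \<open>Pairing the equation with \<open>W\<close>. The derivative of \<open>p\<close>, of which
  no formula is known, enters through 2 \<kappa> p' u and cancels against the derivative of 2
  \<kappa> p^2.\<close>

lemma energy_deriv:
  assumes "x > 0"
  shows "((\<lambda>x. (cmod (W x))\<^sup>2 - (\<eta> x)\<^sup>2 / 2 - 2 * \<kappa> * (p x)\<^sup>2) has_real_derivative 0) (at x)"
proof -
  obtain p' where p': "(p has_real_derivative p') (at x)" by (rule p_differentiable[OF assms])
  let ?V' = "- (\<i> * of_real d * W x + \<eta> x *\<^sub>R u x + (2 * \<kappa> * p x) *\<^sub>R W x)"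
  let ?W' = "?V' + ((2 * \<kappa> * p x) *\<^sub>R W x + (2 * \<kappa> * p') *\<^sub>R u x)"
  have WV: "W = (\<lambda>x. V x + (2 * \<kappa> * p x) *\<^sub>R u x)" by (simp add: V_def fun_eq_iff)
  have W': "(W has_vector_derivative ?W') (at x)"
    by (subst WV, intro has_vector_derivative_add V_deriv' has_vector_derivative_scaleR DERIV_cmult u_deriv p' assms)
  have "((\<lambda>x. W x \<bullet> W x - \<eta> x * \<eta> x / 2 - 2 * \<kappa> * (p x * p x)) has_real_derivative
     (W x \<bullet> ?W' + ?W' \<bullet> W x) - (- 2 * p x * \<eta> x + - 2 * p x * \<eta> x) / 2 - 2 * \<kappa> * (p' * p x + p' * p x)) (at x)"
    by (intro DERIV_diff DERIV_cdivide DERIV_cmult has_real_derivative_inner W' DERIV_mult \<eta>_deriv p' assms)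
  moreover have "(W x \<bullet> ?W' + ?W' \<bullet> W x) - (- 2 * p x * \<eta> x + - 2 * p x * \<eta> x) / 2 - 2 * \<kappa> * (p' * p x + p' * p x) = 0"
    by (simp add: p_def inner_complex_def field_simps)
  ultimately have "((\<lambda>x. W x \<bullet> W x - \<eta> x * \<eta> x / 2 - 2 * \<kappa> * (p x * p x)) has_real_derivative 0) (at x)"
    by (simp only:)
  then show ?thesis unfolding power2_norm_eq_inner by (simp add: power2_eq_square)
qed

section \<open>The constants of motion vanish\<close>

lemma small_point:
  assumes "0 < e" "e \<le> 1"
  obtains x where "x > 0" "\<bar>\<eta> x\<bar> \<le> e" "\<bar>m x\<bar> \<le> 2 * e" "\<bar>p x\<bar> \<le> 2 * e" "cmod (W x) \<le> e"
proof -
  obtain x where x: "x > 0" "(\<eta> x)\<^sup>2 + (cmod (W x))\<^sup>2 < e\<^sup>2"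
    using small[of "e\<^sup>2"] assms by (auto simp: \<eta>_def)
  have 1: "(\<eta> x)\<^sup>2 \<le> e\<^sup>2" "(cmod (W x))\<^sup>2 \<le> e\<^sup>2"
    using x(2) zero_le_power2[of "\<eta> x"] zero_le_power2[of "cmod (W x)"] by linarith+
  have \<eta>: "\<bar>\<eta> x\<bar> \<le> e" by (rule power2_le_imp_le) (use 1(1) assms in auto)
  have W: "cmod (W x) \<le> e" using assms by (intro power2_le_imp_le[OF 1(2)]) simp
  \<comment> \<open>Since e <= 1, |u|^2 = 1 - \<eta> is at most 2; the cruder bound 4 gives |u| <=
    2.\<close>
  have "(cmod (u x))\<^sup>2 \<le> 2\<^sup>2" using \<eta> assms by (simp add: \<eta>_def)
  then have u: "cmod (u x) \<le> 2" by (rule power2_le_imp_le) simp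
  have uW: "cmod (u x) * cmod (W x) \<le> 2 * e" using u W by (intro mult_mono) auto
  have "\<bar>p x\<bar> \<le> 2 * e" using Cauchy_Schwarz_ineq2[of "u x" "W x"] uW by (simp add: p_def)
  moreover have "\<bar>m x\<bar> \<le> 2 * e"
    using Cauchy_Schwarz_ineq2[of "\<i> * u x" "W x"] uW by (simp add: m_def norm_mult)
  ultimately show ?thesis by (intro that[of x] x(1) \<eta> W)
qed

lemma momentum: assumes "x > 0" shows "m x = d / 2 * \<eta> x"
proof -
  obtain C where C: "\<And>x. x > 0 \<Longrightarrow> m x - d / 2 * \<eta> x = C"
    using zero_deriv_half_line_const[OF momentum_deriv] by auto
  have "C = 0"
  proof (rule eq_zero_if_abs_le_small[of _ "2 + \<bar>d\<bar>"])
    fix e :: real assume e: "0 < e" "e \<le> 1"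
    obtain x where x: "x > 0" "\<bar>\<eta> x\<bar> \<le> e" "\<bar>m x\<bar> \<le> 2 * e" "\<bar>p x\<bar> \<le> 2 * e" "cmod (W x) \<le> e"
      by (rule small_point[OF e])
    have "\<bar>C\<bar> \<le> \<bar>m x\<bar> + \<bar>d / 2 * \<eta> x\<bar>" using C[OF x(1)] by linarith
    also have "\<bar>d / 2 * \<eta> x\<bar> \<le> \<bar>d\<bar> * e"
      using mult_mono[of "\<bar>d\<bar> / 2" "\<bar>d\<bar>" "\<bar>\<eta> x\<bar>" e] x(2) by (simp add: abs_mult)
    finally show "\<bar>C\<bar> \<le> (2 + \<bar>d\<bar>) * e" using x(3) by (simp add: algebra_simps)
  qed simp
  then show ?thesis using C[OF assms] by simp
qed

lemma energy: assumes "x > 0" shows "(cmod (W x))\<^sup>2 = (\<eta> x)\<^sup>2 / 2 + 2 * \<kappa> * (p x)\<^sup>2"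
proof -
  obtain C where C: "\<And>x. x > 0 \<Longrightarrow> (cmod (W x))\<^sup>2 - (\<eta> x)\<^sup>2 / 2 - 2 * \<kappa> * (p x)\<^sup>2 = C"
    using zero_deriv_half_line_const[OF energy_deriv] by auto
  have "C = 0"
  \<comment> \<open>|W|^2 and \<eta>^2 contribute at most 2 e^2, the term 2 \<kappa> p^2 at most 8
    \<kappa> e^2, and e^2 <= e.\<close>
  proof (rule eq_zero_if_abs_le_small[of _ "2 + 8 * \<kappa>"])
    fix e :: real assume e: "0 < e" "e \<le> 1"
    obtain x where x: "x > 0" "\<bar>\<eta> x\<bar> \<le> e" "\<bar>m x\<bar> \<le> 2 * e" "\<bar>p x\<bar> \<le> 2 * e" "cmod (W x) \<le> e"
      by (rule small_point[OF e])
    have "(cmod (W x))\<^sup>2 \<le> e\<^sup>2" using x(5) by (intro power_mono) auto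
    moreover have "(\<eta> x)\<^sup>2 \<le> e\<^sup>2" using power_mono[OF x(2), of 2] by simp
    moreover have "(p x)\<^sup>2 \<le> 4 * e\<^sup>2" using power_mono[OF x(4), of 2] by (simp add: power_mult_distrib)
    then have "2 * \<kappa> * (p x)\<^sup>2 \<le> 2 * \<kappa> * (4 * e\<^sup>2)" using kappa_pos by (intro mult_left_mono) auto
    moreover have "2 * \<kappa> * (p x)\<^sup>2 \<ge> 0" using kappa_pos by simp
    ultimately have "\<bar>C\<bar> \<le> 2 * e\<^sup>2 + 2 * \<kappa> * (4 * e\<^sup>2)"
      using C[OF x(1)] zero_le_power2[of "\<eta> x"] zero_le_power2[of "cmod (W x)"] zero_le_power2[of e]
      unfolding abs_le_iff by linarith
    also have "\<dots> = (2 + 8 * \<kappa>) * e\<^sup>2" by (simp add: algebra_simps)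
    also have "\<dots> \<le> (2 + 8 * \<kappa>) * e"
      using e kappa_pos by (intro mult_left_mono) (auto simp: power2_eq_square mult_left_le)
    finally show "\<bar>C\<bar> \<le> (2 + 8 * \<kappa>) * e" .
  qed (use kappa_pos in simp)
  then show ?thesis using C[OF assms] by simp
qed

sublocale tw_profile c \<kappa> \<eta> "\<lambda>x. - 2 * p x"
proof
  show "continuous_on {0..} \<eta>" unfolding \<eta>_def by (intro continuous_intros u_cont)
  show "\<eta> 0 = y0" by (simp add: \<eta>_def y0_def u_0)
  show "continuous_on {0<..} (\<lambda>x. - 2 * p x)" unfolding p_def
    by (intro continuous_intros W_cont continuous_on_subset[OF u_cont]) auto
  show "(- 2 * p x)\<^sup>2 * B (\<eta> x) = (\<eta> x)\<^sup>2 * A (\<eta> x)" if "x > 0" for x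
  proof -
    \<comment> \<open>Inserting energy and momentum into \<open>Lagrange\<close> leaves a relation
      between \<eta> and p alone.\<close>
    have "(1 - \<eta> x) * ((\<eta> x)\<^sup>2 / 2 + 2 * \<kappa> * (p x)\<^sup>2) = (p x)\<^sup>2 + (d / 2 * \<eta> x)\<^sup>2"
      using Lagrange[of x] unfolding energy[OF that] momentum[OF that] by (simp add: \<eta>_def)
    then have "4 * ((1 - \<eta> x) * ((\<eta> x)\<^sup>2 / 2 + 2 * \<kappa> * (p x)\<^sup>2)) = 4 * (p x)\<^sup>2 + c\<^sup>2 * (\<eta> x)\<^sup>2"
      by (simp add: power_mult_distrib power_divide d_sq)
    then show ?thesis by (simp add: A_def B_def field_simps power2_eq_square)
  qed
  show "B (\<eta> x) \<noteq> 0" if "x > 0" for x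
    using u_Gamma[OF that] kappa_pos by (simp add: B_def \<eta>_def field_simps)
  show "\<exists>x>0. \<bar>\<eta> x\<bar> < e" if "e > 0" for e
  proof -
    define e' where "e' = min (e / 2) 1"
    have e': "0 < e'" "e' \<le> 1" "e' < e" using that by (auto simp: e'_def)
    obtain x where "x > 0" "\<bar>\<eta> x\<bar> \<le> e'" "\<bar>m x\<bar> \<le> 2 * e'" "\<bar>p x\<bar> \<le> 2 * e'" "cmod (W x) \<le> e'"
      by (rule small_point[OF e'(1,2)])
    then show ?thesis using e'(3) by (intro exI[of _ x]) auto
  qed
qed (rule \<eta>_deriv)

end

section \<open>The two half-lines together\<close>

locale tw_line = tw_param c \<kappa> for c \<kappa> +
  fixes u W :: "real \<Rightarrow> complex"
  assumes u_cont: "continuous_on UNIV u"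
    and Gamma: "Gamma_set \<kappa> u = {0}"
    and u_deriv: "x \<noteq> 0 \<Longrightarrow> (u has_vector_derivative W x) (at x)"
    and W_cont: "continuous_on (- {0}) W"
    and V_deriv: "x \<noteq> 0 \<Longrightarrow> ((\<lambda>x. W x - (2 * \<kappa> * (u x \<bullet> W x)) *\<^sub>R u x) has_vector_derivative
       - (\<i> * of_real c * W x + (1 - (cmod (u x))\<^sup>2) *\<^sub>R u x + (2 * \<kappa> * (u x \<bullet> W x)) *\<^sub>R W x)) (at x)"
    and small_right: "e > 0 \<Longrightarrow> \<exists>x>0. (1 - (cmod (u x))\<^sup>2)\<^sup>2 + (cmod (W x))\<^sup>2 < e"
    and small_left: "e > 0 \<Longrightarrow> \<exists>x<0. (1 - (cmod (u x))\<^sup>2)\<^sup>2 + (cmod (W x))\<^sup>2 < e"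
begin

lemma Gamma': "(cmod (u x))\<^sup>2 = 1 / (2 * \<kappa>) \<longleftrightarrow> x = 0"
  using Gamma by (auto simp: Gamma_set_def set_eq_iff)

sublocale right: tw_half_line c \<kappa> c u W
proof
  show "continuous_on {0..} u" by (rule continuous_on_subset[OF u_cont]) simp
  show "continuous_on {0<..} W" by (rule continuous_on_subset[OF W_cont]) auto
qed (use Gamma' u_deriv V_deriv small_right in auto)

text \<open>Under reflection the derivative of u and the speed both change sign, which leaves the
  equation invariant.\<close>

sublocale left: tw_half_line c \<kappa> "- c" "\<lambda>x. u (- x)" "\<lambda>x. - W (- x)"
proof
  show "continuous_on {0..} (\<lambda>x. u (- x))"
    by (intro continuous_on_compose2[OF u_cont] continuous_intros) simp
  show "continuous_on {0<..} (\<lambda>x. - W (- x))"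
    by (intro continuous_intros continuous_on_compose2[OF W_cont]) auto
  show "((\<lambda>x. u (- x)) has_vector_derivative - W (- x)) (at x)" if "0 < x" for x
    using that by (intro has_vector_derivative_reflect u_deriv) auto
  show "((\<lambda>x. - W (- x) - (2 * \<kappa> * (u (- x) \<bullet> - W (- x))) *\<^sub>R u (- x)) has_vector_derivative
       - (\<i> * of_real (- c) * - W (- x) + (1 - (cmod (u (- x)))\<^sup>2) *\<^sub>R u (- x) + (2 * \<kappa> * (u (- x) \<bullet> - W (- x))) *\<^sub>R - W (- x))) (at x)"
    if "0 < x" for x
    using has_vector_derivative_minus[OF has_vector_derivative_reflect[OF V_deriv[of "- x"]]] that
    by (simp add: algebra_simps)
  show "\<exists>x>0. (1 - (cmod (u (- x)))\<^sup>2)\<^sup>2 + (cmod (- W (- x)))\<^sup>2 < e" if e: "e > 0" for e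
  proof -
    obtain x where "x < 0" "(1 - (cmod (u x))\<^sup>2)\<^sup>2 + (cmod (W x))\<^sup>2 < e" using small_left[OF e] by auto
    then show ?thesis by (intro exI[of _ "- x"]) simp
  qed
qed (use Gamma' in auto)

lemma eta_u: "eta c \<kappa> x = 1 - (cmod (u x))\<^sup>2"
proof (cases "x \<ge> 0")
  case True
  then show ?thesis using right.profile_eq_eta[of x] by (simp add: right.\<eta>_def)
next
  case False
  then show ?thesis using left.profile_eq_eta[of "- x"] by (simp add: left.\<eta>_def eta_eq)
qed

text \<open>The values of \<open>eta\<close> lie between \<open>y0\<close> and 0, both of which are
  less than 1. Division by |u| is therefore possible everywhere, including at the origin.\<close>

lemma u_nz: "u x \<noteq> 0"
proof -
  have 1: "1 - eta c \<kappa> z > 0" if z: "z \<ge> 0" for z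
  proof -
    have "y0 < 1" using kappa_pos by (simp add: y0_def)
    moreover have "eta c \<kappa> z \<in> insert y0 betw"
      unfolding right.profile_eq_eta[OF z] using right.eta_betw[of z] right.init z by (cases "z = 0") auto
    ultimately show ?thesis using betw_cases[of "eta c \<kappa> z"] by (auto split: if_splits)
  qed
  have "1 - eta c \<kappa> x > 0" using 1[of "\<bar>x\<bar>"] by (simp add: eta_eq)
  then show ?thesis by (auto simp: eta_u)
qed

lemma momentum_line: "x \<noteq> 0 \<Longrightarrow> (\<i> * u x) \<bullet> W x = c / 2 * (1 - (cmod (u x))\<^sup>2)"
  using right.momentum[of x] left.momentum[of "- x"]
  by (cases "x > 0") (auto simp: right.m_def left.m_def right.\<eta>_def left.\<eta>_def)

section \<open>The phase\<close>

lemma eta_ratio_cont: "continuous_on UNIV (\<lambda>x. eta c \<kappa> x / (1 - eta c \<kappa> x))"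
  unfolding eta_u using u_nz by (intro continuous_intros u_cont) auto

lemma theta_deriv: "(theta c \<kappa> has_real_derivative c / 2 * (eta c \<kappa> x / (1 - eta c \<kappa> x))) (at x)"
proof -
  \<comment> \<open>Chosen so that \<open>{- K..K}\<close> contains the base point 0 and has x in
    its interior.\<close>
  define K where "K = \<bar>x\<bar> + 1"
  have "((\<lambda>v. LBINT y=ereal 0..ereal v. eta c \<kappa> y / (1 - eta c \<kappa> y)) has_vector_derivative
      eta c \<kappa> x / (1 - eta c \<kappa> x)) (at x within {- K..K})"
    by (rule interval_integral_FTC2) (auto simp: K_def intro: continuous_on_subset[OF eta_ratio_cont])
  moreover have "at x within {- K..K} = at x" by (rule at_within_Icc_at) (auto simp: K_def)
  ultimately have "((\<lambda>v. LBINT y=0..v. eta c \<kappa> y / (1 - eta c \<kappa> y)) has_real_derivative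
      eta c \<kappa> x / (1 - eta c \<kappa> x)) (at x)"
    by (simp add: has_real_derivative_iff_has_vector_derivative zero_ereal_def)
  from DERIV_cmult[OF this, of "c / 2"] show ?thesis
    by (simp add: theta_def[abs_def] has_real_derivative_iff_has_vector_derivative)
qed

lemma theta_0: "theta c \<kappa> 0 = 0"
  by (simp add: theta_def zero_ereal_def[symmetric])

text \<open>Since \<open>u\<close> and \<open>\<i> u\<close> are orthogonal, \<open>W\<close> is determined by its pairings with them.\<close>

lemma W_decomp:
  assumes "x \<noteq> 0"
  shows "W x = u x * Complex ((u x \<bullet> W x) / (cmod (u x))\<^sup>2) (c / 2 * (eta c \<kappa> x / (1 - eta c \<kappa> x)))"
proof -
  have r: "(cmod (u x))\<^sup>2 \<noteq> 0" using u_nz[of x] by simp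
  have "of_real ((cmod (u x))\<^sup>2) * W x = u x * Complex (u x \<bullet> W x) ((\<i> * u x) \<bullet> W x)"
    unfolding cmod_power2 by (simp add: complex_eq_iff inner_complex_def algebra_simps power2_eq_square)
  then have "W x = u x * (Complex (u x \<bullet> W x) ((\<i> * u x) \<bullet> W x) / of_real ((cmod (u x))\<^sup>2))"
    using r by (simp add: field_simps)
  also have "Complex (u x \<bullet> W x) ((\<i> * u x) \<bullet> W x) / of_real ((cmod (u x))\<^sup>2) =
      Complex ((u x \<bullet> W x) / (cmod (u x))\<^sup>2) (c / 2 * (eta c \<kappa> x / (1 - eta c \<kappa> x)))"
    unfolding momentum_line[OF assms] by (simp add: complex_eq_iff eta_u)
  finally show ?thesis .
qed

text \<open>By \<open>W_decomp\<close> the quotient u' / u has real part (ln |u|)' and imaginary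
  part \<theta>', so u / |u| times exp(-\<i> \<theta>) has derivative zero off the origin.\<close>

lemma phase_const: "u x * exp (- (\<i> * of_real (theta c \<kappa> x))) / of_real (cmod (u x)) = u 0 / of_real (cmod (u 0))"
proof -
  define E where "E x = exp (- (\<i> * of_real (theta c \<kappa> x)))" for x
  define q where "q x = inverse (cmod (u x)) *\<^sub>R (u x * E x)" for x
  have E_deriv: "(E has_vector_derivative - (\<i> * of_real (c / 2 * (eta c \<kappa> x / (1 - eta c \<kappa> x)))) * E x) (at x)" for x
  proof -
    have "((\<lambda>x. - (\<i> * of_real (theta c \<kappa> x))) has_vector_derivative
       - (\<i> * of_real (c / 2 * (eta c \<kappa> x / (1 - eta c \<kappa> x))))) (at x)"
      by (intro has_vector_derivative_minus has_vector_derivative_mult_right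
          has_vector_derivative_of_real theta_deriv)
    from field_vector_diff_chain_at[OF this DERIV_exp] show ?thesis
      by (simp add: E_def[abs_def] o_def)
  qed
  have r_deriv: "((\<lambda>x. inverse (cmod (u x))) has_real_derivative - (u x \<bullet> W x) / cmod (u x) ^ 3) (at x)"
    if "x \<noteq> 0" for x
  proof -
    have "((\<lambda>x. u x \<bullet> u x) has_real_derivative u x \<bullet> W x + W x \<bullet> u x) (at x)"
      by (intro has_real_derivative_inner u_deriv that)
    then have "((\<lambda>x. sqrt (u x \<bullet> u x)) has_real_derivative inverse (sqrt (u x \<bullet> u x)) / 2 * (u x \<bullet> W x + W x \<bullet> u x)) (at x)"
      by (rule DERIV_chain2[OF DERIV_real_sqrt, rotated]) (use u_nz in simp)
    then have "((\<lambda>x. cmod (u x)) has_real_derivative (u x \<bullet> W x) / cmod (u x)) (at x)"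
      unfolding norm_eq_sqrt_inner[symmetric] inner_commute[of "W x" "u x"]
      by (simp add: inverse_eq_divide)
    note D = this
    have "- (a / n * inverse (n ^ Suc (Suc 0))) = - a / n ^ 3" for a n :: real
      by (simp add: inverse_eq_divide power3_eq_cube)
    then show ?thesis by (rule DERIV_cong[OF DERIV_inverse_fun[OF D], rotated]) (simp add: u_nz)
  qed
  have q_deriv: "(q has_vector_derivative 0) (at x)" if "x \<noteq> 0" for x
  proof -
    have nz: "cmod (u x) \<noteq> 0" using u_nz by simp
    let ?t = "c / 2 * (eta c \<kappa> x / (1 - eta c \<kappa> x))"
    have "(q has_vector_derivative (inverse (cmod (u x)) *\<^sub>R (u x * (- (\<i> * of_real ?t) * E x) + W x * E x)
        + (- (u x \<bullet> W x) / cmod (u x) ^ 3) *\<^sub>R (u x * E x))) (at x)"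
      unfolding q_def[abs_def]
      by (intro has_vector_derivative_scaleR r_deriv has_vector_derivative_mult u_deriv E_deriv that)
    also have "u x * (- (\<i> * of_real ?t) * E x) + W x * E x = ((u x \<bullet> W x) / (cmod (u x))\<^sup>2) *\<^sub>R (u x * E x)"
    proof -
      have "W x = u x * (of_real ((u x \<bullet> W x) / (cmod (u x))\<^sup>2) + \<i> * of_real ?t)"
        using W_decomp[OF that] by (simp only: Complex_eq)
      then have WE: "W x * E x = u x * (of_real ((u x \<bullet> W x) / (cmod (u x))\<^sup>2) + \<i> * of_real ?t) * E x"
        by simp
      show ?thesis unfolding WE by (simp add: scaleR_conv_of_real algebra_simps)
    qed
    also have "inverse (cmod (u x)) *\<^sub>R ((u x \<bullet> W x) / (cmod (u x))\<^sup>2) *\<^sub>R (u x * E x)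
        + (- (u x \<bullet> W x) / cmod (u x) ^ 3) *\<^sub>R (u x * E x) = 0"
    proof -
      have "inverse (cmod (u x)) * ((u x \<bullet> W x) / (cmod (u x))\<^sup>2) + - (u x \<bullet> W x) / cmod (u x) ^ 3 = 0"
        using nz by (simp add: field_simps power2_eq_square power3_eq_cube)
      then show ?thesis by (metis scaleR_scaleR scaleR_add_left scaleR_zero_left)
    qed
    finally show ?thesis .
  qed
  have E_cont: "continuous_on UNIV E"
    by (intro continuous_at_imp_continuous_on ballI has_vector_derivative_continuous[OF E_deriv])
  have "q x = q 0"
  proof (rule has_derivative_zero_unique_strong_connected[where f = q and S = UNIV and K = "{0}" and c = 0])
    show "continuous_on UNIV q"
      unfolding q_def[abs_def] using u_nz by (intro continuous_intros u_cont E_cont) auto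
    show "(q has_derivative (\<lambda>h. 0)) (at x within UNIV)" if "x \<in> UNIV - {0}" for x
      using q_deriv[of x] that by (simp add: has_vector_derivative_def)
  qed auto
  moreover have "q y = u y * exp (- (\<i> * of_real (theta c \<kappa> y))) / of_real (cmod (u y))" for y
    unfolding q_def E_def by (simp add: scaleR_conv_of_real inverse_eq_divide)
  ultimately show ?thesis by (simp only: theta_0) simp
qed

lemma conclusion:
  shows "(\<exists>\<alpha>. cmod \<alpha> = 1 \<and>
            (\<forall>x. u x = \<alpha> * (of_real (sqrt (1 - eta c \<kappa> x)) * exp (\<i> * of_real (theta c \<kappa> x)))))
         \<and> nondiff_set u = {0}"
proof
  define \<alpha> where "\<alpha> = u 0 / of_real (cmod (u 0))"
  have "cmod \<alpha> = 1" using u_nz[of 0] by (simp add: \<alpha>_def norm_divide)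
  moreover have "u x = \<alpha> * (of_real (sqrt (1 - eta c \<kappa> x)) * exp (\<i> * of_real (theta c \<kappa> x)))" for x
  proof -
    have "sqrt (1 - eta c \<kappa> x) = cmod (u x)" by (simp add: eta_u)
    then show ?thesis
      unfolding \<alpha>_def phase_const[of x, symmetric] using u_nz[of x] by (simp add: exp_minus)
  qed
  ultimately show "\<exists>\<alpha>. cmod \<alpha> = 1 \<and>
            (\<forall>x. u x = \<alpha> * (of_real (sqrt (1 - eta c \<kappa> x)) * exp (\<i> * of_real (theta c \<kappa> x))))"
    by (intro exI[of _ \<alpha>]) simp
  have "u differentiable (at x)" if "x \<noteq> 0" for x
    using u_deriv[OF that] by (rule differentiableI_vector)
  moreover have "\<not> u differentiable (at 0)"
  proof
    assume "u differentiable (at 0)"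
    then have "(\<lambda>x. 1 - u x \<bullet> u x) differentiable (at 0)"
      by (intro differentiable_diff differentiable_inner) auto
    moreover have "\<not> (\<lambda>x. 1 - u x \<bullet> u x) differentiable (at 0)"
      by (rule right.not_differentiable) (simp add: right.\<eta>_def power2_norm_eq_inner)
    ultimately show False by simp
  qed
  ultimately show "nondiff_set u = {0}" by (auto simp: nondiff_set_def)
qed

end

section \<open>From weak to classical solutions\<close>

lemma test_functions_scaleR:
  assumes "(\<psi> :: real \<Rightarrow> real) \<in> test_functions"
  shows "(\<lambda>x. \<psi> x *\<^sub>R e) \<in> test_functions"
proof -
  obtain N where N: "\<And>x. x \<notin> {-N..N} \<Longrightarrow> \<psi> x = 0" using test_functions_support[OF assms] by metis
  show ?thesis
    by (rule test_functionsI[OF smooth_scaleR[OF test_functions_smooth[OF assms]], of "-N" N]) (simp add: N)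
qed

text \<open>The equation provides a weak derivative for a combination V of u and its weak
  derivative. The continuous representative of V is solved for a continuous W off the origin, and
  this continuity makes u and V continuously differentiable there.\<close>

lemma weak_solution_imp_tw_line:
  assumes param: "(c, \<kappa>) \<in> D_tilde" and sol: "TW_weak_solution c \<kappa> u" and Gam: "Gamma_set \<kappa> u = {0}"
  obtains W where "tw_line c \<kappa> u W"
proof -
  interpret tw_param c \<kappa> by unfold_locales (rule param)
  define w where "w = weak_deriv u"
  have en: "u \<in> energy_space" using sol by (simp add: TW_weak_solution_def)
  have u_cont: "continuous_on UNIV u" using en by (simp add: energy_space_def)
  have hw: "has_weak_deriv u w"
    using en has_weak_deriv_weak_deriv unfolding energy_space_def H1_loc_def w_def by blast
  have wL2: "w \<in> L2" and etaL2: "(\<lambda>x. 1 - (cmod (u x))\<^sup>2) \<in> L2"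
    using en by (simp_all add: energy_space_def w_def)
  have wm[measurable]: "w \<in> borel_measurable lebesgue" and w2: "integrable lebesgue (\<lambda>x. (cmod (w x))\<^sup>2)"
    using wL2 by (simp_all add: L2_def)
  have um[measurable]: "u \<in> borel_measurable lebesgue" by (rule continuous_lebesgue_measurable[OF u_cont])
  note wi = has_weak_derivD(2)[OF hw]
  have w2i: "set_integrable lebesgue {a..b} (\<lambda>x. (cmod (w x))\<^sup>2)" for a b
    unfolding set_integrable_def by (rule integrable_mult_indicator[OF _ w2]) simp
  \<comment> \<open>Expanding the derivative of <u, \<phi>> and collecting terms, the integrand
    becomes <G, \<phi>> - <V, \<phi>'>.\<close>
  define V where "V x = w x - (2 * \<kappa> * (u x \<bullet> w x)) *\<^sub>R u x" for x
  define G where "G x = \<i> * of_real c * w x + (1 - (cmod (u x))\<^sup>2) *\<^sub>R u x + (2 * \<kappa> * (u x \<bullet> w x)) *\<^sub>R w x" for x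
  have Vm: "V \<in> borel_measurable lebesgue" unfolding V_def[abs_def] by measurable
  have Vi: "set_integrable lebesgue {a..b} V" for a b
  proof (rule set_integrable_bound_Icc[OF wi Vm])
    show "continuous_on {a..b} (\<lambda>x. 1 + 2 * \<kappa> * (cmod (u x))\<^sup>2)"
      by (intro continuous_intros continuous_on_subset[OF u_cont]) auto
    show "norm (V x) \<le> (1 + 2 * \<kappa> * (cmod (u x))\<^sup>2) * norm (w x)" for x
    proof -
      have "norm (V x) \<le> norm (w x) + norm ((2 * \<kappa> * (u x \<bullet> w x)) *\<^sub>R u x)"
        unfolding V_def by (rule norm_triangle_ineq4)
      also have "norm ((2 * \<kappa> * (u x \<bullet> w x)) *\<^sub>R u x) = 2 * \<kappa> * norm (u x) * \<bar>u x \<bullet> w x\<bar>"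
        using kappa_pos by (simp add: abs_mult)
      also have "\<dots> \<le> 2 * \<kappa> * norm (u x) * (norm (u x) * norm (w x))"
        using kappa_pos by (intro mult_left_mono Cauchy_Schwarz_ineq2) auto
      finally show ?thesis by (simp add: algebra_simps power2_eq_square)
    qed
  qed
  have Gi: "set_integrable lebesgue {a..b} G" for a b
    unfolding G_def[abs_def]
  proof (intro set_integral_add)
    show "set_integrable lebesgue {a..b} (\<lambda>x. \<i> * of_real c * w x)"
    proof (rule set_integrable_bound_Icc[OF wi])
      show "(\<lambda>x. \<i> * of_real c * w x) \<in> borel_measurable lebesgue" by measurable
      show "norm (\<i> * of_real c * w x) \<le> \<bar>c\<bar> * norm (w x)" for x by (simp add: norm_mult)
    qed simp
    show "set_integrable lebesgue {a..b} (\<lambda>x. (1 - (cmod (u x))\<^sup>2) *\<^sub>R u x)"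
      by (intro continuous_set_integrable continuous_intros u_cont)
    \<comment> \<open>This term is quadratic in w, so its local integrability rests on w being
      square integrable.\<close>
    show "set_integrable lebesgue {a..b} (\<lambda>x. (2 * \<kappa> * (u x \<bullet> w x)) *\<^sub>R w x)"
    proof (rule set_integrable_bound_Icc[OF w2i])
      show "(\<lambda>x. (2 * \<kappa> * (u x \<bullet> w x)) *\<^sub>R w x) \<in> borel_measurable lebesgue" by measurable
      show "continuous_on {a..b} (\<lambda>x. 2 * \<kappa> * cmod (u x))"
        by (intro continuous_intros continuous_on_subset[OF u_cont]) auto
      show "norm ((2 * \<kappa> * (u x \<bullet> w x)) *\<^sub>R w x) \<le> 2 * \<kappa> * cmod (u x) * norm ((cmod (w x))\<^sup>2)" for x
      proof -
        have "norm ((2 * \<kappa> * (u x \<bullet> w x)) *\<^sub>R w x) = 2 * \<kappa> * norm (w x) * \<bar>u x \<bullet> w x\<bar>"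
          using kappa_pos by (simp add: abs_mult)
        also have "\<dots> \<le> 2 * \<kappa> * norm (w x) * (norm (u x) * norm (w x))"
          using kappa_pos by (intro mult_left_mono Cauchy_Schwarz_ineq2) auto
        finally show ?thesis by (simp add: power2_eq_square mult_ac)
      qed
    qed
  qed
  have weak: "(LINT x|lebesgue. vderiv \<psi> x *\<^sub>R V x) = - (LINT x|lebesgue. \<psi> x *\<^sub>R - G x)"
    if \<psi>: "\<psi> \<in> test_functions" for \<psi> :: "real \<Rightarrow> real"
  proof -
    have i: "integrable lebesgue (\<lambda>x. vderiv \<psi> x *\<^sub>R V x)" "integrable lebesgue (\<lambda>x. \<psi> x *\<^sub>R G x)"
      by (rule test_scaleR_integrable[OF test_functions_vderiv[OF \<psi>] Vi], rule test_scaleR_integrable[OF \<psi> Gi])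
    have sm: "smooth \<psi>" by (rule test_functions_smooth[OF \<psi>])
    have [measurable]: "\<psi> \<in> borel_measurable lebesgue" "vderiv \<psi> \<in> borel_measurable lebesgue"
      by (intro continuous_lebesgue_measurable smooth_continuous smooth_vderiv sm)+
    \<comment> \<open>Testing with \<psi> e for every fixed direction e turns the scalar equation
      into one between complex integrals.\<close>
    have "(LINT x|lebesgue. vderiv \<psi> x *\<^sub>R V x) \<bullet> e = (LINT x|lebesgue. \<psi> x *\<^sub>R G x) \<bullet> e" for e
    proof -
      note hp = has_weak_deriv_test_times_inner[OF hw \<psi>, of e]
      have [measurable]: "weak_deriv (\<lambda>x. \<psi> x * (u x \<bullet> e)) \<in> borel_measurable lebesgue"
        by (rule locally_integrable_measurable[OF has_weak_derivD(2)[OF has_weak_deriv_weak_deriv[OF hp]]])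
      have [measurable]: "G \<in> borel_measurable lebesgue" "V \<in> borel_measurable lebesgue"
        by (rule locally_integrable_measurable[OF Gi], rule Vm)
      have eq: "(\<lambda>y. u y \<bullet> (\<psi> y *\<^sub>R e)) = (\<lambda>y. \<psi> y * (u y \<bullet> e))" by simp
      have "(LINT x|lebesgue.
          (\<i> * of_real c * weak_deriv u x + u x * of_real (1 - (cmod (u x))\<^sup>2)) \<bullet> (\<psi> x *\<^sub>R e)
          - weak_deriv u x \<bullet> vderiv (\<lambda>x. \<psi> x *\<^sub>R e) x
          + 2 * \<kappa> * (u x \<bullet> weak_deriv u x) * weak_deriv (\<lambda>y. u y \<bullet> (\<psi> y *\<^sub>R e)) x) = 0"
        using sol test_functions_scaleR[OF \<psi>, of e] unfolding TW_weak_solution_def by blast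
      then have "0 = (LINT x|lebesgue.
          (\<i> * of_real c * w x + u x * of_real (1 - (cmod (u x))\<^sup>2)) \<bullet> (\<psi> x *\<^sub>R e)
          - w x \<bullet> (vderiv \<psi> x *\<^sub>R e) + 2 * \<kappa> * (u x \<bullet> w x) * weak_deriv (\<lambda>x. \<psi> x * (u x \<bullet> e)) x)"
        unfolding vderiv_scaleR_const[OF sm] eq w_def[symmetric] by (rule sym)
      also have "\<dots> = (LINT x|lebesgue. (\<psi> x *\<^sub>R G x) \<bullet> e - (vderiv \<psi> x *\<^sub>R V x) \<bullet> e)"
      proof (rule integral_cong_AE)
        show "AE x in lebesgue.
          (\<i> * of_real c * w x + u x * of_real (1 - (cmod (u x))\<^sup>2)) \<bullet> (\<psi> x *\<^sub>R e)
          - w x \<bullet> (vderiv \<psi> x *\<^sub>R e) + 2 * \<kappa> * (u x \<bullet> w x) * weak_deriv (\<lambda>x. \<psi> x * (u x \<bullet> e)) x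
          = (\<psi> x *\<^sub>R G x) \<bullet> e - (vderiv \<psi> x *\<^sub>R V x) \<bullet> e"
          using weak_deriv_AE_unique[OF hp]
          by eventually_elim (simp add: G_def V_def inner_complex_def algebra_simps)
      qed measurable
      also have "\<dots> = (LINT x|lebesgue. \<psi> x *\<^sub>R G x) \<bullet> e - (LINT x|lebesgue. vderiv \<psi> x *\<^sub>R V x) \<bullet> e"
        using i by (simp del: inner_scaleR_left)
      finally show ?thesis by simp
    qed
    then have "(LINT x|lebesgue. vderiv \<psi> x *\<^sub>R V x) = (LINT x|lebesgue. \<psi> x *\<^sub>R G x)"
      by (rule euclidean_eqI)
    then show ?thesis by simp
  qed
  have hV: "has_weak_deriv V (\<lambda>x. - G x)"
    unfolding has_weak_deriv_def using Vi Gi weak by (auto simp: set_integrable_def)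
  obtain Vc where Vc: "continuous_on UNIV Vc" "AE x in lebesgue. V x = Vc x"
    "\<And>s t. s \<le> t \<Longrightarrow> Vc t - Vc s = (LINT x:{s..t}|lebesgue. - G x)"
    by (rule has_weak_deriv_primitive[OF hV]) blast
  obtain U where U: "continuous_on UNIV U" "AE x in lebesgue. u x = U x"
    "\<And>s t. s \<le> t \<Longrightarrow> U t - U s = (LINT x:{s..t}|lebesgue. w x)"
    by (rule has_weak_deriv_primitive[OF hw]) blast
  \<comment> \<open>Increments of u itself, not merely of a representative, are now integrals of
    w.\<close>
  have uU: "u = U" by (rule continuous_AE_eq_imp_eq[OF u_cont U(1,2)])
  define \<delta> where "\<delta> x = 1 - 2 * \<kappa> * (u x \<bullet> u x)" for x
  have \<delta>: "\<delta> x \<noteq> 0" if "x \<noteq> 0" for x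
  proof
    assume "\<delta> x = 0"
    then have "x \<in> Gamma_set \<kappa> u"
      using kappa_pos by (simp add: \<delta>_def Gamma_set_def power2_norm_eq_inner field_simps)
    with Gam that show False by simp
  qed
  \<comment> \<open>Pairing V = w - 2 \<kappa> <u, w> u with u gives <u, V> = \<delta> <u, w>, and
    substituting back solves for w. The formula is applied to the continuous representative of
    V.\<close>
  define W where "W x = Vc x + (2 * \<kappa> * (u x \<bullet> Vc x) / \<delta> x) *\<^sub>R u x" for x
  have W_cont: "continuous_on (- {0}) W"
    unfolding W_def[abs_def] \<delta>_def using \<delta>
    by (intro continuous_intros continuous_on_subset[OF u_cont] continuous_on_subset[OF Vc(1)]) (auto simp: \<delta>_def)
  have ae0: "AE x in lebesgue. x \<noteq> (0::real)" by (intro AE_completion AE_lborel_singleton)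
  have wW: "AE x in lebesgue. w x = W x"
    using Vc(2) ae0
  proof eventually_elim
    case (elim x)
    have "u x \<bullet> Vc x = (u x \<bullet> w x) * \<delta> x"
      unfolding elim(1)[symmetric] by (simp add: V_def \<delta>_def inner_diff_right algebra_simps)
    then show ?case
      using \<delta>[OF elim(2)] by (simp add: W_def elim(1)[symmetric]) (simp add: V_def)
  qed
  have VW: "W x - (2 * \<kappa> * (u x \<bullet> W x)) *\<^sub>R u x = Vc x" if "x \<noteq> 0" for x
  proof -
    have "u x \<bullet> W x = (u x \<bullet> Vc x) / \<delta> x"
      using \<delta>[OF that] by (simp add: W_def inner_add_right field_simps) (simp add: \<delta>_def algebra_simps)
    then show ?thesis by (simp add: W_def)
  qed
  define h where "h x = - (\<i> * of_real c * W x + (1 - (cmod (u x))\<^sup>2) *\<^sub>R u x + (2 * \<kappa> * (u x \<bullet> W x)) *\<^sub>R W x)" for x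
  have "tw_line c \<kappa> u W"
  proof
    show "(u has_vector_derivative W x) (at x)" if "x \<noteq> 0" for x
      by (rule primitive_has_vector_derivative[OF wi U(3)[folded uU] wW _ _ W_cont]) (use that in auto)
    show "((\<lambda>x. W x - (2 * \<kappa> * (u x \<bullet> W x)) *\<^sub>R u x) has_vector_derivative
       - (\<i> * of_real c * W x + (1 - (cmod (u x))\<^sup>2) *\<^sub>R u x + (2 * \<kappa> * (u x \<bullet> W x)) *\<^sub>R W x)) (at x)"
      if x: "x \<noteq> 0" for x
    proof -
      have "(Vc has_vector_derivative h x) (at x)"
      proof (rule primitive_has_vector_derivative[OF has_weak_derivD(2)[OF hV] Vc(3), where S = "- {0}"])
        show "AE x in lebesgue. - G x = h x" using wW by eventually_elim (simp add: G_def h_def)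
        show "continuous_on (- {0}) h" unfolding h_def[abs_def]
          by (intro continuous_intros continuous_on_subset[OF u_cont] W_cont) auto
      qed (use x in auto)
      then have "((\<lambda>x. W x - (2 * \<kappa> * (u x \<bullet> W x)) *\<^sub>R u x) has_vector_derivative h x) (at x)"
        by (rule has_vector_derivative_transform_within_open[where S = "- {0}"]) (use x VW in auto)
      then show ?thesis by (simp add: h_def)
    qed
    define f where "f x = (norm (1 - (cmod (u x))\<^sup>2))\<^sup>2 + (cmod (w x))\<^sup>2" for x
    have f: "integrable lebesgue f" "\<And>x. f x \<ge> 0"
      using etaL2 w2 unfolding f_def[abs_def] by (auto simp: L2_def)
    have fh: "AE x in lebesgue. f x = (1 - (cmod (u x))\<^sup>2)\<^sup>2 + (cmod (W x))\<^sup>2"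
      using wW by eventually_elim (simp add: f_def)
    fix e :: real assume e: "e > 0"
    show "\<exists>x>0. (1 - (cmod (u x))\<^sup>2)\<^sup>2 + (cmod (W x))\<^sup>2 < e"
      using integrable_small_on_long_intervals[OF f fh e, of "\<lambda>n. {0<..<real n}" "\<lambda>n. 0"] by auto
    show "\<exists>x<0. (1 - (cmod (u x))\<^sup>2)\<^sup>2 + (cmod (W x))\<^sup>2 < e"
      using integrable_small_on_long_intervals[OF f fh e, of "\<lambda>n. {- real n<..<0}" "\<lambda>n. - real n"] by auto
  qed (rule u_cont Gam W_cont)+
  then show ?thesis by (rule that)
qed

theorem corollary1p4:
  fixes c \<kappa> :: real and u :: "real \<Rightarrow> complex"
  assumes "(c, \<kappa>) \<in> D_tilde"
    and "u \<in> energy_space"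
    and "TW_weak_solution c \<kappa> u"
    and "\<not> trivial_solution u"
    and "Gamma_set \<kappa> u = {0}"
  shows "(\<exists>\<alpha>. cmod \<alpha> = 1 \<and>
            (\<forall>x. u x = \<alpha> * (of_real (sqrt (1 - eta c \<kappa> x)) * exp (\<i> * of_real (theta c \<kappa> x)))))
         \<and> nondiff_set u = {0}"
proof -
  obtain W where "tw_line c \<kappa> u W"
    by (rule weak_solution_imp_tw_line[OF assms(1,3,5)])
  then interpret tw_line c \<kappa> u W .
  show ?thesis by (rule conclusion)
qed

end
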